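(* Let $(\mathfrak g,D,\rho,\mu)$ be a pre-LieDer pair with pre-Lie product $\pi$ and representation space $V$, and put $\alpha=(s^{-1}(\pi+\rho+\mu),D)$. Then $(s^{-1}L'\oplus\mathfrak h,\{l_k^{\alpha}\}_{k=1}^{+\infty})$ is an $L_\infty$-algebra, where the $l_k^\alpha$ are given by $$l_1^{\alpha}(s^{-1}f,\theta)=l_2\big((s^{-1}(\pi+\rho+\mu),D),(s^{-1}f,\theta)\big),$$ $$l_2^{\alpha}\big((s^{-1}f_1,\theta_1),(s^{-1}f_2,\theta_2)\big)=l_2\big((s^{-1}f_1,\theta_1),(s^{-1}f_2,\theta_2)\big),$$ $$l_k^{\alpha}\big((s^{-1}f_1,\theta_1),\dots,(s^{-1}f_k,\theta_k)\big)=0,\quad k\ge3.$$ Furthermore, for all $\pi'\in\mathrm{Hom}(\mathfrak g\otimes\mathfrak g,\mathfrak g)$, $\rho'\in\mathrm{Hom}(\mathfrak g\otimes V,V)$, $\mu'\in\mathrm{Hom}(V\otimes\mathfrak g,V)$ and $D'\in\mathrm{Hom}(\mathfrak g,V)$, $(\mathfrak g,\pi+\pi',D+D',\rho+\rho',\mu+\mu')$ is a pre-LieDer pair if and only if $(s^{-1}(\pi'+\rho'+\mu'),D')$ is a Maurer-Cartan element of the twisted $L_\infty$-algebra $(s^{-1}L'\oplus\mathfrak h,\{l_k^{\alpha}\}_{k=1}^{+\infty})$.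
   Context: All vector spaces are over an algebraically closed field $\mathbb K$ of characteristic $0$. Pre-Lie algebra: a vector space $\mathfrak g$ with a bilinear product $\cdot$ (also denoted $\pi$) such that $(x\cdot y)\cdot z-x\cdot(y\cdot z)=(y\cdot x)\cdot z-y\cdot(x\cdot z)$. Its sub-adjacent Lie algebra $\mathfrak g^C$ has bracket $[x,y]_C=x\cdot y-y\cdot x$. A representation $(V;\rho,\mu)$ consists of a representation $\rho:\mathfrak g\to\mathfrak{gl}(V)$ of the Lie algebra $\mathfrak g^C$ and a linear map $\mu:\mathfrak g\to\mathfrak{gl}(V)$ with $\mu(y)\mu(x)-\mu(x\cdot y)=\mu(y)\rho(x)-\rho(x)\mu(y)$. A pre-LieDer pair $(\mathfrak g,D,\rho,\mu)$, also written $(\mathfrak g,\pi,D,\rho,\mu)$, is a pre-Lie algebra $(\mathfrak g,\pi)$ with a representation $(V;\rho,\mu)$ and a derivation, i.e. a linear map $D:\mathfrak g\to V$ with $D(x\cdot y)=\rho(x)D(y)+\mu(y)D(x)$. We write $\rho(x,v)=\rho(x)v$ and $\mu(v,x)=\mu(x)v$. Matsushima-Nijenhuis bracket: for a vector space $W$, $C^n(W;W)=\mathrm{Hom}(\wedge^{n-1}W\otimes W,W)$, $n\ge1$, whose elements have degree $n-1$. For $P\in C^{p+1}(W;W)$, $Q\in C^{q+1}(W;W)$, $[P,Q]^{MN}=P\circ Q-(-1)^{pq}Q\circ P$, where $$(P\circ Q)(x_1,\dots,x_{p+q+1})=\sum_{\sigma\in\mathbb S_{(q,1,p-1)}}\mathrm{sgn}(\sigma)P(Q(x_{\sigma(1)},\dots,x_{\sigma(q+1)}),x_{\sigma(q+2)},\dots,x_{\sigma(p+q)},x_{p+q+1})$$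 $$+(-1)^{pq}\sum_{\sigma\in\mathbb S_{(p,q)}}\mathrm{sgn}(\sigma)P(x_{\sigma(1)},\dots,x_{\sigma(p)},Q(x_{\sigma(p+1)},\dots,x_{\sigma(p+q)},x_{p+q+1})),$$ with $\mathbb S_{(i_1,\dots,i_k)}$ the unshuffles (first sum absent if $p=0$). This makes $C^*(W;W)$ a graded Lie algebra. Take $W=\mathfrak g\oplus V$. Let $L'=\bigoplus_{n\ge0}L'^{\,n}$ with $L'^{\,n}=\mathrm{Hom}(\wedge^n\mathfrak g\otimes\mathfrak g,\mathfrak g)\oplus\mathrm{Hom}(\wedge^n\mathfrak g\otimes V,V)\oplus\mathrm{Hom}(\wedge^{n-1}\mathfrak g\otimes V\otimes\mathfrak g,V)$ in degree $n$ (third summand absent for $n=0$), and $\mathfrak h=\bigoplus_{n\ge1}\mathrm{Hom}(\wedge^{n-1}\mathfrak g\otimes\mathfrak g,V)$, the $n$-th summand in degree $n-1$. Both are viewed inside $C^*(W;W)$ by horizontal lifts: for $f$ in $\mathrm{Hom}(\wedge^{m-1}\mathfrak g\otimes\mathfrak g,\mathfrak g)$ or $\mathrm{Hom}(\wedge^{m-1}\mathfrak g\otimes\mathfrak g,V)$, $\hat f(x_1+v_1,\dots,x_m+v_m)=f(x_1,\dots,x_m)$; for $f\in\mathrm{Hom}(\wedge^{m-1}\mathfrak g\otimes V,V)$, $\hat f(\dots)=f(x_1,\dots,x_{m-1},v_m)$; for $f\in\mathrm{Hom}(\wedge^{m-2}\mathfrak g\otimes V\otimes\mathfrak g,V)$,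 $\hat f(\dots)=\sum_{i=1}^{m-1}(-1)^{m-1-i}f(x_1,\dots,\hat{x_i},\dots,x_{m-1},v_i,x_m)$. $L'$ is a graded Lie subalgebra, and $[f,\theta]^{MN}\in\mathfrak h$ for $f\in L'$, $\theta\in\mathfrak h$. $(s^{-1}L')^i=L'^{\,i+1}$. An $L_\infty$-algebra is a $\mathbb Z$-graded vector space with degree $1$ graded symmetric multilinear maps $l_k$, $k\ge1$, satisfying $\sum_{i=1}^n\sum_{\sigma\in\mathbb S_{(i,n-i)}}\varepsilon(\sigma)l_{n-i+1}(l_i(x_{\sigma(1)},\dots,x_{\sigma(i)}),x_{\sigma(i+1)},\dots,x_{\sigma(n)})=0$ for all $n\ge1$, with $\varepsilon(\sigma)$ the Koszul sign. A Maurer-Cartan element is a degree $0$ element $\alpha$ with $\sum_{k\ge1}\frac1{k!}l_k(\alpha,\dots,\alpha)=0$. The twist of $\{l_k\}$ by a Maurer-Cartan element $\alpha$ is $l_k^\alpha(x_1,\dots,x_k)=\sum_{n\ge0}\frac1{n!}l_{k+n}(\alpha,\dots,\alpha,x_1,\dots,x_k)$ ($n$ copies of $\alpha$). The untwisted $L_\infty$-structure on $s^{-1}L'\oplus\mathfrak h$ has as only nonzero operations (up to permutation of arguments, extended multilinearly) $l_2(s^{-1}f,s^{-1}g)=(-1)^{|f|}s^{-1}[f,g]^{MN}$ and $l_2(s^{-1}f,\theta)=[f,\theta]^{MN}$ for homogeneous $f,g\in L'$ ($|f|$ the degree in $L'$) and $\theta\in\mathfrak h$. *)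

theory Defs
  imports
    "HOL-Analysis.Product_Vector"
    "HOL-Combinatorics.Permutations"
    "HOL-Computational_Algebra.Polynomial"
    "HOL-Library.Function_Algebras"
begin

text \<open>
  Vector spaces over \<open>'k\<close> are types of class \<open>ab_group_add\<close> with an explicit scalar multiplication
  satisfying \<open>vector_space\<close>; spaces of functions carry the pointwise addition.
\<close>

section \<open>Pre-LieDer pairs\<close>

definition bilinear_map ::
  "('k::field \<Rightarrow> 'a::ab_group_add \<Rightarrow> 'a) \<Rightarrow> ('k \<Rightarrow> 'b::ab_group_add \<Rightarrow> 'b) \<Rightarrow>
   ('k \<Rightarrow> 'c::ab_group_add \<Rightarrow> 'c) \<Rightarrow> ('a \<Rightarrow> 'b \<Rightarrow> 'c) \<Rightarrow> bool" where
  "bilinear_map sA sB sC f \<longleftrightarrow>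
     (\<forall>x. Vector_Spaces.linear sB sC (f x)) \<and>
     (\<forall>y. Vector_Spaces.linear sA sC (\<lambda>x. f x y))"

definition pre_Lie_algebra ::
  "('k::field \<Rightarrow> 'g::ab_group_add \<Rightarrow> 'g) \<Rightarrow> ('g \<Rightarrow> 'g \<Rightarrow> 'g) \<Rightarrow> bool" where
  "pre_Lie_algebra sG \<pi> \<longleftrightarrow>
     vector_space sG \<and> bilinear_map sG sG sG \<pi> \<and>
     (\<forall>x y z. \<pi> (\<pi> x y) z - \<pi> x (\<pi> y z) = \<pi> (\<pi> y x) z - \<pi> y (\<pi> x z))"

definition sub_adjacent_bracket :: "('g \<Rightarrow> 'g \<Rightarrow> 'g::ab_group_add) \<Rightarrow> 'g \<Rightarrow> 'g \<Rightarrow> 'g" where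
  "sub_adjacent_bracket \<pi> x y = \<pi> x y - \<pi> y x"

text \<open>Here \<open>\<rho> x v\<close> is \<open>\<rho>(x)v\<close> and \<open>\<mu> x v\<close> is \<open>\<mu>(x)v\<close>.\<close>

definition pre_Lie_representation ::
  "('k::field \<Rightarrow> 'g::ab_group_add \<Rightarrow> 'g) \<Rightarrow> ('k \<Rightarrow> 'v::ab_group_add \<Rightarrow> 'v) \<Rightarrow>
   ('g \<Rightarrow> 'g \<Rightarrow> 'g) \<Rightarrow> ('g \<Rightarrow> 'v \<Rightarrow> 'v) \<Rightarrow> ('g \<Rightarrow> 'v \<Rightarrow> 'v) \<Rightarrow> bool" where
  "pre_Lie_representation sG sV \<pi> \<rho> \<mu> \<longleftrightarrow>
     vector_space sV \<and> bilinear_map sG sV sV \<rho> \<and> bilinear_map sG sV sV \<mu> \<and>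
     (\<forall>x y v. \<rho> (sub_adjacent_bracket \<pi> x y) v = \<rho> x (\<rho> y v) - \<rho> y (\<rho> x v)) \<and>
     (\<forall>x y v. \<mu> y (\<mu> x v) - \<mu> (\<pi> x y) v = \<mu> y (\<rho> x v) - \<rho> x (\<mu> y v))"

definition pre_LieDer_pair ::
  "('k::field \<Rightarrow> 'g::ab_group_add \<Rightarrow> 'g) \<Rightarrow> ('k \<Rightarrow> 'v::ab_group_add \<Rightarrow> 'v) \<Rightarrow>
   ('g \<Rightarrow> 'g \<Rightarrow> 'g) \<Rightarrow> ('g \<Rightarrow> 'v) \<Rightarrow> ('g \<Rightarrow> 'v \<Rightarrow> 'v) \<Rightarrow> ('g \<Rightarrow> 'v \<Rightarrow> 'v) \<Rightarrow> bool" where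
  "pre_LieDer_pair sG sV \<pi> D \<rho> \<mu> \<longleftrightarrow>
     pre_Lie_algebra sG \<pi> \<and> pre_Lie_representation sG sV \<pi> \<rho> \<mu> \<and>
     Vector_Spaces.linear sG sV D \<and> (\<forall>x y. D (\<pi> x y) = \<rho> x (D y) + \<mu> y (D x))"

section \<open>Unshuffles and Koszul signs\<close>

text \<open>
  Permutations of \<open>{0,\<dots>,n-1}\<close>, \<open>n\<close> the sum of the block sizes, increasing on each block of
  consecutive positions. Throughout, \<open>permute_list \<sigma> xs\<close> is \<open>(x\<^bsub>\<sigma>(1)\<^esub>,\<dots>,x\<^bsub>\<sigma>(n)\<^esub>)\<close>.
\<close>

definition unshuffles :: "nat list \<Rightarrow> (nat \<Rightarrow> nat) set" where
  "unshuffles ks = {\<sigma>. \<sigma> permutes {..<sum_list ks} \<and>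
     (\<forall>j<length ks. strict_mono_on {sum_list (take j ks)..<sum_list (take (Suc j) ks)} \<sigma>)}"

definition koszul_sign :: "int list \<Rightarrow> (nat \<Rightarrow> nat) \<Rightarrow> int" where
  "koszul_sign ds \<sigma> =
     (\<Prod>(i, j) | i < j \<and> j < length ds \<and> \<sigma> j < \<sigma> i.
        if odd (ds ! \<sigma> i * ds ! \<sigma> j) then -1 else 1)"

section \<open>\<open>L\<^sub>\<infinity>\<close>-algebras\<close>

definition multilinear_on ::
  "('k::field \<Rightarrow> 'a::ab_group_add \<Rightarrow> 'a) \<Rightarrow> ('k \<Rightarrow> 'b::ab_group_add \<Rightarrow> 'b) \<Rightarrow>
   'a set \<Rightarrow> nat \<Rightarrow> ('a list \<Rightarrow> 'b) \<Rightarrow> bool" where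
  "multilinear_on sA sB S n F \<longleftrightarrow>
     (\<forall>us vs x y c. length us + 1 + length vs = n \<and> set us \<subseteq> S \<and> set vs \<subseteq> S \<and> x \<in> S \<and> y \<in> S \<longrightarrow>
        F (us @ (x + y) # vs) = F (us @ x # vs) + F (us @ y # vs) \<and>
        F (us @ sA c x # vs) = sB c (F (us @ x # vs)))"

text \<open>A \<open>\<int>\<close>-graded vector space is an independent family of subspaces of an ambient vector space.\<close>

definition graded_vector_space ::
  "('k::field \<Rightarrow> 'e::ab_group_add \<Rightarrow> 'e) \<Rightarrow> (int \<Rightarrow> 'e set) \<Rightarrow> bool" where
  "graded_vector_space s E \<longleftrightarrow>
     vector_space s \<and> (\<forall>i. module.subspace s (E i)) \<and>
     (\<forall>I x. finite I \<and> (\<forall>i\<in>I. x i \<in> E i) \<and> (\<Sum>i\<in>I. x i) = 0 \<longrightarrow> (\<forall>i\<in>I. x i = 0))"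

definition total_space ::
  "('k::field \<Rightarrow> 'e::ab_group_add \<Rightarrow> 'e) \<Rightarrow> (int \<Rightarrow> 'e set) \<Rightarrow> 'e set" where
  "total_space s E = module.span s (\<Union>i. E i)"

definition homogeneous_list :: "(int \<Rightarrow> 'e set) \<Rightarrow> 'e list \<Rightarrow> int list \<Rightarrow> bool" where
  "homogeneous_list E xs ds \<longleftrightarrow> list_all2 (\<lambda>x d. x \<in> E d) xs ds"

text \<open>The operation \<open>l k\<close> is only relevant for \<open>k \<ge> 1\<close> and on lists of length \<open>k\<close>.\<close>

definition L_infinity_algebra ::
  "('k::field \<Rightarrow> 'e::ab_group_add \<Rightarrow> 'e) \<Rightarrow> (int \<Rightarrow> 'e set) \<Rightarrow> (nat \<Rightarrow> 'e list \<Rightarrow> 'e) \<Rightarrow> bool" where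
  "L_infinity_algebra s E l \<longleftrightarrow>
     graded_vector_space s E \<and>
     (\<forall>k\<ge>1. multilinear_on s s (total_space s E) k (l k)) \<and>
     (\<forall>k\<ge>1. \<forall>xs ds. length xs = k \<and> homogeneous_list E xs ds \<longrightarrow> l k xs \<in> E (sum_list ds + 1)) \<and>
     (\<forall>k\<ge>1. \<forall>xs ds \<sigma>. length xs = k \<and> homogeneous_list E xs ds \<and> \<sigma> permutes {..<k} \<longrightarrow>
        l k (permute_list \<sigma> xs) = s (of_int (koszul_sign ds \<sigma>)) (l k xs)) \<and>
     (\<forall>n\<ge>1. \<forall>xs ds. length xs = n \<and> homogeneous_list E xs ds \<longrightarrow>
        (\<Sum>i=1..n. \<Sum>\<sigma>\<in>unshuffles [i, n - i].
           s (of_int (koszul_sign ds \<sigma>))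
             (l (n - i + 1) (l i (take i (permute_list \<sigma> xs)) # drop i (permute_list \<sigma> xs)))) = 0)"

text \<open>
  The two series below are finite sums over their nonzero terms; in the Maurer-Cartan equation
  finiteness is part of the condition.
\<close>

definition maurer_cartan ::
  "('k::field_char_0 \<Rightarrow> 'e::ab_group_add \<Rightarrow> 'e) \<Rightarrow> (int \<Rightarrow> 'e set) \<Rightarrow> (nat \<Rightarrow> 'e list \<Rightarrow> 'e) \<Rightarrow>
   'e \<Rightarrow> bool" where
  "maurer_cartan s E l \<alpha> \<longleftrightarrow>
     \<alpha> \<in> E 0 \<and> finite {k. 1 \<le> k \<and> l k (replicate k \<alpha>) \<noteq> 0} \<and>
     (\<Sum>k | 1 \<le> k \<and> l k (replicate k \<alpha>) \<noteq> 0. s (1 / fact k) (l k (replicate k \<alpha>))) = 0"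

definition twist ::
  "('k::field_char_0 \<Rightarrow> 'e::ab_group_add \<Rightarrow> 'e) \<Rightarrow> (nat \<Rightarrow> 'e list \<Rightarrow> 'e) \<Rightarrow> 'e \<Rightarrow>
   nat \<Rightarrow> 'e list \<Rightarrow> 'e" where
  "twist s l \<alpha> k xs =
     (\<Sum>n | l (k + n) (replicate n \<alpha> @ xs) \<noteq> 0.
        s (1 / fact n) (l (k + n) (replicate n \<alpha> @ xs)))"

section \<open>Cochains and the Matsushima-Nijenhuis bracket\<close>

text \<open>
  \<open>Hom_wedge sA sB sC n\<close> is \<open>Hom(\<and>\<^sup>nA \<otimes> B, C)\<close>. A cochain takes the list of its \<open>n\<close> alternating
  arguments and then the last argument; it is \<open>0\<close> on lists of any other length. So a function of
  this type can be a sum of cochains of different degrees, and its component of degree \<open>n\<close> is its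
  restriction to lists of length \<open>n\<close>.
\<close>

definition Hom_wedge ::
  "('k::field \<Rightarrow> 'a::ab_group_add \<Rightarrow> 'a) \<Rightarrow> ('k \<Rightarrow> 'b::ab_group_add \<Rightarrow> 'b) \<Rightarrow>
   ('k \<Rightarrow> 'c::ab_group_add \<Rightarrow> 'c) \<Rightarrow> nat \<Rightarrow> ('a list \<Rightarrow> 'b \<Rightarrow> 'c) set" where
  "Hom_wedge sA sB sC n = {f.
     (\<forall>b. multilinear_on sA sC UNIV n (\<lambda>xs. f xs b)) \<and>
     (\<forall>xs. Vector_Spaces.linear sB sC (f xs)) \<and>
     (\<forall>xs b. \<not> distinct xs \<longrightarrow> f xs b = 0) \<and>
     (\<forall>xs b. length xs \<noteq> n \<longrightarrow> f xs b = 0)}"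

text \<open>\<open>Hom(\<and>\<^sup>nA \<otimes> B \<otimes> B', C)\<close>.\<close>

definition Hom_wedge2 ::
  "('k::field \<Rightarrow> 'a::ab_group_add \<Rightarrow> 'a) \<Rightarrow> ('k \<Rightarrow> 'b::ab_group_add \<Rightarrow> 'b) \<Rightarrow>
   ('k \<Rightarrow> 'b'::ab_group_add \<Rightarrow> 'b') \<Rightarrow> ('k \<Rightarrow> 'c::ab_group_add \<Rightarrow> 'c) \<Rightarrow> nat \<Rightarrow>
   ('a list \<Rightarrow> 'b \<Rightarrow> 'b' \<Rightarrow> 'c) set" where
  "Hom_wedge2 sA sB sB' sC n = {f.
     (\<forall>b. (\<lambda>xs. f xs b) \<in> Hom_wedge sA sB' sC n) \<and>
     (\<forall>xs b'. Vector_Spaces.linear sB sC (\<lambda>b. f xs b b'))}"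

type_synonym 'w cochain = "'w list \<Rightarrow> 'w \<Rightarrow> 'w"

definition cochain_scale :: "('k \<Rightarrow> 'w \<Rightarrow> 'w) \<Rightarrow> 'k \<Rightarrow> 'w cochain \<Rightarrow> 'w cochain" where
  "cochain_scale s c f = (\<lambda>xs y. s c (f xs y))"

text \<open>\<open>P\<close> and \<open>Q\<close> enter only through their components of degree \<open>p\<close> and \<open>q\<close>.\<close>

definition MN_circ ::
  "('k::field \<Rightarrow> 'w::ab_group_add \<Rightarrow> 'w) \<Rightarrow> nat \<Rightarrow> nat \<Rightarrow> 'w cochain \<Rightarrow> 'w cochain \<Rightarrow> 'w cochain" where
  "MN_circ s p q P Q = (\<lambda>xs y.
     if length xs = p + q then
       (if p = 0 then 0 else
          \<Sum>\<sigma>\<in>unshuffles [q, 1, p - 1]. s (of_int (sign \<sigma>))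
            (let zs = permute_list \<sigma> xs in P (Q (take q zs) (zs ! q) # drop (q + 1) zs) y)) +
       s ((-1) ^ (p * q)) (\<Sum>\<sigma>\<in>unshuffles [p, q]. s (of_int (sign \<sigma>))
            (let zs = permute_list \<sigma> xs in P (take p zs) (Q (drop p zs) y)))
     else 0)"

definition MN_bracket ::
  "('k::field \<Rightarrow> 'w::ab_group_add \<Rightarrow> 'w) \<Rightarrow> nat \<Rightarrow> nat \<Rightarrow> 'w cochain \<Rightarrow> 'w cochain \<Rightarrow> 'w cochain" where
  "MN_bracket s p q P Q =
     MN_circ s p q P Q - cochain_scale s ((-1) ^ (p * q)) (MN_circ s q p Q P)"

section \<open>The graded vector space \<open>s\<^sup>-\<^sup>1L' \<oplus> h\<close>\<close>

text \<open>Horizontal lifts, with \<open>W = g \<oplus> V\<close>.\<close>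

definition lift_ggg :: "('g list \<Rightarrow> 'g \<Rightarrow> 'g) \<Rightarrow> ('g::ab_group_add \<times> 'v::ab_group_add) cochain" where
  "lift_ggg f = (\<lambda>ws w. (f (map fst ws) (fst w), 0))"

definition lift_gvv :: "('g list \<Rightarrow> 'v \<Rightarrow> 'v) \<Rightarrow> ('g::ab_group_add \<times> 'v::ab_group_add) cochain" where
  "lift_gvv f = (\<lambda>ws w. (0, f (map fst ws) (snd w)))"

definition lift_ggv :: "('g list \<Rightarrow> 'g \<Rightarrow> 'v) \<Rightarrow> ('g::ab_group_add \<times> 'v::ab_group_add) cochain" where
  "lift_ggv f = (\<lambda>ws w. (0, f (map fst ws) (fst w)))"

definition lift_gvgv ::
  "('k::field \<Rightarrow> 'v::ab_group_add \<Rightarrow> 'v) \<Rightarrow> ('g list \<Rightarrow> 'v \<Rightarrow> 'g \<Rightarrow> 'v) \<Rightarrow>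
   ('g::ab_group_add \<times> 'v) cochain" where
  "lift_gvgv sV f = (\<lambda>ws w. (0, \<Sum>i<length ws. sV ((-1) ^ (length ws - 1 - i))
     (f (take i (map fst ws) @ drop (Suc i) (map fst ws)) (snd (ws ! i)) (fst w))))"

definition L' ::
  "('k::field \<Rightarrow> 'g::ab_group_add \<Rightarrow> 'g) \<Rightarrow> ('k \<Rightarrow> 'v::ab_group_add \<Rightarrow> 'v) \<Rightarrow> nat \<Rightarrow>
   ('g \<times> 'v) cochain set" where
  "L' sG sV n =
     {lift_ggg f1 + lift_gvv f2 + lift_gvgv sV f3 | f1 f2 f3.
        f1 \<in> Hom_wedge sG sG sG n \<and> f2 \<in> Hom_wedge sG sV sV n \<and>
        f3 \<in> (if n = 0 then {0} else Hom_wedge2 sG sV sG sV (n - 1))}"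

text \<open>\<open>h_space sG sV n\<close> is the part of degree \<open>n\<close>, that is \<open>Hom(\<and>\<^sup>ng \<otimes> g, V)\<close>.\<close>

definition h_space ::
  "('k::field \<Rightarrow> 'g::ab_group_add \<Rightarrow> 'g) \<Rightarrow> ('k \<Rightarrow> 'v::ab_group_add \<Rightarrow> 'v) \<Rightarrow> nat \<Rightarrow>
   ('g \<times> 'v) cochain set" where
  "h_space sG sV n = lift_ggv ` Hom_wedge sG sG sV n"

type_synonym ('g, 'v) element = "('g \<times> 'v) cochain \<times> ('g \<times> 'v) cochain"

text \<open>The pair \<open>(f, \<theta>)\<close> stands for \<open>(s\<^sup>-\<^sup>1f, \<theta>)\<close>.\<close>

definition sLh ::
  "('k::field \<Rightarrow> 'g::ab_group_add \<Rightarrow> 'g) \<Rightarrow> ('k \<Rightarrow> 'v::ab_group_add \<Rightarrow> 'v) \<Rightarrow> int \<Rightarrow>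
   ('g, 'v) element set" where
  "sLh sG sV i =
     (if i \<ge> -1 then L' sG sV (nat (i + 1)) else {0}) \<times> (if i \<ge> 0 then h_space sG sV (nat i) else {0})"

definition element_scale ::
  "('k::field \<Rightarrow> 'g::ab_group_add \<Rightarrow> 'g) \<Rightarrow> ('k \<Rightarrow> 'v::ab_group_add \<Rightarrow> 'v) \<Rightarrow> 'k \<Rightarrow>
   ('g, 'v) element \<Rightarrow> ('g, 'v) element" where
  "element_scale sG sV =
     module_prod.scale (cochain_scale (module_prod.scale sG sV)) (cochain_scale (module_prod.scale sG sV))"

text \<open>
  The bilinear extension of the binary operation from homogeneous elements: at a list of length
  \<open>n\<close> one sums over the degrees \<open>p\<close> and \<open>n - p\<close> of the two components involved. The last summand is
  \<open>l\<^sub>2(\<theta>, s\<^sup>-\<^sup>1g)\<close>, obtained from \<open>l\<^sub>2(s\<^sup>-\<^sup>1g, \<theta>)\<close> by graded symmetry: for \<open>g\<close> of degree \<open>p\<close> in \<open>L'\<close>, the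
  degree of \<open>s\<^sup>-\<^sup>1g\<close> has the parity of \<open>p + 1\<close>.
\<close>

definition l2_op ::
  "('k::field \<Rightarrow> 'g::ab_group_add \<Rightarrow> 'g) \<Rightarrow> ('k \<Rightarrow> 'v::ab_group_add \<Rightarrow> 'v) \<Rightarrow>
   ('g, 'v) element \<Rightarrow> ('g, 'v) element \<Rightarrow> ('g, 'v) element" where
  "l2_op sG sV X Y =
     (let s = module_prod.scale sG sV; f = fst X; \<theta> = snd X; g = fst Y; \<eta> = snd Y in
       (\<lambda>xs y. \<Sum>p\<le>length xs. let q = length xs - p in
          s ((-1) ^ p) (MN_bracket s p q f g xs y),
        \<lambda>xs y. \<Sum>p\<le>length xs. let q = length xs - p in
          MN_bracket s p q f \<eta> xs y + s ((-1) ^ (q * (p + 1))) (MN_bracket s p q g \<theta> xs y)))"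

text \<open>\<open>l2_op\<close> takes the prescribed values on homogeneous elements.\<close>

lemma MN_circ_eq_0:
  assumes s: "vector_space s" and P: "P \<in> Hom_wedge s s s p'" and Q: "Q \<in> Hom_wedge s s s q'"
    and ne: "p \<noteq> p' \<or> q \<noteq> q'"
  shows "MN_circ s p q P Q = 0"
proof -
  interpret vs: vector_space s by (rule s)
  have s0: "s c 0 = 0" for c by (rule vs.scale_zero_right)
  have Q0: "Q xs y = 0" if "length xs = q" "q \<noteq> q'" for xs y
    using Q that unfolding Hom_wedge_def by blast
  have P0: "P xs y = 0" if "length xs = p" "p \<noteq> p'" for xs y
    using P that unfolding Hom_wedge_def by blast
  have Plast: "P xs 0 = 0" for xs
  proof -
    interpret Vector_Spaces.linear s s "P xs" using P unfolding Hom_wedge_def by blast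
    show ?thesis by (rule zero)
  qed
  have Pfirst: "P (0 # xs) y = 0" for xs y
  proof (cases "length xs + 1 = p'")
    case True
    have "multilinear_on s s UNIV p' (\<lambda>xs. P xs y)" using P unfolding Hom_wedge_def by blast
    then have "P ([] @ (0 + 0) # xs) y = P ([] @ 0 # xs) y + P ([] @ 0 # xs) y"
      using True unfolding multilinear_on_def by (metis UNIV_I add_0 list.size(3) subset_UNIV add.commute)
    then show ?thesis by simp
  next
    case False
    then show ?thesis using P unfolding Hom_wedge_def by simp
  qed
  have "P (Q (take q zs) (zs ! q) # drop (q + 1) zs) y = 0" if "length zs = p + q" "p \<noteq> 0" for zs y
  proof (cases "q = q'")
    case True
    then show ?thesis using ne that by (intro P0) auto
  next
    case False
    then show ?thesis using that Q0[of "take q zs"] Pfirst by simp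
  qed
  moreover have "P (take p zs) (Q (drop p zs) y) = 0" if "length zs = p + q" for zs y
  proof (cases "q = q'")
    case True
    then show ?thesis using ne that by (intro P0) auto
  next
    case False
    then show ?thesis using that Q0[of "drop p zs"] Plast by simp
  qed
  ultimately show ?thesis
    unfolding MN_circ_def Let_def by (auto simp: fun_eq_iff s0 sum.neutral)
qed

lemma
  fixes sG :: "'k::field \<Rightarrow> 'g::ab_group_add \<Rightarrow> 'g" and sV :: "'k \<Rightarrow> 'v::ab_group_add \<Rightarrow> 'v"
    and f g \<theta> \<eta> :: "('g \<times> 'v) cochain"
  defines "s \<equiv> module_prod.scale sG sV"
  assumes "vector_space sG" "vector_space sV"
    and f: "f \<in> Hom_wedge s s s p" and g: "g \<in> Hom_wedge s s s q"
    and \<theta>: "\<theta> \<in> Hom_wedge s s s r" and \<eta>: "\<eta> \<in> Hom_wedge s s s t"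
  shows l2_op_ff: "l2_op sG sV (f, 0) (g, 0) = (cochain_scale s ((-1) ^ p) (MN_bracket s p q f g), 0)"
    and l2_op_fh: "l2_op sG sV (f, 0) (0, \<theta>) = (0, MN_bracket s p r f \<theta>)"
    and l2_op_hf: "l2_op sG sV (0, \<theta>) (f, 0) =
      (0, cochain_scale s ((-1) ^ (r * (p + 1))) (MN_bracket s p r f \<theta>))"
    and l2_op_hh: "l2_op sG sV (0, \<theta>) (0, \<eta>) = 0"
proof -
  interpret vp: vector_space_prod sG sV
    using assms by (simp add: vector_space_prod_def vector_space_pair_def)
  have s: "vector_space s" unfolding s_def by (rule vp.p.vector_space_axioms)
  interpret vs: vector_space s by (rule s)
  have s0: "s c 0 = 0" for c by (rule vs.scale_zero_right)
  have lin0: "Vector_Spaces.linear s s (\<lambda>_. 0)"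
    by unfold_locales (simp_all add: s0)
  have zero: "0 \<in> Hom_wedge s s s n" for n
    unfolding Hom_wedge_def multilinear_on_def using lin0 s0 by (simp add: zero_fun_def)
  have br0: "MN_bracket s m n P Q = 0" if "P \<in> Hom_wedge s s s m'" "Q \<in> Hom_wedge s s s n'"
    "m \<noteq> m' \<or> n \<noteq> n'" for m n m' n' P Q
    using MN_circ_eq_0[OF s that(1,2), of m n] MN_circ_eq_0[OF s that(2,1), of n m] that(3)
    unfolding MN_bracket_def cochain_scale_def by (auto simp: fun_eq_iff s0)
  have br_l: "MN_bracket s m n P 0 = 0" if "P \<in> Hom_wedge s s s m'" for m n m' P
    using br0[OF that zero, of m n "Suc n"] by simp
  have br_r: "MN_bracket s m n 0 P = 0" if "P \<in> Hom_wedge s s s n'" for m n n' P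
    using br0[OF zero that, of m "Suc m" n] by simp
  have br_len: "MN_bracket s m n P Q xs y = 0" if "length xs \<noteq> m + n" for m n P Q xs y
    using that unfolding MN_bracket_def cochain_scale_def MN_circ_def by (simp add: s0)
  have main: "(\<Sum>m\<le>length xs. s (c m (length xs - m)) (MN_bracket s m (length xs - m) P Q xs y)) =
      s (c m' n') (MN_bracket s m' n' P Q xs y)"
    if "P \<in> Hom_wedge s s s m'" "Q \<in> Hom_wedge s s s n'" for m' n' P Q xs y c
  proof (cases "length xs = m' + n'")
    case True
    have "(\<Sum>m\<le>length xs. s (c m (length xs - m)) (MN_bracket s m (length xs - m) P Q xs y)) =
      (\<Sum>m\<le>length xs. if m = m' then s (c m' n') (MN_bracket s m' n' P Q xs y) else 0)"
      using True br0[OF that] by (intro sum.cong) (auto simp: s0)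
    then show ?thesis using True by simp
  next
    case False
    have "MN_bracket s m (length xs - m) P Q xs y = 0" if "m \<le> length xs" for m
      using False that br0[OF \<open>P \<in> _\<close> \<open>Q \<in> _\<close>, of m "length xs - m"] by fastforce
    then show ?thesis using False by (simp add: br_len s0)
  qed
  have s1: "s 1 x = x" for x
    by (rule vs.scale_one)
  note [simp] = l2_op_def Let_def s_def[symmetric] br_l[OF f] br_r[OF f] br_l[OF g] br_r[OF g]
    br_l[OF \<theta>] br_r[OF \<theta>] br_l[OF \<eta>] br_r[OF \<eta>] br_l[OF zero] s0 fun_eq_iff
    cochain_scale_def
  show "l2_op sG sV (f, 0) (g, 0) = (cochain_scale s ((-1) ^ p) (MN_bracket s p q f g), 0)"
    using main[OF f g, of "\<lambda>m n. (-1) ^ m"] by simp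
  show "l2_op sG sV (f, 0) (0, \<theta>) = (0, MN_bracket s p r f \<theta>)"
    using main[OF f \<theta>, of "\<lambda>m n. 1"] by (simp add: s1)
  show "l2_op sG sV (0, \<theta>) (f, 0) =
      (0, cochain_scale s ((-1) ^ (r * (p + 1))) (MN_bracket s p r f \<theta>))"
    using main[OF f \<theta>, of "\<lambda>m n. (-1) ^ (n * (m + 1))"] by simp
  show "l2_op sG sV (0, \<theta>) (0, \<eta>) = 0" by (simp add: prod_eq_iff)
qed

definition untwisted_l ::
  "('k::field \<Rightarrow> 'g::ab_group_add \<Rightarrow> 'g) \<Rightarrow> ('k \<Rightarrow> 'v::ab_group_add \<Rightarrow> 'v) \<Rightarrow>
   nat \<Rightarrow> ('g, 'v) element list \<Rightarrow> ('g, 'v) element" where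
  "untwisted_l sG sV k xs = (if k = 2 then l2_op sG sV (xs ! 0) (xs ! 1) else 0)"

text \<open>The element \<open>(s\<^sup>-\<^sup>1(\<pi> + \<rho> + \<mu>), D)\<close>, with \<open>\<mu>\<close> as a map on \<open>V \<otimes> g\<close>.\<close>

definition pair_element ::
  "('k::field \<Rightarrow> 'v::ab_group_add \<Rightarrow> 'v) \<Rightarrow> ('g::ab_group_add \<Rightarrow> 'g \<Rightarrow> 'g) \<Rightarrow> ('g \<Rightarrow> 'v \<Rightarrow> 'v) \<Rightarrow>
   ('v \<Rightarrow> 'g \<Rightarrow> 'v) \<Rightarrow> ('g \<Rightarrow> 'v) \<Rightarrow> ('g, 'v) element" where
  "pair_element sV \<pi> \<rho> \<mu> D =
     (lift_ggg (\<lambda>xs y. if length xs = 1 then \<pi> (hd xs) y else 0) +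
      lift_gvv (\<lambda>xs v. if length xs = 1 then \<rho> (hd xs) v else 0) +
      lift_gvgv sV (\<lambda>xs v x. if xs = [] then \<mu> v x else 0),
      lift_ggv (\<lambda>xs x. if xs = [] then D x else 0))"

end

theory Submission
  imports Defs
begin

text \<open>
  On cochains, insertion \<open>P \<circ> Q\<close> is a signed sum over shuffles in which \<open>Q\<close>, or the alternation of \<open>Q\<close>
  over all of its arguments, is plugged into the last, or into the first, argument of \<open>P\<close>.
  Coassociativity and graded cocommutativity of the shuffle coproduct make it a graded right
  pre-Lie product, whose commutator, the Matsushima-Nijenhuis bracket, therefore satisfies the
  graded Jacobi identity. Hence \<open>l\<^sub>2\<close> is a graded symmetric binary operation of degree \<open>1\<close>
  satisfying the Jacobi identity, and for every \<open>\<alpha>\<close> of degree \<open>0\<close> with \<open>l\<^sub>2(\<alpha>, \<alpha>) = 0\<close> the twisted structure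
  consists of the differential \<open>l\<^sub>2(\<alpha>, -)\<close> and \<open>l\<^sub>2\<close> itself. Its Maurer-Cartan equation for \<open>\<beta>\<close> is half
  of \<open>l\<^sub>2(\<alpha> + \<beta>, \<alpha> + \<beta>) = 0\<close>, and for a pair element this equation says that the semidirect
  product on \<open>g \<oplus> V\<close> is pre-Lie and that \<open>D\<close> is a derivation.
\<close>

text \<open>Composing unshuffles as permutations is awkward, because blocks and positions shift with
  the degrees. Splittings of a list, defined by recursion on its head with signs read off from the
  lengths of the parts, avoid this: coassociativity becomes an induction in which the head has three
  places to go. Permutations are met essentially once, when \<open>MN_circ\<close> is translated.
  What makes insertion right pre-Lie is that in \<open>(P o Q) o R - P o (Q o R)\<close> exactly
  those terms survive in which \<open>Q\<close> and \<open>R\<close> enter different arguments of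
  \<open>P\<close>. The delicate case is that of two alternating arguments of \<open>P\<close>: an
  alternated cochain of degree \<open>q\<close> consumes \<open>q + 1\<close> arguments, and the
  surplus sign is repaired by the antisymmetry of \<open>P\<close>. A second obstacle is that the
  bracket must not leave L' and h. Instead of computing the brackets of all kinds of lifts, both
  spaces are characterised by a grading which the bracket respects. Characteristic 0 enters through
  the distinctness of the powers of 2 and through division by 2, in \<open>l_1 o l_1 = 0\<close> and
  in the Maurer-Cartan equation.\<close>

text \<open>Signs act on any abelian group, so that the shuffle calculus works without scalars and
  applies to cochains as well as to their values.\<close>

definition sg :: "nat \<Rightarrow> 'b::ab_group_add \<Rightarrow> 'b" where
  "sg n x = (if even n then x else - x)"

lemma sg_simps [simp]:
  "sg 0 x = x" "sg (Suc 0) x = - x" "sg n 0 = 0" "sg m (sg n x) = sg (m + n) x"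
  "sg n (- x) = - sg n x" "sg (Suc n) x = - sg n x"
  by (simp_all add: sg_def)

lemma sg_add: "sg n (x + y) = sg n x + sg n y"
  and sg_diff: "sg n (x - y) = sg n x - sg n y"
  by (simp_all add: sg_def)

lemma sg_cong: "even m = even n \<Longrightarrow> sg m x = sg n x"
  by (simp add: sg_def)

lemma sg_apply: "sg n f x = sg n (f x)"
  by (simp add: sg_def)

lemma (in vector_space) scale_sg: "scale c (sg n x) = sg n (scale c x)"
  by (simp add: sg_def)

lemma (in vector_space) scale_power_minus_one: "scale ((- 1) ^ n) x = sg n x"
  by (simp add: sg_def minus_one_power_iff)

section \<open>Signed sums over shuffles\<close>

text \<open>
  The sum of \<open>\<plusminus> F T U\<close> over all splittings of a list into complementary sublists \<open>T\<close> and \<open>U\<close>, where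
  the sign is that of the unshuffle: the head of the list contributes \<open>(-1)^|T|\<close> when it goes
  into \<open>U\<close>, as it has to pass \<open>T\<close>. The recursion makes this the convolution of the shuffle
  coalgebra, and all that is used about it is that the latter is coassociative and graded
  cocommutative.
\<close>

primrec shsum :: "'a list \<Rightarrow> ('a list \<Rightarrow> 'a list \<Rightarrow> 'b::ab_group_add) \<Rightarrow> 'b" where
  "shsum [] F = F [] []"
| "shsum (w # xs) F =
     shsum xs (\<lambda>T U. F (w # T) U) + shsum xs (\<lambda>T U. sg (length T) (F T (w # U)))"

lemma shsum_cong:
  assumes "\<And>T U. length T + length U = length xs \<Longrightarrow> F T U = G T U"
  shows "shsum xs F = shsum xs G"
  using assms
proof (induction xs arbitrary: F G)
  case (Cons w xs)
  have "shsum xs (\<lambda>T U. F (w # T) U) = shsum xs (\<lambda>T U. G (w # T) U)"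
    by (rule Cons.IH) (simp add: Cons.prems)
  moreover have "shsum xs (\<lambda>T U. sg (length T) (F T (w # U))) =
      shsum xs (\<lambda>T U. sg (length T) (G T (w # U)))"
    by (rule Cons.IH) (simp add: Cons.prems)
  ultimately show ?case by simp
qed simp

lemma shsum_hom:
  assumes "\<And>x y. h (x + y) = h x + h y"
  shows "h (shsum xs F) = shsum xs (\<lambda>T U. h (F T U))"
proof -
  have "h 0 + h 0 = h 0 + 0" using assms[of 0 0] by simp
  then have h0: "h 0 = 0" by (simp only: add_left_cancel)
  have hm: "h (- x) = - h x" for x using assms[of x "- x"] h0 by (simp add: eq_neg_iff_add_eq_0 add.commute)
  have hsg: "h (sg n x) = sg n (h x)" for n x by (simp add: sg_def hm)
  show ?thesis
    by (induction xs arbitrary: F) (simp_all add: assms hsg)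
qed

lemma shsum_add: "shsum xs (\<lambda>T U. F T U + G T U) = shsum xs F + shsum xs G"
  by (induction xs arbitrary: F G) (simp_all add: sg_add algebra_simps)

lemma shsum_zero [simp]: "shsum xs (\<lambda>T U. 0) = 0"
  by (induction xs) simp_all

lemma shsum_sg: "shsum xs (\<lambda>T U. sg n (F T U)) = sg n (shsum xs F)"
  by (rule shsum_hom[symmetric]) (rule sg_add)

lemma shsum_minus: "shsum xs (\<lambda>T U. - F T U) = - shsum xs F"
  using shsum_sg[of xs 1 F] by simp

lemma shsum_diff: "shsum xs (\<lambda>T U. F T U - G T U) = shsum xs F - shsum xs G"
  using shsum_add[of xs F "\<lambda>T U. - G T U"] by (simp add: shsum_minus)

lemma shsum_map: "shsum (map f xs) F = shsum xs (\<lambda>T U. F (map f T) (map f U))"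
  by (induction xs arbitrary: F) simp_all

lemma shsum_only_left: "shsum xs (\<lambda>T U. if U = [] then f T else 0) = f xs"
  by (induction xs arbitrary: f) simp_all

text \<open>Graded cocommutativity: exchanging the parts moves each element of one past each element
  of the other. In the induction the two branches of the recursion change places.\<close>

lemma shsum_swap: "shsum xs F = shsum xs (\<lambda>T U. sg (length T * length U) (F U T))"
proof (induction xs arbitrary: F)
  case (Cons w xs)
  have "shsum xs (\<lambda>T U. F (w # T) U) =
      shsum xs (\<lambda>T U. sg (length T + length T * length (w # U)) (F (w # U) T))"
    by (subst Cons.IH) (intro shsum_cong sg_cong, auto)
  moreover have "shsum xs (\<lambda>T U. sg (length T) (F T (w # U))) =
      shsum xs (\<lambda>T U. sg (length (w # T) * length U) (F U (w # T)))"
    by (subst Cons.IH) (auto intro!: shsum_cong sg_cong)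
  ultimately show ?case by (simp add: add.commute)
qed simp

text \<open>Coassociativity: both sides run over the splittings into three parts. The head goes to
  one of them and passes the parts in front of it; for the third part the left side counts this as
  \<open>length S\<close>, the right side as \<open>length T + length A\<close>, and these
  agree.\<close>

lemma shsum_assoc:
  "shsum xs (\<lambda>S U. shsum S (\<lambda>T A. F T A U)) = shsum xs (\<lambda>T S. shsum S (\<lambda>A U. F T A U))"
proof (induction xs arbitrary: F)
  case (Cons w xs)
  have 1: "shsum xs (\<lambda>S U. shsum S (\<lambda>T A. sg (length T) (F T (w # A) U))) =
      shsum xs (\<lambda>T S. sg (length T) (shsum S (\<lambda>A U. F T (w # A) U)))"
    by (simp add: Cons.IH shsum_sg[symmetric])
  have "shsum xs (\<lambda>S U. sg (length S) (shsum S (\<lambda>T A. F T A (w # U)))) =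
     shsum xs (\<lambda>S U. shsum S (\<lambda>T A. sg (length T + length A) (F T A (w # U))))"
    by (simp add: shsum_sg[symmetric]) (intro shsum_cong, simp)
  also have "\<dots> = shsum xs (\<lambda>T S. sg (length T) (shsum S (\<lambda>A U. sg (length A) (F T A (w # U)))))"
    by (simp add: Cons.IH shsum_sg[symmetric])
  finally show ?case
    using 1 Cons.IH[of "\<lambda>T. F (w # T)"] by (simp add: shsum_add sg_add)
qed simp

text \<open>Cocommutativity in the first two of three factors; coassociativity brings these two
  together.\<close>

lemma shsum_swap12:
  "shsum xs (\<lambda>T S. shsum S (\<lambda>A U. F T A U)) =
   shsum xs (\<lambda>T S. shsum S (\<lambda>A U. sg (length T * length A) (F A T U)))"
proof -
  have "shsum xs (\<lambda>S U. shsum S (\<lambda>T A. F T A U)) =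
      shsum xs (\<lambda>S U. shsum S (\<lambda>T A. sg (length T * length A) (F A T U)))"
    by (subst shsum_swap) (rule refl)
  then show ?thesis by (simp only: shsum_assoc)
qed

section \<open>The insertion product on cochains\<close>

text \<open>Selects the splittings whose second part is a single element, which then serves as the
  last argument of a cochain.\<close>

definition on_single :: "('a \<Rightarrow> 'b::zero) \<Rightarrow> 'a list \<Rightarrow> 'b" where
  "on_single f Z = (case Z of [z] \<Rightarrow> f z | _ \<Rightarrow> 0)"

lemma on_single_simps [simp]:
  "on_single f [] = 0" "on_single f [z] = f z" "on_single f (z # z' # Z) = 0"
  by (simp_all add: on_single_def)

text \<open>A cochain is not alternating in its last argument. Before it is plugged into an
  alternating slot of another cochain it has to be alternated over all its arguments; for degree
  \<open>q\<close> this is the sum over the blocks \<open>q, 1\<close> of the unshuffles in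
  \<open>MN_circ\<close>.\<close>

definition alternation :: "'w::ab_group_add cochain \<Rightarrow> 'w list \<Rightarrow> 'w" where
  "alternation Q xs = shsum xs (\<lambda>T Z. on_single (Q T) Z)"

text \<open>The factor \<open>(-1)^(p*q)\<close> of the second sum in \<open>MN_circ\<close> is
  absent because the arguments of \<open>Q\<close> come first here. No degrees appear, since on
  homogeneous cochains the wrong block lengths contribute zero.\<close>

definition ins_prod :: "'w::ab_group_add cochain \<Rightarrow> 'w cochain \<Rightarrow> 'w cochain" where
  "ins_prod P Q = (\<lambda>xs y. shsum xs (\<lambda>T U. P (alternation Q T # U) y + P U (Q T y)))"

definition biadditive :: "'w::ab_group_add cochain \<Rightarrow> bool" where
  "biadditive P \<longleftrightarrow> (\<forall>us x y vs z. P (us @ (x + y) # vs) z = P (us @ x # vs) z + P (us @ y # vs) z) \<and>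
     (\<forall>xs x y. P xs (x + y) = P xs x + P xs y)"

definition swap_alternating :: "'w::ab_group_add cochain \<Rightarrow> bool" where
  "swap_alternating P \<longleftrightarrow> (\<forall>x y vs z. P (x # y # vs) z = - P (y # x # vs) z)"

definition of_degree :: "nat \<Rightarrow> 'w::ab_group_add cochain \<Rightarrow> bool" where
  "of_degree p P \<longleftrightarrow> (\<forall>xs y. length xs \<noteq> p \<longrightarrow> P xs y = 0)"

lemma biadditive_Cons: "biadditive P \<Longrightarrow> P ((x + y) # vs) z = P (x # vs) z + P (y # vs) z"
  unfolding biadditive_def by (metis append_Nil)

lemma biadditive_last: "biadditive P \<Longrightarrow> P vs (x + y) = P vs x + P vs y"
  by (simp add: biadditive_def)

lemma of_degree_alternation:
  assumes "of_degree q Q" and "length xs \<noteq> Suc q"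
  shows "alternation Q xs = 0"
proof -
  have "on_single (Q T) Z = 0" if "length T + length Z = length xs" for T Z
    using that assms by (auto simp: on_single_def of_degree_def split: list.splits)
  then have "shsum xs (\<lambda>T Z. on_single (Q T) Z) = shsum xs (\<lambda>T Z. 0)"
    by (intro shsum_cong) auto
  then show ?thesis by (simp add: alternation_def)
qed

lemma biadditive_zero:
  assumes "biadditive P"
  shows "P (us @ 0 # vs) z = 0" "P xs 0 = 0" "P (0 # vs) z = 0"
proof -
  show 1: "P (us @ 0 # vs) z = 0" for us
    using assms unfolding biadditive_def by (metis add_0 add_cancel_right_right)
  show "P xs 0 = 0"
    using assms unfolding biadditive_def by (metis add_0 add_cancel_right_right)
  show "P (0 # vs) z = 0" using 1[of "[]"] by simp
qed

text \<open>On the right, the inserted value of \<open>R\<close> is the head of the list over which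
  \<open>Q\<close> is alternated. It either stays among the alternating arguments of
  \<open>Q\<close> or is selected as the last one, and these cases are the two kinds of insertion of
  \<open>R\<close> into \<open>Q\<close>.\<close>

lemma alternation_ins_prod:
  assumes Q: "biadditive Q"
  shows "alternation (ins_prod Q R) xs = shsum xs (\<lambda>T U. alternation Q (alternation R T # U))"
proof -
  let ?v = "alternation R"
  have os: "on_single (\<lambda>z. shsum S (\<lambda>T U. F T U z)) Z = shsum S (\<lambda>T U. on_single (F T U) Z)"
    for S Z and F :: "'a list \<Rightarrow> 'a list \<Rightarrow> 'a \<Rightarrow> 'a"
    by (auto simp: on_single_def split: list.splits)
  have osa: "on_single (\<lambda>z. f z + g z) Z = on_single f Z + on_single g Z" for Z and f g :: "'a \<Rightarrow> 'a"
    by (auto simp: on_single_def split: list.splits)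
  have "alternation (ins_prod Q R) xs =
      shsum xs (\<lambda>S Z. shsum S (\<lambda>T U. on_single (\<lambda>z. Q (?v T # U) z + Q U (R T z)) Z))"
    by (simp only: alternation_def[of "ins_prod Q R"]) (simp only: ins_prod_def os)
  also have "\<dots> = shsum xs (\<lambda>T S. shsum S (\<lambda>U Z. on_single (Q (?v T # U)) Z)) +
      shsum xs (\<lambda>T S. shsum S (\<lambda>U Z. on_single (\<lambda>z. Q U (R T z)) Z))"
    by (simp add: osa shsum_assoc shsum_add)
  finally have 1: "alternation (ins_prod Q R) xs = \<dots>" .
  \<comment> \<open>The head is the selected last argument; then all of \<open>U\<close> must remain
    in the first part.\<close>
  have last: "shsum U (\<lambda>A Z. sg (length A) (on_single (Q A) (w # Z))) = sg (length U) (Q U w)" for U w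
  proof -
    have "shsum U (\<lambda>A Z. sg (length A) (on_single (Q A) (w # Z))) =
       shsum U (\<lambda>A Z. if Z = [] then sg (length A) (Q A w) else 0)"
      by (intro shsum_cong) (auto simp: on_single_def split: list.splits)
    then show ?thesis by (simp add: shsum_only_left[of U "\<lambda>A. sg (length A) (Q A w)"])
  qed
  have 2: "shsum xs (\<lambda>T U. alternation Q (?v T # U)) =
      shsum xs (\<lambda>T S. shsum S (\<lambda>U Z. on_single (Q (?v T # U)) Z)) +
      shsum xs (\<lambda>T U. sg (length U) (Q U (?v T)))"
    by (simp add: alternation_def[of Q] last shsum_add)
  have inner: "Q U (?v T) = shsum T (\<lambda>A Z. on_single (\<lambda>z. Q U (R A z)) Z)" for U T
  proof -
    have "Q U (?v T) = shsum T (\<lambda>A Z. Q U (on_single (R A) Z))"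
      unfolding alternation_def by (rule shsum_hom) (rule biadditive_last[OF Q])
    also have "\<dots> = shsum T (\<lambda>A Z. on_single (\<lambda>z. Q U (R A z)) Z)"
      by (intro shsum_cong) (auto simp: on_single_def biadditive_zero[OF Q] split: list.splits)
    finally show ?thesis .
  qed
  have "shsum xs (\<lambda>T U. sg (length U) (Q U (?v T))) =
     shsum xs (\<lambda>U T. sg (length U * length T + length U) (Q U (?v T)))"
    by (subst shsum_swap) (intro shsum_cong, simp)
  also have "\<dots> = shsum xs (\<lambda>U T. shsum T (\<lambda>A Z. sg (length U * length T + length U) (on_single (\<lambda>z. Q U (R A z)) Z)))"
    by (simp add: inner shsum_sg)
  \<comment> \<open>Only single-element \<open>Z\<close> contribute, so
    \<open>length T = length A + 1\<close> and the extra summand \<open>length U\<close> cancels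
    modulo 2.\<close>
  also have "\<dots> = shsum xs (\<lambda>U T. shsum T (\<lambda>A Z. sg (length U * length A) (on_single (\<lambda>z. Q U (R A z)) Z)))"
    by (intro shsum_cong) (auto simp: on_single_def sg_def split: list.splits; metis even_Suc)
  also have "\<dots> = shsum xs (\<lambda>T S. shsum S (\<lambda>U Z. on_single (\<lambda>z. Q U (R T z)) Z))"
    by (subst shsum_swap12) (intro shsum_cong, simp add: sg_def mult.commute)
  finally show ?thesis using 1 2 by simp
qed

text \<open>The terms in which \<open>Q\<close> and \<open>R\<close> enter different arguments of
  \<open>P\<close>: both alternating ones, or one alternating and the last. The sign arises when the
  value of \<open>R\<close> passes the arguments \<open>A\<close> of \<open>Q\<close>.\<close>

definition ins_defect :: "'w::ab_group_add cochain \<Rightarrow> 'w cochain \<Rightarrow> 'w cochain \<Rightarrow> 'w cochain" where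
  "ins_defect P Q R = (\<lambda>xs y. shsum xs (\<lambda>T S. shsum S (\<lambda>A B.
     sg (length A) (P (alternation Q A # alternation R T # B) y) +
     sg (length A) (P (alternation R T # B) (Q A y)) + P (alternation Q A # B) (R T y))))"

text \<open>Expanding the left-hand product, the value of \<open>R\<close> lands inside an argument
  of \<open>Q\<close> or beside it. By coassociativity and \<open>alternation_ins_prod\<close> the
  nested terms form \<open>P o (Q o R)\<close>; the terms beside it remain.\<close>

lemma ins_prod_associator:
  assumes P: "biadditive P" and Q: "biadditive Q"
  shows "ins_prod (ins_prod P Q) R - ins_prod P (ins_prod Q R) = ins_defect P Q R"
proof (intro ext)
  fix xs y
  let ?q = "alternation Q" and ?r = "alternation R"
  have L: "ins_prod (ins_prod P Q) R xs y = shsum xs (\<lambda>T S. shsum S (\<lambda>A B.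
      P (?q (?r T # A) # B) y + P B (Q (?r T # A) y) + sg (length A) (P (?q A # ?r T # B) y)
      + sg (length A) (P (?r T # B) (Q A y)) + P (?q A # B) (R T y) + P B (Q A (R T y))))"
    unfolding ins_prod_def by (simp add: shsum_add sg_add add.assoc)
  have "P (alternation (ins_prod Q R) S # B) y = shsum S (\<lambda>T A. P (?q (?r T # A) # B) y)" for S B
    unfolding alternation_ins_prod[OF Q] by (rule shsum_hom) (rule biadditive_Cons[OF P])
  moreover have "P B (ins_prod Q R S y) = shsum S (\<lambda>T A. P B (Q (?r T # A) y) + P B (Q A (R T y)))" for S B
    unfolding ins_prod_def
    by (subst shsum_hom[of "P B"]) (simp_all add: biadditive_last[OF P])
  ultimately have "ins_prod P (ins_prod Q R) xs y = shsum xs (\<lambda>S B. shsum S (\<lambda>T A.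
      P (?q (?r T # A) # B) y + (P B (Q (?r T # A) y) + P B (Q A (R T y)))))"
    unfolding ins_prod_def[of P] by (simp add: shsum_add)
  also have "\<dots> = shsum xs (\<lambda>T S. shsum S (\<lambda>A B.
      P (?q (?r T # A) # B) y + (P B (Q (?r T # A) y) + P B (Q A (R T y)))))"
    by (rule shsum_assoc)
  finally show "(ins_prod (ins_prod P Q) R - ins_prod P (ins_prod Q R)) xs y = ins_defect P Q R xs y"
    unfolding ins_defect_def by (simp add: L shsum_add)
qed

text \<open>This is the graded right pre-Lie identity. The blocks \<open>T\<close> and
  \<open>A\<close> are exchanged by \<open>shsum_swap12\<close>; the degrees determine the block
  lengths of every nonzero term and hence its sign.\<close>

lemma ins_defect_swap:
  assumes P: "biadditive P" "swap_alternating P" and Q: "of_degree q Q" and R: "of_degree r R"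
  shows "ins_defect P Q R = sg (q * r) (ins_defect P R Q)"
proof (intro ext)
  fix xs y
  let ?q = "alternation Q" and ?r = "alternation R"
  note vq = of_degree_alternation[OF Q] and vr = of_degree_alternation[OF R]
  have summand: "sg (length T * length A) (sg (length T) (P (?r T # ?q A # B) y) +
      sg (length T) (P (?q A # B) (R T y)) + P (?r T # B) (Q A y)) =
    sg (q * r) (sg (length A) (P (?q A # ?r T # B) y) +
      sg (length A) (P (?r T # B) (Q A y)) + P (?q A # B) (R T y))" for T A B
  proof -
    \<comment> \<open>A nonzero term has \<open>length T = r + 1\<close> and
      \<open>length A = q + 1\<close>. The two exponents then have different parity, and the
      exchange of the first two arguments of \<open>P\<close> supplies the missing sign.\<close>
    have a: "sg (length T * length A + length T) (P (?r T # ?q A # B) y) =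
      sg (q * r + length A) (P (?q A # ?r T # B) y)"
    proof (cases "length T = Suc r \<and> length A = Suc q")
      case True
      then show ?thesis using P(2)[unfolded swap_alternating_def, rule_format, of "?r T" "?q A" B y]
        by (auto simp: sg_def)
    next
      case False
      then have "?r T = 0 \<or> ?q A = 0" using vq vr by blast
      moreover have "P (?r T # 0 # B) y = 0" "P (?q A # 0 # B) y = 0"
        using biadditive_zero(1)[OF P(1), of "[_]" B y] by simp_all
      ultimately show ?thesis using biadditive_zero(3)[OF P(1)] by auto
    qed
    have b: "sg (length T * length A + length T) (P (?q A # B) (R T y)) =
      sg (q * r) (P (?q A # B) (R T y))"
    proof (cases "length T = r \<and> length A = Suc q")
      case False
      then have "R T y = 0 \<or> ?q A = 0" using vq R by (auto simp: of_degree_def)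
      then show ?thesis using biadditive_zero[OF P(1)] by auto
    qed (auto simp: sg_def)
    have c: "sg (length T * length A) (P (?r T # B) (Q A y)) =
      sg (q * r + length A) (P (?r T # B) (Q A y))"
    proof (cases "length T = Suc r \<and> length A = q")
      case False
      then have "?r T = 0 \<or> Q A y = 0" using vr Q by (auto simp: of_degree_def)
      then show ?thesis using biadditive_zero[OF P(1)] by auto
    qed (auto simp: sg_def)
    show ?thesis by (simp add: sg_add a b c)
  qed
  have "ins_defect P R Q xs y = shsum xs (\<lambda>T S. shsum S (\<lambda>A B. sg (length T * length A)
     (sg (length T) (P (?r T # ?q A # B) y) + sg (length T) (P (?q A # B) (R T y)) + P (?r T # B) (Q A y))))"
    unfolding ins_defect_def by (rule shsum_swap12)
  also have "\<dots> = sg (q * r) (ins_defect P Q R xs y)"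
    unfolding ins_defect_def by (simp only: summand shsum_sg)
  finally show "ins_defect P Q R xs y = sg (q * r) (ins_defect P R Q) xs y"
    by (simp add: sg_apply) (simp add: sg_def)
qed

section \<open>Unshuffles\<close>

text \<open>In one-line notation: put a new smallest value at position \<open>m\<close> and raise
  the others. On lists this moves the head to position \<open>m\<close>, which is the permutation
  counterpart of one step of the recursion of \<open>shsum\<close>.\<close>

definition insert_zero :: "nat \<Rightarrow> (nat \<Rightarrow> nat) \<Rightarrow> nat \<Rightarrow> nat" where
  "insert_zero m \<tau> = (\<lambda>i. if i < m then Suc (\<tau> i) else if i = m then 0 else Suc (\<tau> (i - 1)))"

definition delete_zero :: "nat \<Rightarrow> (nat \<Rightarrow> nat) \<Rightarrow> nat \<Rightarrow> nat" where
  "delete_zero m \<sigma> = (\<lambda>i. if i < m then \<sigma> i - 1 else \<sigma> (Suc i) - 1)"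

lemma delete_insert_zero: "delete_zero m (insert_zero m \<tau>) = \<tau>"
  by (auto simp: delete_zero_def insert_zero_def fun_eq_iff)

lemma insert_delete_zero:
  assumes "\<sigma> m = 0" "inj \<sigma>"
  shows "insert_zero m (delete_zero m \<sigma>) = \<sigma>"
proof
  fix i
  have "\<sigma> j \<noteq> 0" if "j \<noteq> m" for j using assms that by (metis injD)
  then show "insert_zero m (delete_zero m \<sigma>) i = \<sigma> i"
    using assms(1) by (auto simp: delete_zero_def insert_zero_def)
qed

text \<open>Moving the new value one place further costs one transposition; this is where the sign
  \<open>(-1)^m\<close> comes from.\<close>

lemma insert_zero_Suc: "insert_zero (Suc m) \<tau> = insert_zero m \<tau> \<circ> transpose m (Suc m)"
  by (auto simp: insert_zero_def transpose_def fun_eq_iff)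

text \<open>Shifting by one turns a product of transpositions into a product of equally many shifted
  transpositions.\<close>

lemma insert_zero_0_permutes:
  assumes "\<tau> permutes {..<n}"
  shows "insert_zero 0 \<tau> permutes {..<Suc n}" and "evenperm (insert_zero 0 \<tau>) = evenperm \<tau>"
proof -
  have ap: "(insert_zero 0 \<tau> permutes {..<Suc n}) \<and> evenperm (insert_zero 0 \<tau>) = evenperm \<tau>"
    using assms finite_lessThan[of n]
  proof (induction rule: permutes_induct)
    case id
    have "insert_zero 0 id = id" by (auto simp: insert_zero_def fun_eq_iff)
    then show ?case by (simp only: permutes_id simp_thms)
  next
    case (swap a b p)
    have eq: "insert_zero 0 (transpose a b \<circ> p) = transpose (Suc a) (Suc b) \<circ> insert_zero 0 p"
      by (auto simp: insert_zero_def transpose_def fun_eq_iff)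
    have "permutation p" "permutation (insert_zero 0 p)"
      using swap by (meson finite_lessThan permutation_permutes)+
    moreover have "insert_zero 0 p permutes {..<Suc n}" "evenperm (insert_zero 0 p) = evenperm p"
      using swap by auto
    moreover have "transpose (Suc a) (Suc b) permutes {..<Suc n}"
      using swap by (intro permutes_swap_id) auto
    ultimately show ?case
      unfolding eq
      by (simp only: permutes_compose evenperm_comp permutation_swap_id evenperm_swap) simp
  qed
  show "insert_zero 0 \<tau> permutes {..<Suc n}" and "evenperm (insert_zero 0 \<tau>) = evenperm \<tau>"
    using ap by auto
qed

lemma insert_zero_permutes:
  assumes "\<tau> permutes {..<n}" "m \<le> n"
  shows "insert_zero m \<tau> permutes {..<Suc n}"
    and "evenperm (insert_zero m \<tau>) = (even m = evenperm \<tau>)"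
proof -
  have ap: "(insert_zero m \<tau> permutes {..<Suc n}) \<and> evenperm (insert_zero m \<tau>) = (even m = evenperm \<tau>)"
    using assms(2)
  proof (induction m)
    case 0
    then show ?case using insert_zero_0_permutes[OF assms(1)] by auto
  next
    case (Suc m)
    then have perm: "insert_zero m \<tau> permutes {..<Suc n}" and ev: "evenperm (insert_zero m \<tau>) = (even m = evenperm \<tau>)"
      by auto
    then have "permutation (insert_zero m \<tau>)" by (meson finite_lessThan permutation_permutes)
    moreover have "transpose m (Suc m) permutes {..<Suc n}"
      using Suc by (intro permutes_swap_id) auto
    ultimately show ?case
      unfolding insert_zero_Suc using perm ev
      by (simp only: permutes_compose evenperm_comp permutation_swap_id evenperm_swap) auto
  qed
  then show "insert_zero m \<tau> permutes {..<Suc n}"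
    and "evenperm (insert_zero m \<tau>) = (even m = evenperm \<tau>)" by auto
qed

lemma delete_zero_permutes:
  assumes "\<sigma> permutes {..<Suc n}" "m \<le> n" "\<sigma> m = 0"
  shows "delete_zero m \<sigma> permutes {..<n}"
proof (rule bij_imp_permutes)
  have inj: "inj \<sigma>" using assms(1) by (rule permutes_inj)
  have nz: "\<sigma> j \<noteq> 0" if "j \<noteq> m" for j using inj assms(3) that by (metis injD)
  have lt: "\<sigma> j < Suc n \<longleftrightarrow> j < Suc n" for j using permutes_in_image[OF assms(1), of j] by simp
  have "inj_on (delete_zero m \<sigma>) {..<n}"
  proof (rule inj_onI)
    fix i j assume *: "delete_zero m \<sigma> i = delete_zero m \<sigma> j"
    let ?s = "\<lambda>i. if i < m then i else Suc i"
    have "delete_zero m \<sigma> i = \<sigma> (?s i) - 1" for i by (simp add: delete_zero_def)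
    then have "\<sigma> (?s i) - 1 = \<sigma> (?s j) - 1" using * by simp
    moreover have "\<sigma> (?s i) \<noteq> 0" "\<sigma> (?s j) \<noteq> 0" by (rule nz, simp)+
    ultimately have "\<sigma> (?s i) = \<sigma> (?s j)" by linarith
    then have "?s i = ?s j" using inj by (rule injD[rotated])
    then show "i = j" by (auto split: if_splits)
  qed
  moreover have "delete_zero m \<sigma> ` {..<n} \<subseteq> {..<n}"
  proof
    fix k assume "k \<in> delete_zero m \<sigma> ` {..<n}"
    then obtain i where i: "i < n" "k = delete_zero m \<sigma> i" by auto
    show "k \<in> {..<n}"
    proof (cases "i < m")
      case True
      then have "\<sigma> i \<noteq> 0" "\<sigma> i < Suc n" using nz lt i by auto
      then show ?thesis using i True by (simp add: delete_zero_def)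
    next
      case False
      then have "\<sigma> (Suc i) \<noteq> 0" "\<sigma> (Suc i) < Suc n" using nz lt i by auto
      then show ?thesis using i False by (simp add: delete_zero_def)
    qed
  qed
  ultimately show "bij_betw (delete_zero m \<sigma>) {..<n} {..<n}"
    by (simp add: bij_betw_def endo_inj_surj)
  show "delete_zero m \<sigma> i = i" if "i \<notin> {..<n}" for i
    using that assms(2) permutes_not_in[OF assms(1), of "Suc i"] by (simp add: delete_zero_def)
qed

lemma permute_list_insert_zero:
  assumes "\<tau> permutes {..<length xs}" "m \<le> length xs"
  shows "permute_list (insert_zero m \<tau>) (w # xs) =
     take m (permute_list \<tau> xs) @ w # drop m (permute_list \<tau> xs)"
proof (rule nth_equalityI)
  fix i assume "i < length (permute_list (insert_zero m \<tau>) (w # xs))"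
  then have i: "i < Suc (length xs)" by simp
  have lt: "\<tau> j < length xs" if "j < length xs" for j using permutes_in_image[OF assms(1), of j] that by simp
  consider "i < m" | "i = m" | k where "i = Suc (m + k)" by (metis less_imp_Suc_add linorder_neqE_nat)
  then show "permute_list (insert_zero m \<tau>) (w # xs) ! i =
      (take m (permute_list \<tau> xs) @ w # drop m (permute_list \<tau> xs)) ! i"
    using i assms(2) lt
    by cases (auto simp: permute_list_def insert_zero_def nth_append min_def simp del: upt_Suc)
qed (use assms(2) in simp)

lemma unshuffles3:
  "unshuffles [a, b, c] = {\<sigma>. \<sigma> permutes {..<a + b + c} \<and> strict_mono_on {0..<a} \<sigma> \<and>
     strict_mono_on {a..<a + b} \<sigma> \<and> strict_mono_on {a + b..<a + b + c} \<sigma>}"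
  by (auto simp: unshuffles_def less_Suc_eq numeral_3_eq_3 add.assoc)

text \<open>An empty first block lets a single three-block recursion serve both sums in
  \<open>MN_circ\<close>.\<close>

lemma unshuffles2: "unshuffles [p, q] = unshuffles [0, p, q]"
  by (auto simp: unshuffles_def less_Suc_eq strict_mono_on_def)

lemma finite_unshuffles: "finite (unshuffles ks)"
  by (rule finite_subset[OF _ finite_permutations[of "{..<sum_list ks}"]]) (auto simp: unshuffles_def)

text \<open>The new value lies behind the block, in front of it, or at its first position, where its
  minimality preserves monotonicity.\<close>

lemma strict_mono_on_insert_zero:
  "l \<le> m \<Longrightarrow> strict_mono_on {k..<l} (insert_zero m \<tau>) \<longleftrightarrow> strict_mono_on {k..<l} \<tau>"
  "m < k \<Longrightarrow> strict_mono_on {k..<l} (insert_zero m \<tau>) \<longleftrightarrow> strict_mono_on {k - 1..<l - 1} \<tau>"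
  "strict_mono_on {m..<l} (insert_zero m \<tau>) \<longleftrightarrow> strict_mono_on {m..<l - 1} \<tau>"
proof -
  show "l \<le> m \<Longrightarrow> strict_mono_on {k..<l} (insert_zero m \<tau>) \<longleftrightarrow> strict_mono_on {k..<l} \<tau>"
    by (auto simp: strict_mono_on_def insert_zero_def)
  show "strict_mono_on {k..<l} (insert_zero m \<tau>) \<longleftrightarrow> strict_mono_on {k - 1..<l - 1} \<tau>" if "m < k"
  proof
    assume L: "strict_mono_on {k..<l} (insert_zero m \<tau>)"
    show "strict_mono_on {k - 1..<l - 1} \<tau>"
    proof (rule strict_mono_onI)
      fix r s assume "r \<in> {k - 1..<l - 1}" "s \<in> {k - 1..<l - 1}" "r < s"
      then show "\<tau> r < \<tau> s" using that strict_mono_onD[OF L, of "Suc r" "Suc s"]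
        by (auto simp: insert_zero_def)
    qed
  next
    assume R: "strict_mono_on {k - 1..<l - 1} \<tau>"
    show "strict_mono_on {k..<l} (insert_zero m \<tau>)"
    proof (rule strict_mono_onI)
      fix r s assume "r \<in> {k..<l}" "s \<in> {k..<l}" "r < s"
      then show "insert_zero m \<tau> r < insert_zero m \<tau> s"
        using that strict_mono_onD[OF R, of "r - 1" "s - 1"] by (auto simp: insert_zero_def)
    qed
  qed
  show "strict_mono_on {m..<l} (insert_zero m \<tau>) \<longleftrightarrow> strict_mono_on {m..<l - 1} \<tau>"
  proof
    assume L: "strict_mono_on {m..<l} (insert_zero m \<tau>)"
    show "strict_mono_on {m..<l - 1} \<tau>"
    proof (rule strict_mono_onI)
      fix r s assume "r \<in> {m..<l - 1}" "s \<in> {m..<l - 1}" "r < s"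
      then show "\<tau> r < \<tau> s" using strict_mono_onD[OF L, of "Suc r" "Suc s"]
        by (auto simp: insert_zero_def)
    qed
  next
    assume R: "strict_mono_on {m..<l - 1} \<tau>"
    show "strict_mono_on {m..<l} (insert_zero m \<tau>)"
    proof (rule strict_mono_onI)
      fix r s assume "r \<in> {m..<l}" "s \<in> {m..<l}" "r < s"
      then show "insert_zero m \<tau> r < insert_zero m \<tau> s"
        using strict_mono_onD[OF R, of "r - 1" "s - 1"] by (auto simp: insert_zero_def)
    qed
  qed
qed

text \<open>An unshuffle takes the value \<open>0\<close> at the first position of one of its nonempty blocks.\<close>

lemma unshuffles_Suc:
  assumes "a + b + c = Suc n"
  shows "unshuffles [a, b, c] =
    (if a = 0 then {} else insert_zero 0 ` unshuffles [a - 1, b, c]) \<union>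
    (if b = 0 then {} else insert_zero a ` unshuffles [a, b - 1, c]) \<union>
    (if c = 0 then {} else insert_zero (a + b) ` unshuffles [a, b, c - 1])"
    (is "_ = ?A \<union> ?B \<union> ?C")
proof (intro equalityI subsetI)
  fix \<sigma> assume \<sigma>: "\<sigma> \<in> unshuffles [a, b, c]"
  then have perm: "\<sigma> permutes {..<Suc n}"
    and mono: "strict_mono_on {0..<a} \<sigma>" "strict_mono_on {a..<a + b} \<sigma>" "strict_mono_on {a + b..<a + b + c} \<sigma>"
    using assms by (auto simp: unshuffles3)
  obtain i where i: "i < Suc n" "\<sigma> i = 0"
    using permutes_image[OF perm] by (metis imageE lessThan_iff zero_less_Suc)
  have start: "i = k" if "strict_mono_on {k..<l} \<sigma>" "k \<le> i" "i < l" for k l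
    using that i strict_mono_onD[OF that(1), of k i] by fastforce
  have del: "delete_zero i \<sigma> permutes {..<n}" using delete_zero_permutes[OF perm] i by simp
  have \<sigma>_eq: "\<sigma> = insert_zero i (delete_zero i \<sigma>)"
    using insert_delete_zero[of \<sigma> i] i permutes_inj[OF perm] by simp
  note mono' = mono[unfolded arg_cong[OF \<sigma>_eq, of "strict_mono_on _"]]
  consider "i < a" | "a \<le> i" "i < a + b" | "a + b \<le> i" "i < a + b + c" using i assms by linarith
  then show "\<sigma> \<in> ?A \<union> ?B \<union> ?C"
  proof cases
    case 1
    then have [simp]: "i = 0" using start[OF mono(1)] by simp
    have "delete_zero i \<sigma> \<in> unshuffles [a - 1, b, c]"
      using del mono' 1 assms unfolding unshuffles3
      by (cases b; cases c; auto simp: strict_mono_on_insert_zero)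
    then show ?thesis using \<sigma>_eq 1 by auto
  next
    case 2
    then have [simp]: "i = a" using start[OF mono(2)] by simp
    have "delete_zero i \<sigma> \<in> unshuffles [a, b - 1, c]"
      using del mono' 2 assms unfolding unshuffles3
      by (cases c; auto simp: strict_mono_on_insert_zero)
    then show ?thesis using \<sigma>_eq 2 by auto
  next
    case 3
    then have [simp]: "i = a + b" using start[OF mono(3)] by simp
    have "delete_zero i \<sigma> \<in> unshuffles [a, b, c - 1]"
      using del mono' 3 assms unfolding unshuffles3
      by (auto simp: strict_mono_on_insert_zero)
    then show ?thesis using \<sigma>_eq 3 by auto
  qed
next
  fix \<sigma> assume "\<sigma> \<in> ?A \<union> ?B \<union> ?C"
  then consider \<tau> where "a \<noteq> 0" "\<sigma> = insert_zero 0 \<tau>" "\<tau> \<in> unshuffles [a - 1, b, c]"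
    | \<tau> where "b \<noteq> 0" "\<sigma> = insert_zero a \<tau>" "\<tau> \<in> unshuffles [a, b - 1, c]"
    | \<tau> where "c \<noteq> 0" "\<sigma> = insert_zero (a + b) \<tau>" "\<tau> \<in> unshuffles [a, b, c - 1]"
    by (auto split: if_splits)
  then show "\<sigma> \<in> unshuffles [a, b, c]"
  proof cases
    case 1
    then have "\<tau> permutes {..<n}" using assms by (auto simp: unshuffles3 algebra_simps)
    then show ?thesis using 1 assms insert_zero_permutes(1)[of \<tau> n 0] unfolding unshuffles3
      by (cases a; auto simp: strict_mono_on_insert_zero)
  next
    case 2
    then have "\<tau> permutes {..<n}" using assms by (auto simp: unshuffles3 algebra_simps)
    then show ?thesis using 2 assms insert_zero_permutes(1)[of \<tau> n a] unfolding unshuffles3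
      by (cases b; auto simp: strict_mono_on_insert_zero)
  next
    case 3
    then have "\<tau> permutes {..<n}" using assms by (auto simp: unshuffles3 algebra_simps)
    then show ?thesis using 3 assms insert_zero_permutes(1)[of \<tau> n "a + b"] unfolding unshuffles3
      by (cases c; auto simp: strict_mono_on_insert_zero)
  qed
qed

text \<open>The bridge from permutations to \<open>shsum\<close>. The block in which an unshuffle
  takes the value 0 is the part that receives the head, and inserting 0 at the start of this block
  has the sign of passing all earlier blocks. The length conditions on the right pick out the
  prescribed block sizes.\<close>

lemma sum_unshuffles:
  assumes "length xs = a + b + c"
  shows "(\<Sum>\<sigma>\<in>unshuffles [a, b, c]. sg (if evenperm \<sigma> then 0 else 1)
      (let zs = permute_list \<sigma> xs in F (take a zs) (take b (drop a zs)) (drop (a + b) zs))) =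
    shsum xs (\<lambda>S U. shsum S (\<lambda>T A.
      if length T = a \<and> length A = b \<and> length U = c then F T A U else 0))"
  using assms
proof (induction xs arbitrary: a b c F)
  case Nil
  have "unshuffles [0, 0, 0] = {id}"
    by (auto simp: unshuffles3 permutes_id)
  then show ?case using Nil by simp
next
  case (Cons w xs)
  let ?G = "\<lambda>a b c F \<sigma> xs. sg (if evenperm \<sigma> then 0 else 1)
      (let zs = permute_list \<sigma> xs in F (take a zs) (take b (drop a zs)) (drop (a + b) zs))"
  let ?A = "if a = 0 then {} else insert_zero 0 ` unshuffles [a - 1, b, c]"
  let ?B = "if b = 0 then {} else insert_zero a ` unshuffles [a, b - 1, c]"
  let ?C = "if c = 0 then {} else insert_zero (a + b) ` unshuffles [a, b, c - 1]"
  have n: "a + b + c = Suc (length xs)" using Cons.prems by simp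
  have inj: "inj_on (insert_zero m) X" for m X by (rule inj_on_inverseI) (rule delete_insert_zero)
  have fin: "finite ?A" "finite ?B" "finite ?C" by (auto simp: finite_unshuffles)
  \<comment> \<open>The position of the value 0 recovers \<open>m\<close>, and different nonempty
    blocks start at different positions.\<close>
  have disj: "?A \<inter> ?B = {}" "(?A \<union> ?B) \<inter> ?C = {}"
  proof -
    have eq: "m = m'" if "insert_zero m \<tau> = insert_zero m' \<tau>'" for m m' \<tau> \<tau>'
      using fun_cong[OF that, of m] by (auto simp: insert_zero_def split: if_splits)
    show "?A \<inter> ?B = {}" "(?A \<union> ?B) \<inter> ?C = {}"
      by (auto split: if_splits dest!: eq)
  qed
  \<comment> \<open>\<open>F'\<close> is \<open>F\<close> with the head already placed in the block
    that starts at \<open>m\<close>, whose size drops by one.\<close>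
  have step: "(\<Sum>\<sigma>\<in>insert_zero m ` unshuffles [a', b', c']. ?G a b c F \<sigma> (w # xs)) =
      sg m (\<Sum>\<tau>\<in>unshuffles [a', b', c']. ?G a' b' c' F' \<tau> xs)"
    if n': "a' + b' + c' = length xs" and m: "m \<le> length xs"
      and F': "\<And>zs. length zs = length xs \<Longrightarrow> F (take a (take m zs @ w # drop m zs))
         (take b (drop a (take m zs @ w # drop m zs))) (drop (a + b) (take m zs @ w # drop m zs)) =
         F' (take a' zs) (take b' (drop a' zs)) (drop (a' + b') zs)" for m a' b' c' F'
  proof -
    have "?G a b c F (insert_zero m \<tau>) (w # xs) = sg m (?G a' b' c' F' \<tau> xs)"
      if "\<tau> \<in> unshuffles [a', b', c']" for \<tau>
    proof -
      have \<tau>: "\<tau> permutes {..<length xs}"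
        using that n' by (auto simp: unshuffles3)
      show ?thesis
        using insert_zero_permutes(2)[OF \<tau> m]
          permute_list_insert_zero[OF \<tau> m, of w] F'[of "permute_list \<tau> xs"]
        by (auto simp: sg_def Let_def)
    qed
    then show ?thesis
      by (simp add: sum.reindex[OF inj] sg_def sum_negf o_def)
  qed
  have A: "(\<Sum>\<sigma>\<in>?A. ?G a b c F \<sigma> (w # xs)) = shsum xs (\<lambda>S U. shsum S (\<lambda>T A.
      if length (w # T) = a \<and> length A = b \<and> length U = c then F (w # T) A U else 0))"
  proof (cases a)
    case (Suc a')
    have "(\<Sum>\<sigma>\<in>insert_zero 0 ` unshuffles [a', b, c]. ?G a b c F \<sigma> (w # xs)) =
      sg 0 (\<Sum>\<tau>\<in>unshuffles [a', b, c]. ?G a' b c (\<lambda>T. F (w # T)) \<tau> xs)"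
      by (rule step) (use n Suc in auto)
    then show ?thesis using Suc n Cons.IH[of a' b c "\<lambda>T. F (w # T)"] by simp
  qed simp
  have B: "(\<Sum>\<sigma>\<in>?B. ?G a b c F \<sigma> (w # xs)) = shsum xs (\<lambda>S U. shsum S (\<lambda>T A. sg (length T)
      (if length T = a \<and> length (w # A) = b \<and> length U = c then F T (w # A) U else 0)))"
  proof (cases b)
    case (Suc b')
    have "(\<Sum>\<sigma>\<in>insert_zero a ` unshuffles [a, b', c]. ?G a b c F \<sigma> (w # xs)) =
      sg a (\<Sum>\<tau>\<in>unshuffles [a, b', c]. ?G a b' c (\<lambda>T A. F T (w # A)) \<tau> xs)"
      by (rule step) (use n Suc in \<open>auto simp: min_def add.commute drop_take\<close>)
    also have "\<dots> = shsum xs (\<lambda>S U. shsum S (\<lambda>T A. sg a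
      (if length T = a \<and> length A = b' \<and> length U = c then F T (w # A) U else 0)))"
      using Suc n Cons.IH[of a b' c "\<lambda>T A. F T (w # A)"] by (simp add: shsum_sg)
    also have "\<dots> = shsum xs (\<lambda>S U. shsum S (\<lambda>T A. sg (length T)
      (if length T = a \<and> length (w # A) = b \<and> length U = c then F T (w # A) U else 0)))"
      by (intro shsum_cong) (auto simp: Suc)
    finally show ?thesis using Suc by simp
  qed simp
  have C: "(\<Sum>\<sigma>\<in>?C. ?G a b c F \<sigma> (w # xs)) = shsum xs (\<lambda>S U. sg (length S) (shsum S (\<lambda>T A. 
      (if length T = a \<and> length A = b \<and> length (w # U) = c then F T A (w # U) else 0))))"
  proof (cases c)
    case (Suc c')
    have "(\<Sum>\<sigma>\<in>insert_zero (a + b) ` unshuffles [a, b, c']. ?G a b c F \<sigma> (w # xs)) =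
      sg (a + b) (\<Sum>\<tau>\<in>unshuffles [a, b, c']. ?G a b c' (\<lambda>T A U. F T A (w # U)) \<tau> xs)"
      by (rule step) (use n Suc in \<open>auto simp: min_def add.commute drop_take\<close>)
    also have "\<dots> = shsum xs (\<lambda>S U. shsum S (\<lambda>T A. sg (a + b)
      (if length T = a \<and> length A = b \<and> length U = c' then F T A (w # U) else 0)))"
      using Suc n Cons.IH[of a b c' "\<lambda>T A U. F T A (w # U)"] by (simp add: shsum_sg)
    also have "\<dots> = shsum xs (\<lambda>S U. shsum S (\<lambda>T A. sg (length S)
      (if length T = a \<and> length A = b \<and> length (w # U) = c then F T A (w # U) else 0)))"
      by (intro shsum_cong) (auto simp: Suc)
    finally show ?thesis using Suc by (simp add: shsum_sg)
  qed simp
  have "(\<Sum>\<sigma>\<in>unshuffles [a, b, c]. ?G a b c F \<sigma> (w # xs)) =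
     (\<Sum>\<sigma>\<in>?A. ?G a b c F \<sigma> (w # xs)) + (\<Sum>\<sigma>\<in>?B. ?G a b c F \<sigma> (w # xs)) + (\<Sum>\<sigma>\<in>?C. ?G a b c F \<sigma> (w # xs))"
    unfolding unshuffles_Suc[OF n]
    by (subst sum.union_disjoint[OF _ fin(3) disj(2)]) (simp_all only: finite_Un fin sum.union_disjoint[OF fin(1,2) disj(1)] simp_thms)
  then show ?case unfolding A B C by (simp add: shsum_add)
qed

section \<open>The Matsushima-Nijenhuis bracket\<close>

lemma shsum_only_right:
  fixes xs :: "'a list"
  shows "shsum xs (\<lambda>T U. if T = [] then f U else 0) = f xs"
proof (induction xs arbitrary: f)
  case (Cons w xs)
  have "(\<lambda>(T :: 'a list) U. sg (length T) (if T = [] then f (w # U) else 0)) = (\<lambda>T U. if T = [] then f (w # U) else 0)"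
    by (simp add: fun_eq_iff)
  then show ?case by (simp add: Cons.IH)
qed simp

text \<open>\<open>MN_circ\<close> prescribes the block lengths and \<open>ins_prod\<close> sums
  over all splittings; the additional terms vanish because \<open>P\<close> and \<open>Q\<close> are
  homogeneous.\<close>

lemma (in vector_space) MN_circ_eq_ins_prod:
  assumes P: "biadditive P" "of_degree p P" and Q: "of_degree q Q"
  shows "MN_circ scale p q P Q = ins_prod P Q"
proof (intro ext)
  fix xs y
  have sgn: "scale (of_int (sign \<sigma>)) x = sg (if evenperm \<sigma> then 0 else 1) x" for \<sigma> x
    by (simp add: sign_def)
  note zero = biadditive_zero[OF P(1)]
  show "MN_circ scale p q P Q xs y = ins_prod P Q xs y"
  proof (cases "length xs = p + q")
    case len: True
    have Q0: "Q T x = 0" if "length T \<noteq> q" for T x using Q that by (simp add: of_degree_def)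
    have P0: "P T x = 0" if "length T \<noteq> p" for T x using P(2) that by (simp add: of_degree_def)
    have 1: "(if p = 0 then 0 else \<Sum>\<sigma>\<in>unshuffles [q, 1, p - 1]. scale (of_int (sign \<sigma>))
            (let zs = permute_list \<sigma> xs in P (Q (take q zs) (zs ! q) # drop (q + 1) zs) y)) =
        shsum xs (\<lambda>S U. P (alternation Q S # U) y)"
    proof (cases "p = 0")
      case True
      then have "P (alternation Q S # U) y = 0" for S U by (intro P0) simp
      then show ?thesis using True by simp
    next
      case False
      \<comment> \<open>The middle block reaches \<open>sum_unshuffles\<close> as a list of length
        one, so the selected argument is written as its head; as \<open>p\<close> is nonzero,
        position \<open>q\<close> exists.\<close>
      have hd: "hd (take 1 (drop q zs)) = zs ! q" if "length zs = p + q" for zs :: "'b list"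
        using that False by (simp add: hd_take hd_drop_conv_nth)
      have "(\<Sum>\<sigma>\<in>unshuffles [q, 1, p - 1]. scale (of_int (sign \<sigma>))
          (let zs = permute_list \<sigma> xs in P (Q (take q zs) (zs ! q) # drop (q + 1) zs) y)) =
        (\<Sum>\<sigma>\<in>unshuffles [q, 1, p - 1]. sg (if evenperm \<sigma> then 0 else 1)
          (let zs = permute_list \<sigma> xs in P (Q (take q zs) (hd (take 1 (drop q zs))) # drop (q + 1) zs) y))"
        unfolding sgn by (intro sum.cong refl) (simp only: Let_def hd len length_permute_list)
      also have "\<dots> = shsum xs (\<lambda>S U. shsum S (\<lambda>T A.
          if length T = q \<and> length A = 1 \<and> length U = p - 1 then P (Q T (hd A) # U) y else 0))"
        using sum_unshuffles[of xs q 1 "p - 1" "\<lambda>T A U. P (Q T (hd A) # U) y"] len False by simp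
      also have "\<dots> = shsum xs (\<lambda>S U. shsum S (\<lambda>T A. P (on_single (Q T) A # U) y))"
        by (intro shsum_cong) (auto simp: on_single_def Q0 P0 zero split: list.splits)
      also have "\<dots> = shsum xs (\<lambda>S U. P (alternation Q S # U) y)"
        unfolding alternation_def
        by (subst shsum_hom[of "\<lambda>w. P (w # _) y"]) (simp_all add: biadditive_Cons[OF P(1)])
      finally show ?thesis using False by simp
    qed
    have "(\<Sum>\<sigma>\<in>unshuffles [p, q]. scale (of_int (sign \<sigma>))
          (let zs = permute_list \<sigma> xs in P (take p zs) (Q (drop p zs) y))) =
        shsum xs (\<lambda>S U. shsum S (\<lambda>T A.
          if length T = 0 \<and> length A = p \<and> length U = q then P A (Q U y) else 0))"
      using sum_unshuffles[of xs 0 p q "\<lambda>T A U. P A (Q U y)"] len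
      by (simp only: sgn unshuffles2[of p q]) simp
    also have "\<dots> = shsum xs (\<lambda>S U. shsum S (\<lambda>T A. if T = [] then P A (Q U y) else 0))"
      by (intro shsum_cong) (auto simp: Q0 P0 zero)
    also have "\<dots> = shsum xs (\<lambda>A U. P A (Q U y))"
      by (simp add: shsum_only_right)
    \<comment> \<open>Putting the arguments of \<open>Q\<close> first produces a second factor
      \<open>(-1)^(p*q)\<close>, which cancels the one in \<open>MN_circ\<close>.\<close>
    also have "\<dots> = shsum xs (\<lambda>U A. sg (p * q) (P A (Q U y)))"
      by (subst shsum_swap, rule shsum_cong) (metis P0 Q0 mult.commute sg_simps(3) zero(2))
    finally have 2: "scale ((- 1) ^ (p * q)) (\<Sum>\<sigma>\<in>unshuffles [p, q]. scale (of_int (sign \<sigma>))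
          (let zs = permute_list \<sigma> xs in P (take p zs) (Q (drop p zs) y))) =
        shsum xs (\<lambda>U A. P A (Q U y))"
      by (simp only: scale_power_minus_one shsum_sg) (simp add: sg_def)
    show ?thesis
      unfolding MN_circ_def using len 1 2 by (simp add: ins_prod_def shsum_add)
  next
    case False
    have "P (alternation Q T # U) y + P U (Q T y) = 0" if "length T + length U = length xs" for T U
    proof -
      have "P (alternation Q T # U) y = 0"
        using of_degree_alternation[OF Q, of T] P(2) zero that False
        by (cases "length T = Suc q") (auto simp: of_degree_def)
      moreover have "P U (Q T y) = 0"
        using Q P(2) zero that False by (cases "length T = q") (auto simp: of_degree_def)
      ultimately show ?thesis by simp
    qed
    then have "ins_prod P Q xs y = shsum xs (\<lambda>T U. 0)"
      unfolding ins_prod_def by (intro shsum_cong) auto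
    then show ?thesis using False by (simp add: MN_circ_def)
  qed
qed

section \<open>Alternating multilinear maps\<close>

text \<open>In contrast to \<open>multilinear_on\<close>, no length is fixed. A cochain vanishes
  away from its own length, hence is multilinear at every length, and inductions over lists need not
  track it.\<close>

definition multilinear ::
  "('k \<Rightarrow> 'a::ab_group_add \<Rightarrow> 'a) \<Rightarrow> ('k \<Rightarrow> 'b::ab_group_add \<Rightarrow> 'b) \<Rightarrow> ('a list \<Rightarrow> 'b) \<Rightarrow> bool" where
  "multilinear sA sB G \<longleftrightarrow> (\<forall>us x y c vs. G (us @ (x + y) # vs) = G (us @ x # vs) + G (us @ y # vs) \<and>
     G (us @ sA c x # vs) = sB c (G (us @ x # vs)))"

text \<open>The condition on equal neighbours passes through the shuffle recursion easily; with
  multilinearity it implies vanishing on every list with a repetition.\<close>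

definition alternating :: "('a list \<Rightarrow> 'b::zero) \<Rightarrow> bool" where
  "alternating G \<longleftrightarrow> (\<forall>us a vs. G (us @ a # a # vs) = 0)"

lemma multilinear_swap:
  assumes "multilinear sA sB G" "alternating G"
  shows "G (us @ x # y # vs) = - G (us @ y # x # vs)"
proof -
  have add: "G (us @ (x + y) # vs) = G (us @ x # vs) + G (us @ y # vs)" for us x y vs
    using assms(1) by (simp add: multilinear_def)
  have "0 = G (us @ (x + y) # (x + y) # vs)"
    using assms(2) by (simp add: alternating_def)
  also have "\<dots> = G (us @ x # (x + y) # vs) + G (us @ y # (x + y) # vs)" by (rule add)
  also have "G (us @ x # (x + y) # vs) = G (us @ x # x # vs) + G (us @ x # y # vs)"
    using add[of "us @ [x]"] by simp
  also have "G (us @ y # (x + y) # vs) = G (us @ y # x # vs) + G (us @ y # y # vs)"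
    using add[of "us @ [y]"] by simp
  finally show ?thesis using assms(2) by (simp add: alternating_def eq_neg_iff_add_eq_0)
qed

lemma multilinear_move_last:
  assumes "multilinear sA sB G" "alternating G"
  shows "G (us @ x # vs) = sg (length vs) (G (us @ vs @ [x]))"
proof (induction vs arbitrary: us)
  case (Cons v vs)
  show ?case using multilinear_swap[OF assms, of us x v vs] Cons.IH[of "us @ [v]"] by simp
qed simp

lemma multilinear_not_distinct:
  assumes "multilinear sA sB G" "alternating G" "\<not> distinct xs"
  shows "G xs = 0"
proof -
  obtain us a vs ws where xs: "xs = us @ [a] @ vs @ [a] @ ws"
    using not_distinct_decomp[OF assms(3)] by blast
  have "G (us @ a # vs @ a # ws) = 0"
  proof (induction vs arbitrary: us)
    case Nil
    then show ?case using assms(2) by (simp add: alternating_def)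
  next
    case (Cons v vs)
    show ?case using multilinear_swap[OF assms(1,2), of us a v "vs @ a # ws"] Cons.IH[of "us @ [v]"] by simp
  qed
  then show ?thesis by (simp add: xs)
qed

lemma Hom_wedge_iff:
  "f \<in> Hom_wedge sA sB sC n \<longleftrightarrow> (\<forall>b. multilinear sA sC (\<lambda>xs. f xs b)) \<and>
     (\<forall>xs. Vector_Spaces.linear sB sC (f xs)) \<and> (\<forall>b. alternating (\<lambda>xs. f xs b)) \<and>
     (\<forall>xs b. length xs \<noteq> n \<longrightarrow> f xs b = 0)"
  (is "?L \<longleftrightarrow> ?R")
proof
  assume f: ?L
  then interpret Vector_Spaces.linear sB sC "f []" by (auto simp: Hom_wedge_def)
  have len: "f xs b = 0" if "length xs \<noteq> n" for xs b using f that by (auto simp: Hom_wedge_def)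
  have ml: "f (us @ (x + y) # vs) b = f (us @ x # vs) b + f (us @ y # vs) b"
    "f (us @ sA c x # vs) b = sC c (f (us @ x # vs) b)" for us x y vs c b
  proof -
    have "f (us @ (x + y) # vs) b = f (us @ x # vs) b + f (us @ y # vs) b \<and>
      f (us @ sA c x # vs) b = sC c (f (us @ x # vs) b)"
    proof (cases "length us + 1 + length vs = n")
      case True
      have "multilinear_on sA sC UNIV n (\<lambda>xs. f xs b)" using f unfolding Hom_wedge_def by blast
      then show ?thesis unfolding multilinear_on_def using True by blast
    next
      case False
      then show ?thesis by (simp add: len)
    qed
    then show "f (us @ (x + y) # vs) b = f (us @ x # vs) b + f (us @ y # vs) b"
      "f (us @ sA c x # vs) b = sC c (f (us @ x # vs) b)" by auto
  qed
  show ?R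
    using f len ml by (auto simp: Hom_wedge_def multilinear_def alternating_def)
next
  assume f: ?R
  then have "f xs b = 0" if "\<not> distinct xs" for xs b
    using multilinear_not_distinct[of sA sC "\<lambda>xs. f xs b"] that by blast
  then show ?L using f unfolding Hom_wedge_def by (auto simp: multilinear_def multilinear_on_def)
qed

lemma multilinear_shsum:
  assumes "vector_space sB" "\<And>U. multilinear sA sB (\<lambda>T. F T U)" "\<And>T. multilinear sA sB (F T)"
  shows "multilinear sA sB (\<lambda>xs. shsum xs F)"
proof -
  interpret B: vector_space sB by fact
  have hom: "shsum xs (\<lambda>T U. sB c (F T U)) = sB c (shsum xs F)" for xs c F
    by (rule shsum_hom[symmetric]) (rule B.scale_right_distrib)
  have "shsum (us @ (x + y) # vs) F = shsum (us @ x # vs) F + shsum (us @ y # vs) F \<and>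
     shsum (us @ sA c x # vs) F = sB c (shsum (us @ x # vs) F)" for us x y c vs
    using assms(2,3)
  proof (induction us arbitrary: F)
    case Nil
    have F: "F ((x + y) # T) U = F (x # T) U + F (y # T) U" "F (sA c x # T) U = sB c (F (x # T) U)"
      "F T ((x + y) # U) = F T (x # U) + F T (y # U)" "F T (sA c x # U) = sB c (F T (x # U))" for T U
      using Nil(1)[of U] Nil(2)[of T] unfolding multilinear_def by (metis append_Nil)+
    show ?case
      by (simp add: F shsum_add sg_add B.scale_sg[symmetric] hom B.scale_right_distrib)
  next
    case (Cons u us)
    have "multilinear sA sB (\<lambda>T. F (u # T) U)" "multilinear sA sB (F (u # T))" for T U
      using Cons.prems unfolding multilinear_def by (metis append_Cons)+
    note IH1 = Cons.IH[of "\<lambda>T. F (u # T)", OF this]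
    have sgA: "multilinear sA sB (\<lambda>T. sg (length T) (F T (u # U)))" for U
      using Cons.prems(1)[of "u # U"] unfolding multilinear_def
      by (simp add: sg_def B.scale_right_distrib)
    have sgB: "multilinear sA sB (\<lambda>U. sg (length T) (F T (u # U)))" for T
      using Cons.prems(2)[of T] unfolding multilinear_def
      by (auto simp: sg_def simp flip: append_Cons)
    show ?case using IH1 Cons.IH[OF sgA sgB] by (simp add: B.scale_right_distrib)
  qed
  then show ?thesis unfolding multilinear_def by blast
qed

text \<open>Two equal neighbours that go to the same part give zero. If they are separated, the two
  ways to do so differ by one transposition and cancel.\<close>

lemma alternating_shsum:
  fixes F :: "'a list \<Rightarrow> 'a list \<Rightarrow> 'b::ab_group_add"
  assumes "\<And>U. alternating (\<lambda>T. F T U)" "\<And>T. alternating (F T)"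
  shows "alternating (\<lambda>xs. shsum xs F)"
proof -
  have "shsum (us @ a # a # vs) F = 0" for us a vs
    using assms
  proof (induction us arbitrary: F)
    case Nil
    have F: "F (a # a # T) U = 0" "F T (a # a # U) = 0" for T U
      using Nil(1)[of U] Nil(2)[of T] unfolding alternating_def by (metis append_Nil)+
    show ?case by (simp add: F shsum_minus)
  next
    case (Cons u us)
    have "alternating (\<lambda>T. F (u # T) U)" "alternating (F (u # T))" for T U
      using Cons.prems unfolding alternating_def by (metis append_Cons)+
    note IH1 = Cons.IH[of "\<lambda>T. F (u # T)", OF this]
    have sgA: "alternating (\<lambda>T. sg (length T) (F T (u # U)))" for U
      using Cons.prems(1)[of "u # U"] unfolding alternating_def by simp
    have sgB: "alternating (\<lambda>U. sg (length T) (F T (u # U)))" for T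
      using Cons.prems(2)[of T] unfolding alternating_def
      by (auto simp flip: append_Cons)
    show ?case using IH1 Cons.IH[OF sgA sgB] by simp
  qed
  then show ?thesis unfolding alternating_def by blast
qed

lemma multilinear_comp_linear:
  assumes "multilinear sA sB G" "\<And>x y. h (x + y) = h x + h y" "\<And>c x. h (sB c x) = sC c (h x)"
  shows "multilinear sA sC (\<lambda>xs. h (G xs))"
  using assms unfolding multilinear_def by simp

lemma multilinear_Cons: "multilinear sA sB G \<Longrightarrow> multilinear sA sB (\<lambda>xs. G (a # xs))"
  unfolding multilinear_def by (metis append_Cons)

lemma alternating_Cons: "alternating G \<Longrightarrow> alternating (\<lambda>xs. G (a # xs))"
  unfolding alternating_def by (metis append_Cons)

lemma multilinear_add_fun:
  assumes "vector_space sB" "multilinear sA sB F" "multilinear sA sB G"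
  shows "multilinear sA sB (\<lambda>xs. F xs + G xs)"
proof -
  interpret vector_space sB by fact
  show ?thesis using assms(2,3) unfolding multilinear_def by (simp add: scale_right_distrib)
qed

lemma multilinear_scale_fun:
  assumes "vector_space sB" "multilinear sA sB F"
  shows "multilinear sA sB (\<lambda>xs. sB c (F xs))"
proof -
  interpret vector_space sB by fact
  show ?thesis using assms(2) unfolding multilinear_def by (simp add: scale_right_distrib mult.commute)
qed

section \<open>The graded commutator of insertion and its Jacobi identity\<close>

definition bracket :: "nat \<Rightarrow> nat \<Rightarrow> 'w::ab_group_add cochain \<Rightarrow> 'w cochain \<Rightarrow> 'w cochain" where
  "bracket p q P Q = ins_prod P Q - sg (p * q) (ins_prod Q P)"

lemma ins_prod_left:
  "ins_prod (P + P') Q = ins_prod P Q + ins_prod P' Q"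
  "ins_prod (P - P') Q = ins_prod P Q - ins_prod P' Q"
  "ins_prod (sg n P) Q = sg n (ins_prod P Q)"
  by (simp_all add: ins_prod_def fun_eq_iff sg_apply shsum_add shsum_diff
      shsum_sg[symmetric] sg_add)

lemma alternation_add: "alternation (Q + Q') xs = alternation Q xs + alternation Q' xs"
proof -
  have eq: "(\<lambda>T Z. on_single ((Q + Q') T) Z) = (\<lambda>T Z. on_single (Q T) Z + on_single (Q' T) Z)"
    by (auto simp: on_single_def fun_eq_iff split: list.splits)
  show ?thesis unfolding alternation_def eq by (rule shsum_add)
qed

lemma ins_prod_right:
  assumes "biadditive P"
  shows "ins_prod P (Q + Q') = ins_prod P Q + ins_prod P Q'"
    and "ins_prod P (Q - Q') = ins_prod P Q - ins_prod P Q'"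
    and "ins_prod P (sg n Q) = sg n (ins_prod P Q)"
proof -
  have add: "ins_prod P (Q + Q') = ins_prod P Q + ins_prod P Q'" for Q Q'
    by (simp add: ins_prod_def fun_eq_iff alternation_add biadditive_Cons[OF assms]
        biadditive_last[OF assms] shsum_add)
  then show "ins_prod P (Q + Q') = ins_prod P Q + ins_prod P Q'" .
  show diff: "ins_prod P (Q - Q') = ins_prod P Q - ins_prod P Q'" for Q Q'
    using add[of "Q - Q'" Q'] by simp
  have "ins_prod P (- Q) = - ins_prod P Q"
    using diff[of 0 Q] diff[of 0 0] by simp
  then show "ins_prod P (sg n Q) = sg n (ins_prod P Q)" by (simp add: sg_def)
qed

lemma bracket_skew: "bracket q p Q P = - sg (p * q) (bracket p q P Q)"
  by (simp add: bracket_def sg_def mult.commute)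

text \<open>The graded commutator of a right pre-Lie product is a Lie bracket: associators with the
  same left factor cancel in pairs. It is stated in Leibniz form, with \<open>P\<close> acting on
  the bracket of \<open>Q\<close> and \<open>R\<close>.\<close>

lemma bracket_jacobi:
  assumes P: "biadditive P" "swap_alternating P" "of_degree p P"
    and Q: "biadditive Q" "swap_alternating Q" "of_degree q Q"
    and R: "biadditive R" "swap_alternating R" "of_degree r R"
  shows "bracket (p + q) r (bracket p q P Q) R =
    bracket p (q + r) P (bracket q r Q R) - sg (p * q) (bracket q (p + r) Q (bracket p r P R))"
proof -
  have swap: "ins_prod (ins_prod A B) C = ins_prod A (ins_prod B C) +
      sg (b * c) (ins_prod (ins_prod A C) B - ins_prod A (ins_prod C B))"
    if "biadditive A" "swap_alternating A" "biadditive B" "of_degree b B" "biadditive C" "of_degree c C"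
    for A B C :: "'a cochain" and b c
    using ins_defect_swap[OF that(1,2,4,6)]
    unfolding ins_prod_associator[OF that(1,3), symmetric] ins_prod_associator[OF that(1,5), symmetric]
    by (simp only: diff_eq_eq add.commute)
  \<comment> \<open>One right pre-Lie identity for each choice of the left factor; the rest is
    collecting terms for each parity pattern.\<close>
  note 1 = swap[OF P(1,2) Q(1,3) R(1,3)] and 2 = swap[OF Q(1,2) P(1,3) R(1,3)]
    and 3 = swap[OF R(1,2) P(1,3) Q(1,3)]
  note lin = ins_prod_left ins_prod_right[OF P(1)] ins_prod_right[OF Q(1)] ins_prod_right[OF R(1)]
  show ?thesis
    unfolding bracket_def lin 1 2 3
    by (cases "even p"; cases "even q"; cases "even r") (simp_all add: sg_def algebra_simps)
qed

section \<open>Cochains and equivariant cochains are closed under insertion and bracket\<close>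

abbreviation cochains :: "('k::field \<Rightarrow> 'w::ab_group_add \<Rightarrow> 'w) \<Rightarrow> nat \<Rightarrow> 'w cochain set" where
  "cochains s n \<equiv> Hom_wedge s s s n"

text \<open>The factor \<open>c\<close> encodes the weight of \<open>P\<close> with respect to
  \<open>\<phi>\<close>. Factors multiply under insertion, so weights add.\<close>

definition equivariant ::
  "('k \<Rightarrow> 'w \<Rightarrow> 'w) \<Rightarrow> ('w \<Rightarrow> 'w) \<Rightarrow> 'k \<Rightarrow> 'w cochain \<Rightarrow> bool" where
  "equivariant s \<phi> c P \<longleftrightarrow> (\<forall>xs y. \<phi> (P xs y) = s c (P (map \<phi> xs) (\<phi> y)))"

context vector_space
begin

lemma cochainD:
  assumes "P \<in> cochains scale p"
  shows "multilinear scale scale (\<lambda>xs. P xs y)" "alternating (\<lambda>xs. P xs y)"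
    "P xs (x + y) = P xs x + P xs y" "P xs (scale c y) = scale c (P xs y)"
    "length xs \<noteq> p \<Longrightarrow> P xs y = 0"
  using assms by (auto simp: Hom_wedge_iff Vector_Spaces.linear_iff)

lemma cochainI:
  assumes "\<And>y. multilinear scale scale (\<lambda>xs. P xs y)" "\<And>y. alternating (\<lambda>xs. P xs y)"
    "\<And>xs x y. P xs (x + y) = P xs x + P xs y" "\<And>xs c y. P xs (scale c y) = scale c (P xs y)"
    "\<And>xs y. length xs \<noteq> p \<Longrightarrow> P xs y = 0"
  shows "P \<in> cochains scale p"
  using assms vector_space_axioms by (auto simp: Hom_wedge_iff Vector_Spaces.linear_iff)

lemma cochain_props:
  assumes "P \<in> cochains scale p"
  shows "biadditive P" "swap_alternating P" "of_degree p P"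
proof -
  note D = cochainD[OF assms]
  show "biadditive P" using D(1,3) by (simp add: biadditive_def multilinear_def)
  show "swap_alternating P"
    using multilinear_swap[OF D(1,2), of "[]"] unfolding swap_alternating_def append_Nil by blast
  show "of_degree p P" using D(5) by (simp add: of_degree_def)
qed

lemma MN_bracket_eq:
  assumes "P \<in> cochains scale p" "Q \<in> cochains scale q"
  shows "MN_bracket scale p q P Q = bracket p q P Q"
  unfolding MN_bracket_def bracket_def cochain_scale_def
  by (simp add: MN_circ_eq_ins_prod[OF cochain_props(1,3)[OF assms(1)] cochain_props(3)[OF assms(2)]]
      MN_circ_eq_ins_prod[OF cochain_props(1,3)[OF assms(2)] cochain_props(3)[OF assms(1)]]
      scale_power_minus_one fun_eq_iff sg_apply mult.commute)

lemma shsum_scale: "shsum xs (\<lambda>T U. scale c (F T U)) = scale c (shsum xs F)"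
  by (rule shsum_hom[symmetric]) (rule scale_right_distrib)

lemma multilinear_alternation:
  assumes "Q \<in> cochains scale q"
  shows "multilinear scale scale (alternation Q)" and "alternating (alternation Q)"
proof -
  note D = cochainD[OF assms]
  have long: "on_single f Z = 0" if "length Z \<noteq> 1" for f :: "'b \<Rightarrow> 'b" and Z
    using that by (auto simp: on_single_def split: list.splits)
  have "on_single (Q T) (us @ (x + y) # vs) = on_single (Q T) (us @ x # vs) + on_single (Q T) (us @ y # vs) \<and>
     on_single (Q T) (us @ scale c x # vs) = scale c (on_single (Q T) (us @ x # vs))" for T us vs x y c
    by (cases "us = [] \<and> vs = []") (auto simp: long D(3,4))
  then have 1: "multilinear scale scale (on_single (Q T))" for T
    unfolding multilinear_def by blast
  have 24: "multilinear scale scale (\<lambda>T. on_single (Q T) Z) \<and> alternating (\<lambda>T. on_single (Q T) Z)" for Z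
  proof (cases "length Z = 1")
    case True
    then obtain z where "Z = [z]" by (auto simp: length_Suc_conv)
    then show ?thesis by (simp add: D(1,2))
  next
    case False
    then show ?thesis by (simp add: long multilinear_def alternating_def)
  qed
  have 3: "alternating (on_single (Q T))" for T
    by (simp add: alternating_def long)
  show "multilinear scale scale (alternation Q)"
    using multilinear_shsum[OF vector_space_axioms, of scale "\<lambda>T Z. on_single (Q T) Z"] 1 24
    unfolding alternation_def[abs_def] by blast
  show "alternating (alternation Q)"
    using alternating_shsum[of "\<lambda>T Z. on_single (Q T) Z"] 3 24
    unfolding alternation_def[abs_def] by blast
qed

lemma ins_prod_cochain:
  assumes P: "P \<in> cochains scale p" and Q: "Q \<in> cochains scale q"
  shows "ins_prod P Q \<in> cochains scale (p + q)"
proof (rule cochainI)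
  note DP = cochainD[OF P] and DQ = cochainD[OF Q]
  note VQ = multilinear_alternation[OF Q]
  have P1: "P ((x + y) # U) z = P (x # U) z + P (y # U) z" "P (scale c x # U) z = scale c (P (x # U) z)"
    for x y U z c using DP(1) unfolding multilinear_def by (metis append_Nil)+
  note P0 = biadditive_zero[OF cochain_props(1)[OF P]]
  show "multilinear scale scale (\<lambda>xs. ins_prod P Q xs y)" for y
    unfolding ins_prod_def
  proof (rule multilinear_shsum[OF vector_space_axioms])
    show "multilinear scale scale (\<lambda>T. P (alternation Q T # U) y + P U (Q T y))" for U
      by (intro multilinear_add_fun vector_space_axioms multilinear_comp_linear[OF VQ(1), of "\<lambda>w. P (w # U) y"]
          multilinear_comp_linear[OF DQ(1), of "P U"] P1 DP)
    show "multilinear scale scale (\<lambda>U. P (alternation Q T # U) y + P U (Q T y))" for T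
      by (intro multilinear_add_fun vector_space_axioms DP multilinear_Cons[OF DP(1)])
  qed
  show "alternating (\<lambda>xs. ins_prod P Q xs y)" for y
    unfolding ins_prod_def
  proof (rule alternating_shsum)
    show "alternating (\<lambda>T. P (alternation Q T # U) y + P U (Q T y))" for U
      using VQ(2) DQ(2) by (simp add: alternating_def P0)
    show "alternating (\<lambda>U. P (alternation Q T # U) y + P U (Q T y))" for T
      using alternating_Cons[OF DP(2)] DP(2) by (simp add: alternating_def)
  qed
  show "ins_prod P Q xs (x + y) = ins_prod P Q xs x + ins_prod P Q xs y" for xs x y
    by (simp add: ins_prod_def DP DQ shsum_add)
  show "ins_prod P Q xs (scale c y) = scale c (ins_prod P Q xs y)" for xs c y
    by (simp add: ins_prod_def DP DQ shsum_scale scale_right_distrib[symmetric])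
  show "ins_prod P Q xs y = 0" if "length xs \<noteq> p + q" for xs y
  proof -
    have "P (alternation Q T # U) y + P U (Q T y) = 0" if "length T + length U = length xs" for T U
    proof -
      have "P (alternation Q T # U) y = 0"
        using of_degree_alternation[OF cochain_props(3)[OF Q], of T] DP(5) P0 that \<open>length xs \<noteq> _\<close>
        by (cases "length T = Suc q") auto
      moreover have "P U (Q T y) = 0"
        using DQ(5) DP(5) P0 that \<open>length xs \<noteq> _\<close> by (cases "length T = q") auto
      ultimately show ?thesis by simp
    qed
    then have "ins_prod P Q xs y = shsum xs (\<lambda>T U. 0)"
      unfolding ins_prod_def by (intro shsum_cong) auto
    then show ?thesis by simp
  qed
qed

lemma cochains_zero: "0 \<in> cochains scale n"
  by (rule cochainI) (auto simp: multilinear_def alternating_def)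

lemma cochain_adjacent: "P \<in> cochains scale n \<Longrightarrow> P (us @ a # a # vs) y = 0"
  using cochainD(2) unfolding alternating_def by blast

lemma cochains_add: "P \<in> cochains scale n \<Longrightarrow> Q \<in> cochains scale n \<Longrightarrow> P + Q \<in> cochains scale n"
  by (rule cochainI)
    (auto simp: cochainD multilinear_add_fun vector_space_axioms scale_right_distrib alternating_def
      cochain_adjacent)

lemma cochains_scale: "P \<in> cochains scale n \<Longrightarrow> cochain_scale scale c P \<in> cochains scale n"
  unfolding cochain_scale_def
  by (rule cochainI)
    (auto simp: cochainD multilinear_scale_fun[OF vector_space_axioms cochainD(1)]
      scale_right_distrib alternating_def mult.commute cochain_adjacent)

lemma cochain_scale_sign: "cochain_scale scale ((- 1) ^ n) P = sg n P"
  by (simp add: cochain_scale_def scale_power_minus_one fun_eq_iff sg_apply)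

lemma cochains_sg: "P \<in> cochains scale n \<Longrightarrow> sg k P \<in> cochains scale n"
  using cochains_scale[of P n "(- 1) ^ k"] by (simp add: cochain_scale_sign)

lemma cochains_diff: "P \<in> cochains scale n \<Longrightarrow> Q \<in> cochains scale n \<Longrightarrow> P - Q \<in> cochains scale n"
  using cochains_add[of P n "- Q"] cochains_sg[of Q n 1] by simp

lemma bracket_cochain: "P \<in> cochains scale p \<Longrightarrow> Q \<in> cochains scale q \<Longrightarrow> bracket p q P Q \<in> cochains scale (p + q)"
  unfolding bracket_def
  by (metis add.commute cochains_diff cochains_sg ins_prod_cochain)

lemma equivariant_ins_prod:
  assumes \<phi>: "Vector_Spaces.linear scale scale \<phi>" and P: "P \<in> cochains scale p"
    and eP: "equivariant scale \<phi> c P" and eQ: "equivariant scale \<phi> d Q"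
  shows "equivariant scale \<phi> (c * d) (ins_prod P Q)"
  unfolding equivariant_def
proof (intro allI)
  fix xs y
  have \<phi>_add: "\<phi> (x + y) = \<phi> x + \<phi> y" for x y using \<phi> by (simp add: Vector_Spaces.linear_iff)
  have "\<phi> 0 + \<phi> 0 = \<phi> 0 + 0" using \<phi>_add[of 0 0] by simp
  then have \<phi>_0: "\<phi> 0 = 0" by (simp only: add_left_cancel)
  note DP = cochainD[OF P]
  have P1: "P (scale c x # U) z = scale c (P (x # U) z)" for x U z c
    using DP(1) unfolding multilinear_def by (metis append_Nil)
  have alt: "\<phi> (alternation Q T) = scale d (alternation Q (map \<phi> T))" for T
  proof -
    have "\<phi> (on_single (Q T) Z) = scale d (on_single (Q (map \<phi> T)) (map \<phi> Z))" for T Z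
      using eQ \<phi>_0 by (auto simp: equivariant_def on_single_def split: list.splits)
    then show ?thesis
      unfolding alternation_def by (simp add: shsum_hom[of \<phi>, OF \<phi>_add] shsum_map shsum_scale)
  qed
  show "\<phi> (ins_prod P Q xs y) = scale (c * d) (ins_prod P Q (map \<phi> xs) (\<phi> y))"
    unfolding ins_prod_def
    using eP eQ
    by (simp add: shsum_hom[of \<phi>, OF \<phi>_add] shsum_map \<phi>_add equivariant_def alt P1 DP(4)
        scale_right_distrib[symmetric] shsum_scale)
qed

lemma equivariant_zero: "\<phi> 0 = 0 \<Longrightarrow> equivariant scale \<phi> c 0"
  by (simp add: equivariant_def)

lemma equivariant_add:
  assumes "Vector_Spaces.linear scale scale \<phi>" "equivariant scale \<phi> c P" "equivariant scale \<phi> c Q"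
  shows "equivariant scale \<phi> c (P + Q)"
  using assms by (simp add: equivariant_def Vector_Spaces.linear_iff scale_right_distrib)

lemma equivariant_scale:
  assumes "Vector_Spaces.linear scale scale \<phi>" "equivariant scale \<phi> c P"
  shows "equivariant scale \<phi> c (cochain_scale scale d P)"
  using assms by (simp add: equivariant_def cochain_scale_def Vector_Spaces.linear_iff mult.commute)

lemma equivariant_bracket:
  assumes \<phi>: "Vector_Spaces.linear scale scale \<phi>" and "P \<in> cochains scale p" "Q \<in> cochains scale q"
    and "equivariant scale \<phi> c P" "equivariant scale \<phi> d Q"
  shows "equivariant scale \<phi> (c * d) (bracket p q P Q)"
proof -
  have "bracket p q P Q = ins_prod P Q + cochain_scale scale ((- 1) ^ Suc (p * q)) (ins_prod Q P)"
    unfolding cochain_scale_sign by (simp add: bracket_def)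
  moreover have "equivariant scale \<phi> (c * d) (ins_prod Q P)"
    using equivariant_ins_prod[OF \<phi> assms(3,5,4)] by (simp add: mult.commute)
  ultimately show ?thesis
    using equivariant_ins_prod[OF \<phi> assms(2,4,5)] equivariant_add[OF \<phi>] equivariant_scale[OF \<phi>] by simp
qed

end

section \<open>The subspaces of lifted cochains\<close>

text \<open>Makes the alternating sum accessible to list induction. The V-component of the head
  passes all of \<open>ws\<close> to reach the last alternating slot.\<close>

lemma (in vector_space) lift_gvgv_Cons:
  "lift_gvgv scale f (w # ws) y =
    (0, sg (length ws) (f (map fst ws) (snd w) (fst y))) + lift_gvgv scale (\<lambda>xs. f (fst w # xs)) ws y"
  by (simp add: lift_gvgv_def scale_power_minus_one sum.lessThan_Suc_shift del: sum.lessThan_Suc)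

lemma (in vector_space) lift_gvgv_Nil: "lift_gvgv scale f [] y = 0"
  by (simp add: lift_gvgv_def zero_prod_def)

text \<open>
  Both \<open>L'\<close> and \<open>h\<close> consist of all cochains on \<open>g \<oplus> V\<close> of a fixed weight, where \<open>V\<close> has weight \<open>1\<close>
  and \<open>g\<close> weight \<open>0\<close>. As the powers of \<open>2\<close> are distinct, equivariance under the single
  automorphism \<open>dil\<close> detects this weight; in this form it is inherited by the bracket at once.
\<close>

locale semidirect = vector_space_prod sG sV
  for sG :: "'k::field_char_0 \<Rightarrow> 'g::ab_group_add \<Rightarrow> 'g" and sV :: "'k \<Rightarrow> 'v::ab_group_add \<Rightarrow> 'v"
begin

definition dil :: "'g \<times> 'v \<Rightarrow> 'g \<times> 'v" where
  "dil w = (fst w, sV 2 (snd w))"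

abbreviation inG :: "'g \<Rightarrow> 'g \<times> 'v" where "inG x \<equiv> (x, 0)"

abbreviation inV :: "'v \<Rightarrow> 'g \<times> 'v" where "inV v \<equiv> (0, v)"

lemma dil_linear: "Vector_Spaces.linear scale scale dil"
  using p.vector_space_axioms
  by (auto simp: Vector_Spaces.linear_iff dil_def scale_def vs2.scale_right_distrib mult.commute)

lemma split_sum: "w = inG (fst w) + inV (snd w)"
  by (simp add: prod_eq_iff)

lemma fst_scale: "fst (scale c x) = sG c (fst x)" and snd_scale: "snd (scale c x) = sV c (snd x)"
  by (simp_all add: scale_def)

lemma inG_linear: "inG (x + y) = inG x + inG y" "inG (sG c x) = scale c (inG x)"
  and inV_linear: "inV (v + v') = inV v + inV v'" "inV (sV c v) = scale c (inV v)"
  by (simp_all add: scale_def)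

lemma map_fst_dil: "map fst (map dil ws) = map fst ws"
  by (simp add: dil_def o_def)

lemma lift_ggg_cochain:
  assumes "f \<in> Hom_wedge sG sG sG n"
  shows "lift_ggg f \<in> cochains scale n" and "equivariant scale dil 1 (lift_ggg f)"
proof -
  have f: "multilinear sG sG (\<lambda>xs. f xs y)" "alternating (\<lambda>xs. f xs y)"
    "f xs (x + y) = f xs x + f xs y" "f xs (sG c y) = sG c (f xs y)"
    "length xs \<noteq> n \<Longrightarrow> f xs y = 0" for xs x y c
    using assms by (auto simp: Hom_wedge_iff Vector_Spaces.linear_iff)
  show "lift_ggg f \<in> cochains scale n"
    by (rule p.cochainI)
      (use f in \<open>auto simp: lift_ggg_def multilinear_def alternating_def scale_def zero_prod_def\<close>)
  show "equivariant scale dil 1 (lift_ggg f)"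
    unfolding equivariant_def lift_ggg_def map_fst_dil by (simp add: dil_def scale_def)
qed

lemma lift_gvv_cochain:
  assumes "f \<in> Hom_wedge sG sV sV n"
  shows "lift_gvv f \<in> cochains scale n" and "equivariant scale dil 1 (lift_gvv f)"
proof -
  have f: "multilinear sG sV (\<lambda>xs. f xs y)" "alternating (\<lambda>xs. f xs y)"
    "f xs (x + y) = f xs x + f xs y" "f xs (sV c y) = sV c (f xs y)"
    "length xs \<noteq> n \<Longrightarrow> f xs y = 0" for xs x y c
    using assms by (auto simp: Hom_wedge_iff Vector_Spaces.linear_iff)
  show "lift_gvv f \<in> cochains scale n"
    by (rule p.cochainI)
      (use f in \<open>auto simp: lift_gvv_def multilinear_def alternating_def scale_def zero_prod_def\<close>)
  show "equivariant scale dil 1 (lift_gvv f)"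
    unfolding equivariant_def lift_gvv_def map_fst_dil by (simp add: dil_def scale_def f)
qed

lemma lift_ggv_cochain:
  assumes "f \<in> Hom_wedge sG sG sV n"
  shows "lift_ggv f \<in> cochains scale n" and "equivariant scale dil 2 (lift_ggv f)"
proof -
  have f: "multilinear sG sV (\<lambda>xs. f xs y)" "alternating (\<lambda>xs. f xs y)"
    "f xs (x + y) = f xs x + f xs y" "f xs (sG c y) = sV c (f xs y)"
    "length xs \<noteq> n \<Longrightarrow> f xs y = 0" for xs x y c
    using assms by (auto simp: Hom_wedge_iff Vector_Spaces.linear_iff)
  show "lift_ggv f \<in> cochains scale n"
    by (rule p.cochainI)
      (use f in \<open>auto simp: lift_ggv_def multilinear_def alternating_def scale_def zero_prod_def\<close>)
  show "equivariant scale dil 2 (lift_ggv f)"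
    unfolding equivariant_def lift_ggv_def map_fst_dil by (simp add: dil_def scale_def)
qed

lemma lift_gvgv_add: "lift_gvgv sV (\<lambda>xs v x. f xs v x + g xs v x) ws y = lift_gvgv sV f ws y + lift_gvgv sV g ws y"
  by (simp add: lift_gvgv_def vs2.scale_right_distrib sum.distrib)

lemma lift_gvgv_scale: "lift_gvgv sV (\<lambda>xs v x. sV c (f xs v x)) ws y = scale c (lift_gvgv sV f ws y)"
  by (simp add: lift_gvgv_def vs2.scale_sum_right scale_def mult.commute)

lemma lift_gvgv_cochain:
  assumes "f \<in> Hom_wedge2 sG sV sG sV n"
  shows "lift_gvgv sV f \<in> cochains scale (Suc n)" and "equivariant scale dil 1 (lift_gvgv sV f)"
proof -
  have f: "multilinear sG sV (\<lambda>xs. f xs v y)" "alternating (\<lambda>xs. f xs v y)"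
    "f xs v (x + y) = f xs v x + f xs v y" "f xs v (sG c y) = sV c (f xs v y)"
    "f xs (v + v') y = f xs v y + f xs v' y" "f xs (sV c v) y = sV c (f xs v y)"
    "length xs \<noteq> n \<Longrightarrow> f xs v y = 0" for xs v v' x y c
    using assms by (auto simp: Hom_wedge2_def Hom_wedge_iff Vector_Spaces.linear_iff)
  have zero: "lift_gvgv sV (\<lambda>xs v x. 0) ws y = 0" for ws y
    by (simp add: lift_gvgv_def zero_prod_def)
  show "lift_gvgv sV f \<in> cochains scale (Suc n)"
  proof (rule p.cochainI)
    fix y
    have "lift_gvgv sV f (us @ (w + w') # vs) y = lift_gvgv sV f (us @ w # vs) y + lift_gvgv sV f (us @ w' # vs) y \<and>
      lift_gvgv sV f (us @ scale c w # vs) y = scale c (lift_gvgv sV f (us @ w # vs) y)" for us w w' c vs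
      using f(1,5,6)
    proof (induction us arbitrary: f)
      case Nil
      have "f ((x + x') # xs) v z = f (x # xs) v z + f (x' # xs) v z"
        "f (sG c x # xs) v z = sV c (f (x # xs) v z)" for x x' xs v z c
        using Nil(1)[of v z] unfolding multilinear_def by (metis append_Nil)+
      then have 1: "f ((x + x') # xs) = (\<lambda>v z. f (x # xs) v z + f (x' # xs) v z)"
        "f (sG c x # xs) = (\<lambda>v z. sV c (f (x # xs) v z))" for x x' xs c
        by blast+
      show ?case
        by (simp add: vs2.lift_gvgv_Cons Nil(2,3) 1 lift_gvgv_add lift_gvgv_scale sg_add
            p.scale_right_distrib prod_eq_iff fst_scale snd_scale vs2.scale_sg algebra_simps)
    next
      case (Cons u us)
      have IH: "lift_gvgv sV (\<lambda>xs. f (fst u # xs)) (us @ (w + w') # vs) y =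
          lift_gvgv sV (\<lambda>xs. f (fst u # xs)) (us @ w # vs) y + lift_gvgv sV (\<lambda>xs. f (fst u # xs)) (us @ w' # vs) y \<and>
        lift_gvgv sV (\<lambda>xs. f (fst u # xs)) (us @ scale c w # vs) y =
          scale c (lift_gvgv sV (\<lambda>xs. f (fst u # xs)) (us @ w # vs) y)"
        by (rule Cons.IH) (rule Cons.prems multilinear_Cons)+
      show ?case
        using Cons.prems(1)[of "snd u" "fst y"] unfolding multilinear_def
        by (simp add: vs2.lift_gvgv_Cons IH sg_add p.scale_right_distrib
            prod_eq_iff fst_scale snd_scale vs2.scale_sg)
    qed
    then show "multilinear scale scale (\<lambda>ws. lift_gvgv sV f ws y)"
      unfolding multilinear_def by blast
    have "lift_gvgv sV f (us @ w # w # vs) y = 0" for us w vs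
      using f(2)
    proof (induction us arbitrary: f)
      case Nil
      have "f (x # x # xs) v z = 0" for x xs v z
        using Nil(1)[of v z] unfolding alternating_def by (metis append_Nil)
      then have "f (x # x # xs) = (\<lambda>v z. 0)" for x xs
        by blast
      \<comment> \<open>The two terms that take their V-argument from one of the copies of
        \<open>w\<close> have opposite signs.\<close>
      then show ?case by (simp add: vs2.lift_gvgv_Cons zero prod_eq_iff)
    next
      case (Cons u us)
      have IH: "lift_gvgv sV (\<lambda>xs. f (fst u # xs)) (us @ w # w # vs) y = 0"
        by (rule Cons.IH) (rule Cons.prems alternating_Cons)+
      show ?case
        using Cons.prems[of "snd u" "fst y"] unfolding alternating_def
        by (simp add: vs2.lift_gvgv_Cons IH zero_prod_def)
    qed
    then show "alternating (\<lambda>ws. lift_gvgv sV f ws y)"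
      unfolding alternating_def by blast
  next
    show "lift_gvgv sV f ws (x + y) = lift_gvgv sV f ws x + lift_gvgv sV f ws y" for ws x y
      by (simp add: lift_gvgv_def f(3) vs2.scale_right_distrib sum.distrib)
    show "lift_gvgv sV f ws (scale c y) = scale c (lift_gvgv sV f ws y)" for ws c y
      by (simp add: lift_gvgv_def scale_def f(4) vs2.scale_sum_right mult.commute)
    show "lift_gvgv sV f ws y = 0" if "length ws \<noteq> Suc n" for ws y
    proof -
      have "f (take i (map fst ws) @ drop (Suc i) (map fst ws)) (snd (ws ! i)) (fst y) = 0"
        if "i < length ws" for i
        using that \<open>length ws \<noteq> _\<close> by (intro f(7)) auto
      then show ?thesis by (simp add: lift_gvgv_def zero_prod_def)
    qed
  qed
  show "equivariant scale dil 1 (lift_gvgv sV f)"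
    unfolding equivariant_def lift_gvgv_def map_fst_dil
    by (simp add: dil_def scale_def f(6) vs2.scale_sum_right mult.commute)
qed

section \<open>Weights of arguments and the vanishing they force\<close>

definition pure :: "nat \<Rightarrow> 'g \<times> 'v \<Rightarrow> bool" where
  "pure k w \<longleftrightarrow> dil w = scale (2 ^ k) w"

lemma pure_in: "pure 0 (inG x)" "pure (Suc 0) (inV v)"
  by (simp_all add: pure_def dil_def scale_def)

lemma pure_map_inG: "list_all2 pure (replicate (length xs) 0) (map inG xs)"
  by (simp add: list_all2_conv_all_nth pure_in)

context
  fixes F :: "('g \<times> 'v) cochain" and n m :: nat
  assumes F: "F \<in> cochains scale n" and eq: "equivariant scale dil (2 ^ m) F"
begin

lemma slot_add: "F (us @ (x + y) # vs) z = F (us @ x # vs) z + F (us @ y # vs) z"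
  and slot_scale: "F (us @ scale c x # vs) z = scale c (F (us @ x # vs) z)"
  using p.cochainD(1)[OF F] unfolding multilinear_def by blast+

text \<open>The value is an eigenvector of \<open>dil\<close> with exponent
  \<open>m + sum_list ks + k\<close>, while \<open>dil\<close> acts on g with exponent 0 and on V
  with exponent 1.\<close>

lemma pure_components:
  assumes "list_all2 pure ks ws" "pure k y"
  shows "m + sum_list ks + k \<noteq> 0 \<Longrightarrow> fst (F ws y) = 0"
    and "m + sum_list ks + k \<noteq> 1 \<Longrightarrow> snd (F ws y) = 0"
proof -
  have "F (us @ map dil ws) z = scale (2 ^ sum_list ks) (F (us @ ws) z)" for us z
    using assms(1)
  proof (induction ks ws arbitrary: us rule: list_all2_induct)
    case (Cons k ks w ws)
    have "F (us @ map dil (w # ws)) z = scale (2 ^ k) (F ((us @ [w]) @ map dil ws) z)"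
      using Cons.hyps(1) by (simp add: pure_def slot_scale)
    then show ?case by (simp only: Cons.IH) (simp add: power_add)
  qed simp
  from this[of "[]"] have dil: "F (map dil ws) z = scale (2 ^ sum_list ks) (F ws z)" for z
    by simp
  have "dil (F ws y) = scale (2 ^ m) (F (map dil ws) (dil y))"
    using eq unfolding equivariant_def by blast
  also have "\<dots> = scale (2 ^ (m + sum_list ks + k)) (F ws y)"
    unfolding dil assms(2)[unfolded pure_def] p.cochainD(4)[OF F] p.scale_scale
    by (simp add: power_add mult.assoc)
  finally have "dil (F ws y) = scale (2 ^ (m + sum_list ks + k)) (F ws y)" .
  then have *: "fst (F ws y) = sG (2 ^ (m + sum_list ks + k)) (fst (F ws y))"
    "sV 2 (snd (F ws y)) = sV (2 ^ (m + sum_list ks + k)) (snd (F ws y))"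
    by (simp_all add: dil_def scale_def prod_eq_iff)
  \<comment> \<open>Here characteristic 0 is used: distinct powers of 2 stay distinct in the
    field.\<close>
  have pow: "(2 :: 'k) ^ i = 2 ^ j \<longleftrightarrow> i = j" for i j
  proof -
    have "(2 :: 'k) ^ i = 2 ^ j \<longleftrightarrow> of_nat (2 ^ i) = (of_nat (2 ^ j) :: 'k)" by simp
    also have "\<dots> \<longleftrightarrow> (2 :: nat) ^ i = 2 ^ j" by (rule of_nat_eq_iff)
    also have "\<dots> \<longleftrightarrow> i = j" by simp
    finally show ?thesis .
  qed
  show "fst (F ws y) = 0" if "m + sum_list ks + k \<noteq> 0"
  proof -
    have "sG (2 ^ 0) (fst (F ws y)) = sG (2 ^ (m + sum_list ks + k)) (fst (F ws y))"
      using *(1) by simp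
    then show ?thesis using that pow[of 0] by (simp only: vs1.scale_cancel_right) auto
  qed
  show "snd (F ws y) = 0" if "m + sum_list ks + k \<noteq> 1"
  proof -
    have "sV (2 ^ 1) (snd (F ws y)) = sV (2 ^ (m + sum_list ks + k)) (snd (F ws y))"
      using *(2) by simp
    then show ?thesis using that pow[of 1] by (simp only: vs2.scale_cancel_right) auto
  qed
qed

lemma slot_split: "F (us @ w # ws) y = F (us @ inG (fst w) # ws) y + F (us @ inV (snd w) # ws) y"
  by (subst split_sum[of w]) (rule slot_add)

text \<open>No value has weight above 1, and splitting the remaining arguments into their components
  can only raise the weight.\<close>

lemma high_weight_zero:
  assumes "list_all2 pure ks us" "pure k y" "m + sum_list ks + k \<ge> 2"
  shows "F (us @ ws) y = 0"
  using assms(1,3)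
proof (induction ws arbitrary: us ks)
  case Nil
  then have "m + sum_list ks + k \<noteq> 0" "m + sum_list ks + k \<noteq> 1" by linarith+
  then have "fst (F us y) = 0" "snd (F us y) = 0" using pure_components[OF Nil(1) assms(2)] by blast+
  then show ?case by (simp add: prod_eq_iff)
next
  case (Cons w ws)
  have "F (us @ inG (fst w) # ws) y = 0"
    using Cons.IH[of "ks @ [0]" "us @ [inG (fst w)]"] Cons.prems
    by (simp add: pure_in list_all2_appendI)
  moreover have "F (us @ inV (snd w) # ws) y = 0"
    using Cons.IH[of "ks @ [1]" "us @ [inV (snd w)]"] Cons.prems
    by (simp add: pure_in list_all2_appendI)
  ultimately show ?case by (subst slot_split) simp
qed

text \<open>Once the weight is 1, any further V-component would push it to 2, so only the
  g-components of the remaining arguments count.\<close>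

lemma project_rest:
  assumes "list_all2 pure ks us" "pure k y" "m + sum_list ks + k \<ge> 1"
  shows "F (us @ ws) y = F (us @ map (\<lambda>w. inG (fst w)) ws) y"
  using assms(1,3)
proof (induction ws arbitrary: us ks)
  case (Cons w ws)
  have "F (us @ inV (snd w) # ws) y = 0"
    using high_weight_zero[of "ks @ [1]" "us @ [inV (snd w)]" k y ws] Cons.prems assms(2)
    by (simp add: pure_in list_all2_appendI)
  then have "F (us @ w # ws) y = F ((us @ [inG (fst w)]) @ ws) y"
    by (subst slot_split) simp
  also have "\<dots> = F ((us @ [inG (fst w)]) @ map (\<lambda>w. inG (fst w)) ws) y"
    by (rule Cons.IH[of "ks @ [0]"]) (use Cons.prems in \<open>simp_all add: pure_in list_all2_appendI\<close>)
  finally show ?case by simp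
qed simp

lemma last_linear:
  "F xs (inG (x + y)) = F xs (inG x) + F xs (inG y)" "F xs (inG (sG c x)) = scale c (F xs (inG x))"
  "F xs (inV (v + v')) = F xs (inV v) + F xs (inV v')" "F xs (inV (sV c v)) = scale c (F xs (inV v))"
  unfolding inG_linear inV_linear by (rule p.cochainD[OF F])+

text \<open>With \<open>m = 0\<close> and the last argument in g, at most one alternating argument
  may lie in V. Summing over its position and moving it to the last slot gives the signs of
  \<open>lift_gvgv\<close>; \<open>us\<close> collects the arguments already taken from g.\<close>

lemma expand_single_inV:
  assumes "m = 0"
  shows "F (map inG us @ ws) (inG x) = F (map inG us @ map inG (map fst ws)) (inG x) +
    lift_gvgv sV (\<lambda>xs v x. snd (F (map inG us @ map inG xs @ [inV v]) (inG x))) ws (inG x)"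
proof (induction ws arbitrary: us)
  case Nil
  then show ?case by (simp add: vs2.lift_gvgv_Nil)
next
  case (Cons w ws)
  let ?ks = "replicate (length us) (0::nat) @ [1]"
  let ?G = "F (map inG us @ map inG (map fst ws) @ [inV (snd w)]) (inG x)"
  \<comment> \<open>The one V-argument has been chosen, so the rest is projected to g before it is
    moved behind them.\<close>
  have "F ((map inG us @ [inV (snd w)]) @ ws) (inG x) =
     F ((map inG us @ [inV (snd w)]) @ map (\<lambda>w. inG (fst w)) ws) (inG x)"
    by (rule project_rest[of ?ks _ 0])
      (auto simp: pure_in sum_list_replicate intro!: list_all2_appendI pure_map_inG)
  also have "\<dots> = F (map inG us @ inV (snd w) # map inG (map fst ws)) (inG x)"
    by (simp add: o_def)
  also have "\<dots> = sg (length ws) ?G"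
    by (subst multilinear_move_last[OF p.cochainD(1,2)[OF F]]) simp
  also have "?G = (0, snd ?G)"
  proof -
    have "list_all2 pure (replicate (length us) 0 @ replicate (length (map fst ws)) 0 @ [1])
       (map inG us @ map inG (map fst ws) @ [inV (snd w)])"
      by (intro list_all2_appendI pure_map_inG) (simp_all add: pure_in)
    then have "fst ?G = 0"
      by (rule pure_components(1)[OF _ pure_in(1)]) simp
    then show ?thesis by (simp add: prod_eq_iff)
  qed
  finally have "F (map inG us @ inV (snd w) # ws) (inG x) = (0, sg (length ws) (snd ?G))"
    by (simp add: sg_def)
  moreover have "F (map inG us @ inG (fst w) # ws) (inG x) =
    F (map inG us @ map inG (map fst (w # ws))) (inG x) +
    lift_gvgv sV (\<lambda>xs v x. snd (F (map inG us @ map inG (fst w # xs) @ [inV v]) (inG x))) ws (inG x)"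
    using Cons.IH[of "us @ [fst w]"] by simp
  ultimately show ?case
    by (subst slot_split) (simp add: vs2.lift_gvgv_Cons algebra_simps)
qed

lemma multilinear_on_inG:
  assumes "\<And>x y. h (x + y) = h x + h y" "\<And>c x. h (scale c x) = sB c (h x)"
  shows "multilinear sG sB (\<lambda>xs. h (F (map inG xs @ ws) y))" "alternating (\<lambda>xs. h (F (map inG xs @ ws) y))"
proof -
  have "h 0 + h 0 = h 0 + 0" using assms(1)[of 0 0] by simp
  then have "h 0 = 0" by (simp only: add_left_cancel)
  then show "alternating (\<lambda>xs. h (F (map inG xs @ ws) y))"
    by (simp add: alternating_def p.cochain_adjacent[OF F])
  show "multilinear sG sB (\<lambda>xs. h (F (map inG xs @ ws) y))"
    unfolding multilinear_def
    by (simp only: map_append list.map inG_linear append_assoc append_Cons slot_add slot_scale assms simp_thms)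
qed

end

lemma proj_linear:
  "fst (x + y) = fst x + fst y" "fst (scale c x) = sG c (fst x)"
  "snd (x + y) = snd x + snd y" "snd (scale c x) = sV c (snd x)"
  by (simp_all add: scale_def)

text \<open>Factor 1 means that weight is preserved. This leaves three kinds of components: all
  arguments in g, the last one in V, or exactly one alternating argument in V; they are the three
  summands of L'.\<close>

lemma L'_iff: "F \<in> L' sG sV n \<longleftrightarrow> F \<in> cochains scale n \<and> equivariant scale dil 1 F"
proof
  assume "F \<in> L' sG sV n"
  then obtain f1 f2 f3 where F: "F = lift_ggg f1 + lift_gvv f2 + lift_gvgv sV f3"
    and f: "f1 \<in> Hom_wedge sG sG sG n" "f2 \<in> Hom_wedge sG sV sV n"
    and f3: "f3 \<in> (if n = 0 then {0} else Hom_wedge2 sG sV sG sV (n - 1))"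
    unfolding L'_def by blast
  have "lift_gvgv sV f3 \<in> cochains scale n \<and> equivariant scale dil 1 (lift_gvgv sV f3)"
  proof (cases n)
    case 0
    then have "lift_gvgv sV f3 = 0"
      using f3 by (simp add: lift_gvgv_def fun_eq_iff zero_prod_def)
    then show ?thesis by (simp add: p.cochains_zero p.equivariant_zero dil_def zero_prod_def)
  next
    case (Suc n')
    then show ?thesis using lift_gvgv_cochain[of f3 n'] f3 by simp
  qed
  then show "F \<in> cochains scale n \<and> equivariant scale dil 1 F"
    unfolding F using lift_ggg_cochain[OF f(1)] lift_gvv_cochain[OF f(2)]
    by (simp add: p.cochains_add p.equivariant_add[OF dil_linear])
next
  assume "F \<in> cochains scale n \<and> equivariant scale dil 1 F"
  then have F: "F \<in> cochains scale n" and eq: "equivariant scale dil (2 ^ 0) F" by auto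
  note D = p.cochainD[OF F]
  define f1 where "f1 = (\<lambda>xs x. fst (F (map inG xs) (inG x)))"
  define f2 where "f2 = (\<lambda>xs v. snd (F (map inG xs) (inV v)))"
  define f3 where "f3 = (\<lambda>xs v x. snd (F (map inG xs @ [inV v]) (inG x)))"
  have "F ws w = (lift_ggg f1 + lift_gvv f2 + lift_gvgv sV f3) ws w" for ws w
  proof -
    let ?g = "F (map inG (map fst ws)) (inG (fst w))" and ?v = "F (map inG (map fst ws)) (inV (snd w))"
    have pure: "list_all2 pure (replicate (length (map fst ws)) 0) (map inG (map fst ws))"
      by (rule pure_map_inG)
    have "F ws w = F ws (inG (fst w)) + F ws (inV (snd w))"
      by (subst split_sum[of w]) (rule D(3))
    also have "F ws (inV (snd w)) = ?v"
      using project_rest[OF F eq, of "[]" "[]" 1 "inV (snd w)" ws] by (simp add: pure_in o_def)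
    also have "F ws (inG (fst w)) = ?g + lift_gvgv sV f3 ws (inG (fst w))"
      using expand_single_inV[OF F eq refl, of "[]" ws "fst w"] unfolding f3_def list.map append_Nil .
    also have "?g = lift_ggg f1 ws w"
      using pure_components(2)[OF F eq pure pure_in(1)]
      by (simp add: lift_ggg_def f1_def prod_eq_iff sum_list_replicate)
    also have "?v = lift_gvv f2 ws w"
      using pure_components(1)[OF F eq pure pure_in(2)]
      by (simp add: lift_gvv_def f2_def prod_eq_iff)
    also have "lift_gvgv sV f3 ws (inG (fst w)) = lift_gvgv sV f3 ws w"
      by (simp add: lift_gvgv_def)
    finally show ?thesis by (simp add: algebra_simps)
  qed
  then have "F = lift_ggg f1 + lift_gvv f2 + lift_gvgv sV f3" by blast
  moreover have "f1 \<in> Hom_wedge sG sG sG n"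
    using multilinear_on_inG[OF F eq, of fst sG "[]", OF proj_linear(1,2)] vs1.vector_space_axioms
    by (simp add: Hom_wedge_iff f1_def Vector_Spaces.linear_iff last_linear[OF F eq] D(5) fst_scale snd_scale)
  moreover have "f2 \<in> Hom_wedge sG sV sV n"
    using multilinear_on_inG[OF F eq, of snd sV "[]", OF proj_linear(3,4)] vs2.vector_space_axioms
    by (simp add: Hom_wedge_iff f2_def Vector_Spaces.linear_iff last_linear[OF F eq] D(5) fst_scale snd_scale)
  moreover have "f3 \<in> (if n = 0 then {0} else Hom_wedge2 sG sV sG sV (n - 1))"
  proof (cases "n = 0")
    case True
    then show ?thesis using D(5) by (auto simp: f3_def fun_eq_iff)
  next
    case False
    have "F (map inG xs @ [inV (v + v')]) y = F (map inG xs @ [inV v]) y + F (map inG xs @ [inV v']) y"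
      "F (map inG xs @ [inV (sV c v)]) y = scale c (F (map inG xs @ [inV v]) y)" for xs v v' y c
      unfolding inV_linear by (rule slot_add[OF F eq] slot_scale[OF F eq])+
    note last = this
    show ?thesis
      using False multilinear_on_inG[OF F eq, of snd sV, OF proj_linear(3,4)]
        vs1.vector_space_axioms vs2.vector_space_axioms
      by (simp add: Hom_wedge2_def Hom_wedge_iff f3_def last Vector_Spaces.linear_iff last_linear[OF F eq] D(5) fst_scale snd_scale)
  qed
  ultimately show "F \<in> L' sG sV n" unfolding L'_def by blast
qed

text \<open>Factor \<open>2 = 2^1\<close> adds one to the weight of the arguments. Any argument from
  V would lead to weight 2, and arguments from g give a value in V.\<close>

lemma h_space_iff: "F \<in> h_space sG sV n \<longleftrightarrow> F \<in> cochains scale n \<and> equivariant scale dil 2 F"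
proof
  assume "F \<in> h_space sG sV n"
  then show "F \<in> cochains scale n \<and> equivariant scale dil 2 F"
    unfolding h_space_def using lift_ggv_cochain by blast
next
  assume "F \<in> cochains scale n \<and> equivariant scale dil 2 F"
  then have F: "F \<in> cochains scale n" and eq: "equivariant scale dil (2 ^ 1) F" by auto
  note D = p.cochainD[OF F]
  define f where "f = (\<lambda>xs x. snd (F (map inG xs) (inG x)))"
  have "F ws w = lift_ggv f ws w" for ws w
  proof -
    let ?g = "F (map inG (map fst ws)) (inG (fst w))"
    have pure: "list_all2 pure (replicate (length (map fst ws)) 0) (map inG (map fst ws))"
      by (rule pure_map_inG)
    have "F ws w = F ws (inG (fst w)) + F ws (inV (snd w))"
      by (subst split_sum[of w]) (rule D(3))
    also have "F ws (inV (snd w)) = 0"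
      using high_weight_zero[OF F eq, of "[]" "[]" 1 "inV (snd w)" ws] by (simp add: pure_in)
    also have "F ws (inG (fst w)) = ?g"
      using project_rest[OF F eq, of "[]" "[]" 0 "inG (fst w)" ws] by (simp add: pure_in o_def)
    also have "?g = lift_ggv f ws w"
      using pure_components(1)[OF F eq pure pure_in(1)]
      by (simp add: lift_ggv_def f_def prod_eq_iff)
    finally show ?thesis by simp
  qed
  then have "F = lift_ggv f" by blast
  moreover have "f \<in> Hom_wedge sG sG sV n"
    using multilinear_on_inG[OF F eq, of snd sV "[]", OF proj_linear(3,4)] 
      vs1.vector_space_axioms vs2.vector_space_axioms
    by (simp add: Hom_wedge_iff f_def Vector_Spaces.linear_iff last_linear[OF F eq] D(5) fst_scale snd_scale)
  ultimately show "F \<in> h_space sG sV n" unfolding h_space_def by blast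
qed

end

section \<open>\<open>L\<^sub>\<infinity>\<close>-structures with a binary operation only\<close>

definition sgz :: "int \<Rightarrow> 'b::ab_group_add \<Rightarrow> 'b" where
  "sgz n x = (if odd n then - x else x)"

section \<open>Unshuffles and Koszul signs for at most three arguments\<close>

lemma unshuffles_empty: "unshuffles [0, 0, 0] = {id}"
  by (auto simp: unshuffles3 permutes_id)

lemma insert_zero_id: "insert_zero 0 id = id"
  by (auto simp: insert_zero_def fun_eq_iff)

lemma unshuffles_1_0: "unshuffles [1, 0] = {id}"
  by (simp add: unshuffles2 unshuffles_Suc[of _ _ _ 0] unshuffles_empty insert_zero_id)

lemma unshuffles_0_1: "unshuffles [0, 1] = {id}"
  by (simp add: unshuffles2 unshuffles_Suc[of _ _ _ 0] unshuffles_empty insert_zero_id)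

lemma unshuffles_1_1: "unshuffles [1, 1] = {id, insert_zero 1 id}"
  using unshuffles_0_1 unshuffles_1_0
  by (auto simp: unshuffles2 unshuffles_Suc[of _ _ _ 1] insert_zero_id)

lemma unshuffles_2_0: "unshuffles [2, 0] = {id}"
  using unshuffles_1_0
  by (simp add: unshuffles2 unshuffles_Suc[of _ _ _ 1] insert_zero_id)

text \<open>In one-line notation the three elements are 012, 021 and 120.\<close>

lemma unshuffles_2_1:
  "unshuffles [2, 1] = {id, insert_zero 0 (insert_zero 1 id), insert_zero 2 id}"
  using unshuffles_1_1 unshuffles_2_0
  by (auto simp: unshuffles2 unshuffles_Suc[of _ _ _ 2] insert_zero_id numeral_2_eq_2)

text \<open>The index set no longer depends on \<open>\<sigma>\<close>, so for a list of given
  length the product can be written out.\<close>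

lemma koszul_sign_pairs:
  "koszul_sign ds \<sigma> = (\<Prod>(i, j) | i < j \<and> j < length ds.
     if \<sigma> j < \<sigma> i \<and> odd (ds ! \<sigma> i * ds ! \<sigma> j) then -1 else 1)"
proof -
  have "{(i, j). i < j \<and> j < length ds} \<subseteq> {..<length ds} \<times> {..<length ds}" by auto
  then have "finite {(i, j). i < j \<and> j < length ds}" by (rule finite_subset) simp
  then show ?thesis
    unfolding koszul_sign_def by (intro prod.mono_neutral_cong_left) (auto split: if_splits)
qed

lemma koszul_sign_1: "koszul_sign [a] \<sigma> = 1"
proof -
  have "{(i, j). i < j \<and> j < length [a]} = {}" by auto
  then show ?thesis by (simp only: koszul_sign_pairs prod.empty)
qed

lemma koszul_sign_2:
  "koszul_sign [a, b] \<sigma> = (if \<sigma> 1 < \<sigma> 0 \<and> odd ([a, b] ! \<sigma> 0 * [a, b] ! \<sigma> 1) then -1 else 1)"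
proof -
  have "{(i, j). i < j \<and> j < length [a, b]} = {(0, 1)}" by auto
  then show ?thesis by (simp only: koszul_sign_pairs) simp
qed

lemma koszul_sign_3:
  "koszul_sign [a, b, c] \<sigma> =
    (if \<sigma> 1 < \<sigma> 0 \<and> odd ([a, b, c] ! \<sigma> 0 * [a, b, c] ! \<sigma> 1) then -1 else 1) *
    (if \<sigma> 2 < \<sigma> 0 \<and> odd ([a, b, c] ! \<sigma> 0 * [a, b, c] ! \<sigma> 2) then -1 else 1) *
    (if \<sigma> 2 < \<sigma> 1 \<and> odd ([a, b, c] ! \<sigma> 1 * [a, b, c] ! \<sigma> 2) then -1 else 1)"
proof -
  have "{(i, j). i < j \<and> j < length [a, b, c]} = {(0, 1), (0, 2), (1, 2)}" by auto
  then show ?thesis by (simp only: koszul_sign_pairs) simp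
qed

lemma permute_list_2: "permute_list \<sigma> [x, y] = [[x, y] ! \<sigma> 0, [x, y] ! \<sigma> 1]"
  by (simp add: permute_list_def)

lemma permute_list_3:
  "permute_list \<sigma> [x, y, z] = [[x, y, z] ! \<sigma> 0, [x, y, z] ! \<sigma> 1, [x, y, z] ! \<sigma> 2]"
  by (simp add: permute_list_def upt_rec numeral_2_eq_2)

definition binary_op :: "('e \<Rightarrow> 'e \<Rightarrow> 'e) \<Rightarrow> nat \<Rightarrow> 'e list \<Rightarrow> 'e::zero" where
  "binary_op b k xs = (if k = 2 then b (xs ! 0) (xs ! 1) else 0)"

text \<open>Linearity is asked for on the total space because the ambient type also contains
  functions that are not multilinear, where \<open>l2_op\<close> need not be additive. The signs in
  \<open>b_jacobi\<close> are the Koszul signs of the three unshuffles of type (2,1).\<close>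

locale graded_binary =
  fixes s :: "'k::field_char_0 \<Rightarrow> 'e::ab_group_add \<Rightarrow> 'e" and E :: "int \<Rightarrow> 'e set"
    and b :: "'e \<Rightarrow> 'e \<Rightarrow> 'e"
  assumes graded: "graded_vector_space s E"
    and b_left: "\<And>x y z c. x \<in> total_space s E \<Longrightarrow> y \<in> total_space s E \<Longrightarrow> z \<in> total_space s E \<Longrightarrow>
      b (x + y) z = b x z + b y z \<and> b (s c x) z = s c (b x z)"
    and b_right: "\<And>x y z c. x \<in> total_space s E \<Longrightarrow> y \<in> total_space s E \<Longrightarrow> z \<in> total_space s E \<Longrightarrow>
      b z (x + y) = b z x + b z y \<and> b z (s c x) = s c (b z x)"
    and b_degree: "\<And>x y i j. x \<in> E i \<Longrightarrow> y \<in> E j \<Longrightarrow> b x y \<in> E (i + j + 1)"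
    and b_symmetric: "\<And>x y i j. x \<in> E i \<Longrightarrow> y \<in> E j \<Longrightarrow> b y x = sgz (i * j) (b x y)"
    and b_jacobi: "\<And>x y z i j k. x \<in> E i \<Longrightarrow> y \<in> E j \<Longrightarrow> z \<in> E k \<Longrightarrow>
      b (b x y) z + sgz (j * k) (b (b x z) y) + sgz (i * (j + k)) (b (b y z) x) = 0"
begin

sublocale vector_space s
  using graded by (simp add: graded_vector_space_def)

lemma E_total: "x \<in> E i \<Longrightarrow> x \<in> total_space s E"
  unfolding total_space_def by (rule span_base) auto

lemma zero_total: "0 \<in> total_space s E"
  unfolding total_space_def by (rule span_zero)

lemma b_zero: "z \<in> total_space s E \<Longrightarrow> b 0 z = 0" "z \<in> total_space s E \<Longrightarrow> b z 0 = 0"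
  using b_left[of 0 0 z] b_right[of 0 0 z] zero_total by simp_all

lemma maurer_cartan_binary_op:
  assumes "\<beta> \<in> E 0"
  shows "maurer_cartan s E (binary_op b) \<beta> \<longleftrightarrow> b \<beta> \<beta> = 0"
proof -
  have *: "{k. 1 \<le> k \<and> binary_op b k (replicate k \<beta>) \<noteq> 0} = (if b \<beta> \<beta> = 0 then {} else {2})"
    by (auto simp: binary_op_def)
  show ?thesis
    unfolding maurer_cartan_def * using assms by (auto simp: binary_op_def numeral_2_eq_2)
qed

section \<open>The twist of a binary operation by a Maurer-Cartan element\<close>

context
  fixes \<alpha> assumes \<alpha>: "\<alpha> \<in> E 0" and MC: "b \<alpha> \<alpha> = 0"
begin

abbreviation l\<alpha> :: "nat \<Rightarrow> 'e list \<Rightarrow> 'e" where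
  "l\<alpha> \<equiv> twist s (binary_op b) \<alpha>"

text \<open>Only \<open>n = 2 - k\<close> copies of \<open>\<alpha>\<close> lead to arity two, and
  \<open>fact n\<close> is 1 for the relevant \<open>n\<close>. The same count gives the cases
  \<open>k = 2\<close> and \<open>k \<ge> 3\<close>.\<close>

lemma twist_1: "l\<alpha> 1 [x] = b \<alpha> x"
proof -
  have "{n. binary_op b (1 + n) (replicate n \<alpha> @ [x]) \<noteq> 0} = (if b \<alpha> x = 0 then {} else {1})"
    by (auto simp: binary_op_def)
  then show ?thesis by (simp add: twist_def binary_op_def)
qed

lemma twist_2: "l\<alpha> 2 [x, y] = b x y"
proof -
  have "{n. binary_op b (2 + n) (replicate n \<alpha> @ [x, y]) \<noteq> 0} = (if b x y = 0 then {} else {0})"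
    by (auto simp: binary_op_def)
  then show ?thesis by (simp add: twist_def binary_op_def)
qed

lemma twist_ge_3: "k \<ge> 3 \<Longrightarrow> l\<alpha> k xs = 0"
  by (simp add: twist_def binary_op_def)

lemma cases_arity:
  assumes "k \<ge> 1" "length xs = k"
  obtains x where "k = 1" "xs = [x]" | x y where "k = 2" "xs = [x, y]" | "k \<ge> 3"
proof -
  consider "k = 1" | "k = 2" | "k \<ge> 3" using assms(1) by linarith
  then show ?thesis
    using assms(2) that by cases (auto simp: length_Suc_conv numeral_2_eq_2)
qed

text \<open>Three identities are to be shown: the differential squares to zero
  (\<open>n = 1\<close>), it is a derivation of \<open>b\<close> (\<open>n = 2\<close>), and
  \<open>b\<close> satisfies Jacobi (\<open>n = 3\<close>). The first two are
  \<open>b_jacobi\<close> with \<open>\<alpha>\<close> inserted twice and once.\<close>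

lemma binary_jacobi:
  assumes "n \<ge> 1" "length xs = n" "homogeneous_list E xs ds"
  shows "(\<Sum>i=1..n. \<Sum>\<sigma>\<in>unshuffles [i, n - i]. s (of_int (koszul_sign ds \<sigma>))
      (l\<alpha> (n - i + 1) (l\<alpha> i (take i (permute_list \<sigma> xs)) # drop i (permute_list \<sigma> xs)))) = 0"
proof -
  have "x \<in> total_space s E" if "x \<in> set xs" for x
    using assms(3) that E_total unfolding homogeneous_list_def list_all2_conv_all_nth
    by (metis in_set_conv_nth)
  then have total: "set xs \<subseteq> total_space s E" by blast
  \<comment> \<open>Either the outer operation has arity at least three, or the inner one does and
    the outer one receives a zero argument.\<close>
  have high: "l\<alpha> (n - i + 1) (l\<alpha> i (take i (permute_list \<sigma> xs)) # drop i (permute_list \<sigma> xs)) = 0"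
    if i: "1 \<le> i" "i \<le> n" "i \<ge> 3 \<or> n - i \<ge> 2" and \<sigma>: "\<sigma> \<in> unshuffles [i, n - i]" for i \<sigma>
  proof (cases "n - i \<ge> 2")
    case True
    then show ?thesis by (intro twist_ge_3) simp
  next
    case False
    then have inner: "l\<alpha> i (take i (permute_list \<sigma> xs)) = 0" using i by (intro twist_ge_3) simp
    have "\<sigma> permutes {..<length xs}"
      using \<sigma> i assms(2) by (simp add: unshuffles_def)
    then have "set (permute_list \<sigma> xs) = set xs" by (rule set_permute_list)
    then have ys: "set (drop i (permute_list \<sigma> xs)) \<subseteq> total_space s E"
      using set_drop_subset[of i "permute_list \<sigma> xs"] total by blast
    consider "n - i = 0" | "n - i = 1" using False by linarith
    then show ?thesis
    proof cases
      case 1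
      then have "drop i (permute_list \<sigma> xs) = []" using assms(2) by simp
      then show ?thesis unfolding 1 inner by (simp only: add_0 twist_1 b_zero E_total[OF \<alpha>])
    next
      case 2
      then have "length (drop i (permute_list \<sigma> xs)) = Suc 0" using assms(2) by simp
      then obtain y where y: "drop i (permute_list \<sigma> xs) = [y]"
        by (auto simp only: length_Suc_conv length_0_conv)
      then have "y \<in> total_space s E" using ys by simp
      then show ?thesis unfolding 2 inner y by (simp only: one_add_one twist_2 b_zero)
    qed
  qed
  have hom: "length ds = n" "\<And>i. i < n \<Longrightarrow> xs ! i \<in> E (ds ! i)"
    using assms(2,3) by (auto simp: homogeneous_list_def list_all2_conv_all_nth)
  consider "n = 1" | "n = 2" | "n = 3" | "n \<ge> 4" using assms(1) by linarith
  then show ?thesis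
  proof cases
    case 1
    then obtain x d where xd: "xs = [x]" "ds = [d]" using assms(2) hom(1) by (auto simp: length_Suc_conv)
    then have x: "x \<in> E d" using hom(2)[of 0] 1 by simp
    have "b (b \<alpha> x) \<alpha> = b \<alpha> (b \<alpha> x)"
      using b_symmetric[OF \<alpha> b_degree[OF \<alpha> x]] by (simp add: sgz_def)
    \<comment> \<open>Jacobi for \<open>\<alpha>, \<alpha>, x\<close>: the Maurer-Cartan equation
      removes one term and the other two coincide.\<close>
    then have "b \<alpha> (b \<alpha> x) + b \<alpha> (b \<alpha> x) = 0"
      using b_jacobi[OF \<alpha> \<alpha> x] MC b_zero(1)[OF E_total[OF x]] by (simp add: sgz_def)
    then have "s 2 (b \<alpha> (b \<alpha> x)) = 0" using scale_left_distrib[of 1 1] by simp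
    then have "b \<alpha> (b \<alpha> x) = 0" by simp
    then show ?thesis
      using 1 xd twist_1 unshuffles_1_0 by (simp add: koszul_sign_1)
  next
    case 2
    then obtain x y d e where xd: "xs = [x, y]" "ds = [d, e]"
      using assms(2) hom(1) by (auto simp: length_Suc_conv numeral_2_eq_2)
    then have x: "x \<in> E d" and y: "y \<in> E e" using hom(2)[of 0] hom(2)[of 1] 2 by simp_all
    \<comment> \<open>As \<open>\<alpha>\<close> has degree 0, the only sign left is the one for
      exchanging \<open>x\<close> and \<open>y\<close>.\<close>
    have jac: "b (b \<alpha> x) y + sgz (d * e) (b (b \<alpha> y) x) + b (b x y) \<alpha> = 0"
      using b_jacobi[OF \<alpha> x y] by (simp add: sgz_def)
    have sym: "b (b x y) \<alpha> = b \<alpha> (b x y)"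
      using b_symmetric[OF \<alpha> b_degree[OF x y]] by (simp add: sgz_def)
    have iz: "insert_zero 1 id 0 = 1" "insert_zero 1 id 1 = 0" by (simp_all add: insert_zero_def)
    have ne: "id \<noteq> insert_zero 1 id" by (auto simp: insert_zero_def fun_eq_iff)
    have sum: "(\<Sum>i=1..n. f i) = f 1 + f 2" for f :: "nat \<Rightarrow> 'e"
      using 2 by (simp add: numeral_2_eq_2)
    have "(\<Sum>\<sigma>\<in>unshuffles [1, 1]. s (of_int (koszul_sign ds \<sigma>))
      (l\<alpha> 2 (l\<alpha> 1 (take 1 (permute_list \<sigma> xs)) # drop 1 (permute_list \<sigma> xs)))) =
      b (b \<alpha> x) y + sgz (d * e) (b (b \<alpha> y) x)"
      unfolding unshuffles_1_1 xd koszul_sign_2 permute_list_2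
      using ne iz twist_1 twist_2 by (simp add: sgz_def mult.commute)
    moreover have "(\<Sum>\<sigma>\<in>unshuffles [2, 0]. s (of_int (koszul_sign ds \<sigma>))
      (l\<alpha> 1 (l\<alpha> 2 (take 2 (permute_list \<sigma> xs)) # drop 2 (permute_list \<sigma> xs)))) = b (b x y) \<alpha>"
      unfolding unshuffles_2_0 xd koszul_sign_2 permute_list_2
      using twist_1 twist_2 by (simp add: sym)
    ultimately show ?thesis
      unfolding sum 2 using jac by (simp add: numeral_2_eq_2)
  next
    case 3
    then obtain x y z d e f where xd: "xs = [x, y, z]" "ds = [d, e, f]"
      using assms(2) hom(1) by (auto simp: length_Suc_conv numeral_3_eq_3)
    then have x: "x \<in> E d" and y: "y \<in> E e" and z: "z \<in> E f"
      using hom(2)[of 0] hom(2)[of 1] hom(2)[of 2] 3 by simp_all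
    have sum: "(\<Sum>i=1..n. f i) = f 1 + f 2 + f 3" for f :: "nat \<Rightarrow> 'e"
      using 3 by (simp add: numeral_2_eq_2 numeral_3_eq_3)
    have iz: "insert_zero 0 (insert_zero 1 id) 0 = 0" "insert_zero 0 (insert_zero 1 id) 1 = 2"
      "insert_zero 0 (insert_zero 1 id) 2 = 1"
      "insert_zero 2 id 0 = 1" "insert_zero 2 id 1 = 2" "insert_zero 2 id 2 = 0"
      by (simp_all add: insert_zero_def)
    have ne: "id \<noteq> insert_zero 0 (insert_zero 1 id)" "id \<noteq> insert_zero 2 id"
      "insert_zero 0 (insert_zero 1 id) \<noteq> insert_zero 2 id"
    proof -
      show "id \<noteq> insert_zero 0 (insert_zero 1 id)"
        using iz(2) by (intro notI) (drule fun_cong[of _ _ 1], simp)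
      show "id \<noteq> insert_zero 2 id"
        using iz(4) by (intro notI) (drule fun_cong[of _ _ 0], simp)
      show "insert_zero 0 (insert_zero 1 id) \<noteq> insert_zero 2 id"
        using iz(1,4) by (intro notI) (drule fun_cong[of _ _ 0], simp)
    qed
    have nths: "[x, y, z] ! 0 = x" "[x, y, z] ! 1 = y" "[x, y, z] ! 2 = z"
      "[d, e, f] ! 0 = d" "[d, e, f] ! 1 = e" "[d, e, f] ! 2 = f"
      "take 2 [u, v, w] = [u, v]" "drop 2 [u, v, w] = [w]" for u v w :: 'e
      by (simp_all add: numeral_2_eq_2)
    have term_id: "s (of_int (koszul_sign ds id)) (l\<alpha> 2 (l\<alpha> 2 (take 2 (permute_list id xs)) # drop 2 (permute_list id xs))) =
        b (b x y) z"
      unfolding xd koszul_sign_3 permute_list_3 id_apply nths twist_2 by simp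
    have term_yz: "s (of_int (koszul_sign ds (insert_zero 0 (insert_zero 1 id))))
        (l\<alpha> 2 (l\<alpha> 2 (take 2 (permute_list (insert_zero 0 (insert_zero 1 id)) xs)) #
          drop 2 (permute_list (insert_zero 0 (insert_zero 1 id)) xs))) = sgz (e * f) (b (b x z) y)"
      unfolding xd koszul_sign_3 permute_list_3 iz nths twist_2 by (simp add: sgz_def mult.commute)
    have term_x: "s (of_int (koszul_sign ds (insert_zero 2 id)))
        (l\<alpha> 2 (l\<alpha> 2 (take 2 (permute_list (insert_zero 2 id) xs)) #
          drop 2 (permute_list (insert_zero 2 id) xs))) = sgz (d * (e + f)) (b (b y z) x)"
      unfolding xd koszul_sign_3 permute_list_3 iz nths twist_2 by (auto simp add: sgz_def)
    have "(\<Sum>\<sigma>\<in>unshuffles [2, 1]. s (of_int (koszul_sign ds \<sigma>))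
      (l\<alpha> 2 (l\<alpha> 2 (take 2 (permute_list \<sigma> xs)) # drop 2 (permute_list \<sigma> xs)))) =
      b (b x y) z + (sgz (e * f) (b (b x z) y) + sgz (d * (e + f)) (b (b y z) x))"
      unfolding unshuffles_2_1
      by (subst sum.insert, use ne in simp, use ne in simp, subst sum.insert, use ne in simp, use ne in simp)
        (simp only: sum.insert finite.emptyI sum.empty empty_iff not_False_eq_True simp_thms
          term_id term_yz term_x add_0_right)
    then have two: "(\<Sum>\<sigma>\<in>unshuffles [2, n - 2]. s (of_int (koszul_sign ds \<sigma>))
      (l\<alpha> (n - 2 + 1) (l\<alpha> 2 (take 2 (permute_list \<sigma> xs)) # drop 2 (permute_list \<sigma> xs)))) = 0"
      using b_jacobi[OF x y z] 3 by (simp add: add.assoc flip: numeral_2_eq_2)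
    have "(\<Sum>\<sigma>\<in>unshuffles [i, n - i]. s (of_int (koszul_sign ds \<sigma>))
      (l\<alpha> (n - i + 1) (l\<alpha> i (take i (permute_list \<sigma> xs)) # drop i (permute_list \<sigma> xs)))) = 0"
      if "i = 1 \<or> i = 3" for i
      using that 3 by (intro sum.neutral ballI) (subst high, auto)
    then show ?thesis unfolding sum two by simp
  next
    case 4
    have "i \<ge> 3 \<or> n - i \<ge> 2" for i using 4 by linarith
    then show ?thesis using high by (auto intro!: sum.neutral)
  qed
qed

lemma twist_L_infinity: "L_infinity_algebra s E l\<alpha>"
  unfolding L_infinity_algebra_def
proof (intro conjI allI impI)
  show "graded_vector_space s E" by (rule graded)
  note A = E_total[OF \<alpha>]
  show "multilinear_on s s (total_space s E) k (l\<alpha> k)" if "k \<ge> 1" for k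
    unfolding multilinear_on_def
  proof (intro allI impI)
    fix us vs x y c
    assume *: "length us + 1 + length vs = k \<and> set us \<subseteq> total_space s E \<and> set vs \<subseteq> total_space s E \<and>
      x \<in> total_space s E \<and> y \<in> total_space s E"
    consider "k = 1" "us = []" "vs = []" | v where "k = 2" "us = []" "vs = [v]"
      | u where "k = 2" "us = [u]" "vs = []" | "k \<ge> 3"
    proof -
      consider "k = 1" | "k = 2" | "k \<ge> 3" using \<open>k \<ge> 1\<close> by linarith
      then show ?thesis
      proof cases
        case 1
        then show ?thesis using * that(1) by auto
      next
        case 2
        then show ?thesis using * that(2,3) by (cases us; cases vs) auto
      qed (rule that(4))
    qed
    then show "l\<alpha> k (us @ (x + y) # vs) = l\<alpha> k (us @ x # vs) + l\<alpha> k (us @ y # vs) \<and>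
        l\<alpha> k (us @ s c x # vs) = s c (l\<alpha> k (us @ x # vs))"
    proof cases
      case 1
      show ?thesis unfolding 1 append_Nil twist_1 using b_right[of x y \<alpha>] * A by blast
    next
      case (2 v)
      show ?thesis unfolding 2 append_Nil twist_2 using b_left[of x y v] * 2 by simp
    next
      case (3 u)
      show ?thesis unfolding 3 append_Cons append_Nil twist_2 using b_right[of x y u] * 3 by simp
    next
      case 4
      then show ?thesis by (simp add: twist_ge_3)
    qed
  qed
  show "l\<alpha> k xs \<in> E (sum_list ds + 1)" if k: "k \<ge> 1" and hyp: "length xs = k \<and> homogeneous_list E xs ds" for k xs ds
    using k conjunct1[OF hyp]
  proof (cases rule: cases_arity)
    case (1 x)
    then obtain d where "ds = [d]" "x \<in> E d" using hyp by (auto simp: homogeneous_list_def list_all2_Cons1)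
    then show ?thesis unfolding 1 twist_1 using b_degree[OF \<alpha>, of x d] by simp
  next
    case (2 x y)
    then obtain d e where "ds = [d, e]" "x \<in> E d" "y \<in> E e"
      using hyp by (auto simp: homogeneous_list_def list_all2_Cons1)
    then show ?thesis unfolding 2 twist_2 using b_degree[of x d y e] by simp
  next
    case 3
    have "module.subspace s (E (sum_list ds + 1))" using graded by (simp add: graded_vector_space_def)
    then show ?thesis using 3 by (simp add: twist_ge_3 subspace_0)
  qed
  show "l\<alpha> k (permute_list \<sigma> xs) = s (of_int (koszul_sign ds \<sigma>)) (l\<alpha> k xs)"
    if k: "k \<ge> 1" and hyp: "length xs = k \<and> homogeneous_list E xs ds \<and> \<sigma> permutes {..<k}" for k xs ds \<sigma>
    using k conjunct1[OF hyp]
  proof (cases rule: cases_arity)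
    case (1 x)
    then have "\<sigma> \<in> unshuffles [1, 0]" using hyp by (auto simp: unshuffles_def less_Suc_eq strict_mono_on_def)
    then have "\<sigma> = id" by (simp only: unshuffles_1_0 singleton_iff)
    then show ?thesis using 1 that
      by (auto simp: homogeneous_list_def list_all2_Cons1 koszul_sign_1)
  next
    case (2 x y)
    \<comment> \<open>With blocks of size one every permutation is an unshuffle, so the enumeration
      above lists all permutations of two elements.\<close>
    then have "\<sigma> \<in> unshuffles [1, 1]"
      using hyp by (auto simp: unshuffles_def less_Suc_eq strict_mono_on_def numeral_2_eq_2)
    then consider "\<sigma> = id" | "\<sigma> = insert_zero 1 id" unfolding unshuffles_1_1 by blast
    then show ?thesis
    proof cases
      case 1
      have "length ds = 2" using hyp 2 by (auto simp: homogeneous_list_def dest: list_all2_lengthD)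
      then obtain d e where "ds = [d, e]" by (auto simp: length_Suc_conv numeral_2_eq_2)
      then show ?thesis using 1 by (simp add: koszul_sign_2)
    next
      case \<sigma>: 2
      obtain d e where ds: "ds = [d, e]" and xy: "x \<in> E d" "y \<in> E e"
        using hyp 2 by (auto simp: homogeneous_list_def list_all2_Cons1)
      have iz: "insert_zero 1 id 0 = 1" "insert_zero 1 id 1 = 0" by (simp_all add: insert_zero_def)
      have "permute_list \<sigma> xs = [y, x]" "koszul_sign ds \<sigma> = (if odd (d * e) then -1 else 1)"
        unfolding \<sigma> 2 ds permute_list_2 koszul_sign_2 iz by (simp_all add: mult.commute)
      then show ?thesis
        unfolding 2 using b_symmetric[OF xy] by (simp only: twist_2) (simp add: sgz_def)
    qed
  next
    case 3
    then show ?thesis by (simp add: twist_ge_3)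
  qed
  show "(\<Sum>i=1..n. \<Sum>\<sigma>\<in>unshuffles [i, n - i]. s (of_int (koszul_sign ds \<sigma>))
      (l\<alpha> (n - i + 1) (l\<alpha> i (take i (permute_list \<sigma> xs)) # drop i (permute_list \<sigma> xs)))) = 0"
    if "n \<ge> 1" "length xs = n \<and> homogeneous_list E xs ds" for n xs ds
    using binary_jacobi that by blast
qed

lemma maurer_cartan_twist:
  assumes \<beta>: "\<beta> \<in> E 0"
  shows "maurer_cartan s E l\<alpha> \<beta> \<longleftrightarrow> b (\<alpha> + \<beta>) (\<alpha> + \<beta>) = 0"
proof -
  let ?S = "{k. 1 \<le> k \<and> l\<alpha> k (replicate k \<beta>) \<noteq> 0}"
  have sub: "?S \<subseteq> {1, 2}"
  proof
    fix k assume "k \<in> ?S"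
    then have "k \<ge> 1" "\<not> k \<ge> 3" using twist_ge_3 by auto
    then show "k \<in> {1, 2}" by auto
  qed
  then have fin: "finite ?S" by (rule finite_subset) simp
  have "(\<Sum>k\<in>?S. s (1 / fact k) (l\<alpha> k (replicate k \<beta>))) = (\<Sum>k\<in>{1, 2}. s (1 / fact k) (l\<alpha> k (replicate k \<beta>)))"
    by (rule sum.mono_neutral_left) (use sub in auto)
  also have "\<dots> = b \<alpha> \<beta> + s (1 / 2) (b \<beta> \<beta>)"
    using twist_1[of \<beta>] twist_2[of \<beta> \<beta>] by (simp add: numeral_2_eq_2)
  finally have sum: "(\<Sum>k\<in>?S. s (1 / fact k) (l\<alpha> k (replicate k \<beta>))) = b \<alpha> \<beta> + s (1 / 2) (b \<beta> \<beta>)" .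
  have "b (\<alpha> + \<beta>) (\<alpha> + \<beta>) = b \<alpha> \<beta> + b \<alpha> \<beta> + b \<beta> \<beta>"
  proof -
    have ab: "\<alpha> \<in> total_space s E" "\<beta> \<in> total_space s E" "\<alpha> + \<beta> \<in> total_space s E"
      using E_total[OF \<alpha>] E_total[OF \<beta>] span_add unfolding total_space_def by auto
    have "b \<beta> \<alpha> = b \<alpha> \<beta>" using b_symmetric[OF \<alpha> \<beta>] by (simp add: sgz_def)
    then show ?thesis using b_left[OF ab] b_right[OF ab(1,2,1)] b_right[OF ab(1,2,2)] MC by simp
  qed
  also have "\<dots> = s 2 (b \<alpha> \<beta> + s (1 / 2) (b \<beta> \<beta>))"
    using scale_left_distrib[of 1 1] by (simp add: scale_right_distrib)
  finally have "b (\<alpha> + \<beta>) (\<alpha> + \<beta>) = 0 \<longleftrightarrow> b \<alpha> \<beta> + s (1 / 2) (b \<beta> \<beta>) = 0" by simp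
  then show ?thesis using \<beta> fin sum by (simp add: maurer_cartan_def)
qed

end

end

section \<open>The graded space of lifted cochains\<close>

lemma sum_fun_apply2: "(\<Sum>i\<in>I. f i) xs y = (\<Sum>i\<in>I. f i xs y)"
  for f :: "'i \<Rightarrow> 'a \<Rightarrow> 'b \<Rightarrow> 'c::ab_group_add"
  by (induction I rule: infinite_finite_induct) simp_all

lemma cochain_scale_apply: "cochain_scale s c P xs y = s c (P xs y)"
  by (simp add: cochain_scale_def)

lemma even_nat_abs: "even (nat \<bar>i\<bar>) \<longleftrightarrow> even i"
  by (simp add: even_nat_iff)

context vector_space
begin

lemma vector_space_cochain_scale: "vector_space (cochain_scale scale)"
  by unfold_locales
    (auto simp: cochain_scale_def fun_eq_iff scale_right_distrib scale_left_distrib)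

text \<open>A class that contains sums of cochains of different degrees, hence both components of
  every element of the total space (\<open>total_additive\<close>). For \<open>P\<close> in it,
  \<open>MN_circ\<close> is linear in \<open>Q\<close>.\<close>

definition multilinear_cochain :: "'b cochain \<Rightarrow> bool" where
  "multilinear_cochain P \<longleftrightarrow> (\<forall>y. multilinear scale scale (\<lambda>xs. P xs y)) \<and>
     (\<forall>xs. Vector_Spaces.linear scale scale (P xs))"

end

section \<open>Linearity of the operation on the total space, and its degrees, symmetry and Jacobi
  identity\<close>

context semidirect
begin

abbreviation additive_cochain :: "('g \<times> 'v) cochain \<Rightarrow> bool" where
  "additive_cochain \<equiv> p.multilinear_cochain"

lemma additive_cochainD:
  assumes "additive_cochain P"
  shows "P ((x + y) # vs) z = P (x # vs) z + P (y # vs) z" "P (scale c x # vs) z = scale c (P (x # vs) z)"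
    "P vs (x + y) = P vs x + P vs y" "P vs (scale c x) = scale c (P vs x)"
  using assms unfolding p.multilinear_cochain_def multilinear_def Vector_Spaces.linear_iff
  by (metis append_Nil)+

lemma MN_circ_left:
  "MN_circ scale p q (P + P') Q xs y = MN_circ scale p q P Q xs y + MN_circ scale p q P' Q xs y"
  "MN_circ scale p q (cochain_scale scale c P) Q xs y = scale c (MN_circ scale p q P Q xs y)"
  by (simp_all add: MN_circ_def Let_def p.scale_right_distrib sum.distrib p.scale_sum_right
      cochain_scale_apply mult_ac)

lemma MN_circ_right:
  assumes "additive_cochain P"
  shows "MN_circ scale p q P (Q + Q') xs y = MN_circ scale p q P Q xs y + MN_circ scale p q P Q' xs y"
  "MN_circ scale p q P (cochain_scale scale c Q) xs y = scale c (MN_circ scale p q P Q xs y)"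
  by (simp_all add: MN_circ_def Let_def p.scale_right_distrib sum.distrib p.scale_sum_right
      cochain_scale_apply mult_ac additive_cochainD[OF assms])

lemma MN_bracket_left:
  assumes "additive_cochain Q"
  shows "MN_bracket scale p q (P + P') Q xs y = MN_bracket scale p q P Q xs y + MN_bracket scale p q P' Q xs y"
  "MN_bracket scale p q (cochain_scale scale c P) Q xs y = scale c (MN_bracket scale p q P Q xs y)"
  by (simp_all add: MN_bracket_def cochain_scale_apply MN_circ_left MN_circ_right[OF assms]
      p.scale_right_distrib p.scale_right_diff_distrib mult_ac)

lemma MN_bracket_right:
  assumes "additive_cochain P"
  shows "MN_bracket scale p q P (Q + Q') xs y = MN_bracket scale p q P Q xs y + MN_bracket scale p q P Q' xs y"
  "MN_bracket scale p q P (cochain_scale scale c Q) xs y = scale c (MN_bracket scale p q P Q xs y)"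
  by (simp_all add: MN_bracket_def cochain_scale_apply MN_circ_left MN_circ_right[OF assms]
      p.scale_right_distrib p.scale_right_diff_distrib mult_ac)

abbreviation escale :: "'k \<Rightarrow> ('g, 'v) element \<Rightarrow> ('g, 'v) element" where
  "escale \<equiv> element_scale sG sV"

lemma escale_eq: "escale c X = (cochain_scale scale c (fst X), cochain_scale scale c (snd X))"
proof -
  interpret C: vector_space "cochain_scale scale" by (rule p.vector_space_cochain_scale)
  interpret CC: vector_space_prod "cochain_scale scale" "cochain_scale scale" ..
  show ?thesis by (simp add: element_scale_def CC.scale_def)
qed

lemma vector_space_escale: "vector_space escale"
proof -
  interpret C: vector_space "cochain_scale scale" by (rule p.vector_space_cochain_scale)
  interpret CC: vector_space_prod "cochain_scale scale" "cochain_scale scale" ..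
  show ?thesis unfolding element_scale_def by (rule CC.p.vector_space_axioms)
qed

definition additive_element :: "('g, 'v) element \<Rightarrow> bool" where
  "additive_element X \<longleftrightarrow> additive_cochain (fst X) \<and> additive_cochain (snd X)"

lemma l2_op_left:
  assumes "additive_element Z"
  shows "l2_op sG sV (X + Y) Z = l2_op sG sV X Z + l2_op sG sV Y Z"
    and "l2_op sG sV (escale c X) Z = escale c (l2_op sG sV X Z)"
  using assms unfolding additive_element_def
  by (auto simp: l2_op_def Let_def MN_bracket_left MN_bracket_right escale_eq fun_eq_iff
      p.scale_right_distrib sum.distrib p.scale_sum_right cochain_scale_apply mult_ac add_ac)

lemma l2_op_right:
  assumes "additive_element Z"
  shows "l2_op sG sV Z (X + Y) = l2_op sG sV Z X + l2_op sG sV Z Y"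
    and "l2_op sG sV Z (escale c X) = escale c (l2_op sG sV Z X)"
  using assms unfolding additive_element_def
  by (auto simp: l2_op_def Let_def MN_bracket_left MN_bracket_right escale_eq fun_eq_iff
      p.scale_right_distrib sum.distrib p.scale_sum_right cochain_scale_apply mult_ac add_ac)

lemma cochain_additive: "P \<in> cochains scale n \<Longrightarrow> additive_cochain P"
  by (auto simp: p.multilinear_cochain_def Hom_wedge_iff)

text \<open>
  In negative degrees the vanishing components have arbitrary degree; the absolute values choose
  it so that the parities needed for the signs are right in all degrees.
\<close>

lemma sLh_iff:
  "X \<in> sLh sG sV i \<longleftrightarrow> fst X \<in> cochains scale (nat \<bar>i + 1\<bar>) \<and> equivariant scale dil 1 (fst X) \<and>
     snd X \<in> cochains scale (nat \<bar>i\<bar>) \<and> equivariant scale dil 2 (snd X) \<and>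
     (i < -1 \<longrightarrow> fst X = 0) \<and> (i < 0 \<longrightarrow> snd X = 0)"
proof -
  have eq0: "equivariant scale dil c 0" for c by (rule p.equivariant_zero) (simp add: dil_def zero_prod_def)
  have "fst X \<in> (if i \<ge> -1 then L' sG sV (nat (i + 1)) else {0}) \<longleftrightarrow>
    fst X \<in> cochains scale (nat \<bar>i + 1\<bar>) \<and> equivariant scale dil 1 (fst X) \<and> (i < -1 \<longrightarrow> fst X = 0)"
    using eq0 p.cochains_zero by (auto simp: L'_iff)
  moreover have "snd X \<in> (if i \<ge> 0 then h_space sG sV (nat i) else {0}) \<longleftrightarrow>
    snd X \<in> cochains scale (nat \<bar>i\<bar>) \<and> equivariant scale dil 2 (snd X) \<and> (i < 0 \<longrightarrow> snd X = 0)"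
    using eq0 p.cochains_zero by (auto simp: h_space_iff)
  ultimately show ?thesis unfolding sLh_def by (auto simp: mem_Times_iff)
qed

lemma sLh_additive: "X \<in> sLh sG sV i \<Longrightarrow> additive_element X"
  by (auto simp: sLh_iff additive_element_def intro: cochain_additive)

lemma total_additive:
  assumes "X \<in> total_space escale (sLh sG sV)"
  shows "additive_element X"
proof -
  interpret C: vector_space escale by (rule vector_space_escale)
  have ml0: "additive_cochain 0"
    using cochain_additive[OF p.cochains_zero] .
  have mladd: "additive_cochain (P + Q)" if "additive_cochain P" "additive_cochain Q" for P Q
    using that p.vector_space_axioms
    by (auto simp: p.multilinear_cochain_def Vector_Spaces.linear_iff multilinear_add_fun p.scale_right_distrib)
  have mlsc: "additive_cochain (cochain_scale scale c P)" if "additive_cochain P" for c P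
    using that p.vector_space_axioms
    by (auto simp: p.multilinear_cochain_def Vector_Spaces.linear_iff cochain_scale_def
        p.scale_right_distrib mult.commute intro!: multilinear_scale_fun[OF p.vector_space_axioms])
  have "C.subspace {X. additive_element X}"
    by (rule C.subspaceI) (auto simp: additive_element_def ml0 mladd mlsc escale_eq)
  moreover have "(\<Union>i. sLh sG sV i) \<subseteq> {X. additive_element X}" using sLh_additive by blast
  ultimately have "C.span (\<Union>i. sLh sG sV i) \<subseteq> {X. additive_element X}" by (intro C.span_minimal)
  then show ?thesis using assms by (auto simp: total_space_def)
qed

text \<open>Independence holds because components of different degree live on lists of different
  length.\<close>

lemma graded_sLh: "graded_vector_space escale (sLh sG sV)"
  unfolding graded_vector_space_def
proof (intro conjI allI impI ballI)
  interpret C: vector_space escale by (rule vector_space_escale)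
  show "vector_space escale" by (rule vector_space_escale)
  have eq0: "equivariant scale dil c 0" for c by (rule p.equivariant_zero) (simp add: dil_def zero_prod_def)
  show "C.subspace (sLh sG sV i)" for i
    by (rule C.subspaceI)
      (auto simp: sLh_iff p.cochains_zero eq0 p.cochains_add p.cochains_scale
        p.equivariant_add[OF dil_linear] p.equivariant_scale[OF dil_linear] escale_eq, auto simp: cochain_scale_def fun_eq_iff)
  fix I x i
  assume *: "finite I \<and> (\<forall>i\<in>I. x i \<in> sLh sG sV i) \<and> (\<Sum>i\<in>I. x i) = 0" and i: "i \<in> I"
  have "(\<Sum>j\<in>I. fst (x j)) = 0" "(\<Sum>j\<in>I. snd (x j)) = 0"
    using * by (metis fst_sum fst_zero, metis snd_sum snd_zero)
  then have sum: "(\<Sum>j\<in>I. fst (x j) xs y) = 0" "(\<Sum>j\<in>I. snd (x j) xs y) = 0" for xs y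
    by (metis sum_fun_apply2 zero_fun_apply)+
  have single: "f i = 0" if "(\<Sum>j\<in>I. f j) = 0" "\<And>j. j \<in> I \<Longrightarrow> j \<noteq> i \<Longrightarrow> f j = 0" for f :: "int \<Rightarrow> 'g \<times> 'v"
    using that sum.remove[OF conjunct1[OF *] i, of f] by (simp add: sum.neutral)
  have D: "x j \<in> sLh sG sV j" if "j \<in> I" for j using * that by blast
  \<comment> \<open>Evaluate at lists of length \<open>i + 1\<close>. A summand with
    \<open>j < -1\<close>, where the absolute value could collide with this length, has first
    component zero.\<close>
  have "fst (x i) xs y = 0" for xs y
  proof (cases "length xs = nat \<bar>i + 1\<bar> \<and> i \<ge> -1")
    case True
    have "fst (x j) xs y = 0" if j: "j \<in> I" "j \<noteq> i" for j
    proof (cases "j < -1")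
      case False
      then have "length xs \<noteq> nat \<bar>j + 1\<bar>" using True j by auto
      then show ?thesis using D[OF j(1)] p.cochainD(5) unfolding sLh_iff by blast
    qed (use D[OF j(1)] in \<open>simp add: sLh_iff\<close>)
    then show ?thesis by (intro single[of "\<lambda>j. fst (x j) xs y"] sum(1))
  next
    case False
    then have "length xs \<noteq> nat \<bar>i + 1\<bar> \<or> fst (x i) = 0" using D[OF i] unfolding sLh_iff by fastforce
    then show ?thesis using D[OF i] p.cochainD(5) unfolding sLh_iff by fastforce
  qed
  moreover have "snd (x i) xs y = 0" for xs y
  proof (cases "length xs = nat \<bar>i\<bar> \<and> i \<ge> 0")
    case True
    have "snd (x j) xs y = 0" if j: "j \<in> I" "j \<noteq> i" for j
    proof (cases "j < 0")
      case False
      then have "length xs \<noteq> nat \<bar>j\<bar>" using True j by auto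
      then show ?thesis using D[OF j(1)] p.cochainD(5) unfolding sLh_iff by blast
    qed (use D[OF j(1)] in \<open>simp add: sLh_iff\<close>)
    then show ?thesis by (intro single[of "\<lambda>j. snd (x j) xs y"] sum(2))
  next
    case False
    then have "length xs \<noteq> nat \<bar>i\<bar> \<or> snd (x i) = 0" using D[OF i] unfolding sLh_iff by fastforce
    then show ?thesis using D[OF i] p.cochainD(5) unfolding sLh_iff by fastforce
  qed
  ultimately show "x i = 0" by (simp add: prod_eq_iff fun_eq_iff)
qed

text \<open>The second component is allowed to be a sum because values of \<open>l2_op\<close> have
  this shape. Their two summands carry nominal degrees \<open>p + t\<close> and
  \<open>q + r\<close>, which may differ when a factor vanishes in negative degree, so each keeps
  its own sign exponent.\<close>

lemma l2_op_formula:
  assumes f: "f \<in> cochains scale p" and A: "A \<in> cochains scale a" and B: "B \<in> cochains scale a'"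
    and g: "g \<in> cochains scale q" and \<eta>: "\<eta> \<in> cochains scale t"
  shows "l2_op sG sV (f, A + B) (g, \<eta>) = (sg p (bracket p q f g),
    bracket p t f \<eta> + sg (a * (q + 1)) (bracket q a g A) + sg (a' * (q + 1)) (bracket q a' g B))"
proof -
  have add: "additive_element (P, Q)" if "P \<in> cochains scale m" "Q \<in> cochains scale n" for P Q m n
    using that cochain_additive by (auto simp: additive_element_def)
  have z: "additive_element (g, 0)" "additive_element (0, \<eta>)" "additive_element (f, 0)"
    "additive_element (0, A)" "additive_element (0, B)" "additive_element (g, \<eta>)"
    using add p.cochains_zero f g A B \<eta> by blast+
  have vsG: "vector_space sG" "vector_space sV" by unfold_locales
  have "(f, A + B) = (f, 0) + (0, A) + (0, B)" "(g, \<eta>) = (g, 0) + (0, \<eta>)" by simp_all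
  then have "l2_op sG sV (f, A + B) (g, \<eta>) =
    l2_op sG sV (f, 0) (g, 0) + l2_op sG sV (f, 0) (0, \<eta>) +
    (l2_op sG sV (0, A) (g, 0) + l2_op sG sV (0, A) (0, \<eta>)) +
    (l2_op sG sV (0, B) (g, 0) + l2_op sG sV (0, B) (0, \<eta>))"
    by (metis l2_op_left(1)[OF z(6)] l2_op_right(1)[OF z(3)] l2_op_right(1)[OF z(4)] l2_op_right(1)[OF z(5)])
  then show ?thesis
    using l2_op_ff[OF vsG f g f f] l2_op_fh[OF vsG f f \<eta> f] l2_op_hf[OF vsG g g A A] l2_op_hh[OF vsG f f A \<eta>]
      l2_op_hf[OF vsG g g B B] l2_op_hh[OF vsG f f B \<eta>]
    by (simp add: p.cochain_scale_sign p.MN_bracket_eq[OF f g] p.MN_bracket_eq[OF f \<eta>]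
        p.MN_bracket_eq[OF g A] p.MN_bracket_eq[OF g B])
qed

lemma bracket_zero:
  assumes "P \<in> cochains scale m"
  shows "bracket p q P 0 = 0" "bracket p q 0 P = 0"
  using ins_prod_left(2)[of 0 0 P] ins_prod_right(2)[OF p.cochain_props(1)[OF assms], of 0 0]
  by (simp_all add: bracket_def)

lemma bracket_sg:
  assumes "P \<in> cochains scale m"
  shows "bracket p q P (sg n Q) = sg n (bracket p q P Q)" "bracket p q (sg n Q) P = sg n (bracket p q Q P)"
  using ins_prod_left(3)[of n Q P] ins_prod_right(3)[OF p.cochain_props(1)[OF assms], of n Q]
  by (simp_all add: bracket_def sg_diff add.commute)

lemma l2_op_formula1:
  assumes f: "f \<in> cochains scale p" and A: "A \<in> cochains scale a"
    and g: "g \<in> cochains scale q" and \<eta>: "\<eta> \<in> cochains scale t"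
  shows "l2_op sG sV (f, A) (g, \<eta>) = (sg p (bracket p q f g),
    bracket p t f \<eta> + sg (a * (q + 1)) (bracket q a g A))"
  using l2_op_formula[OF f A p.cochains_zero[of 0] g \<eta>] by (simp add: bracket_zero[OF g])

text \<open>Symmetry is \<open>bracket_skew\<close> in the first component and holds by construction
  in the second. The Jacobi expression splits by the number of factors from h: none in the first
  component, one in the second.\<close>

lemma l2_op_graded_binary: "graded_binary escale (sLh sG sV) (l2_op sG sV)"
proof
  show "graded_vector_space escale (sLh sG sV)" by (rule graded_sLh)
  fix X Y Z :: "('g, 'v) element" and c
  assume "X \<in> total_space escale (sLh sG sV)" "Y \<in> total_space escale (sLh sG sV)"
    "Z \<in> total_space escale (sLh sG sV)"
  then show "l2_op sG sV (X + Y) Z = l2_op sG sV X Z + l2_op sG sV Y Z \<and>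
      l2_op sG sV (escale c X) Z = escale c (l2_op sG sV X Z)"
    and "l2_op sG sV Z (X + Y) = l2_op sG sV Z X + l2_op sG sV Z Y \<and>
      l2_op sG sV Z (escale c X) = escale c (l2_op sG sV Z X)"
    using l2_op_left l2_op_right total_additive by blast+
next
  fix X Y i j assume X: "X \<in> sLh sG sV i" and Y: "Y \<in> sLh sG sV j"
  let ?p = "nat \<bar>i + 1\<bar>" and ?r = "nat \<bar>i\<bar>" and ?q = "nat \<bar>j + 1\<bar>" and ?t = "nat \<bar>j\<bar>"
  obtain f \<theta> g \<eta> where XY: "X = (f, \<theta>)" "Y = (g, \<eta>)" by (metis surj_pair)
  have f: "f \<in> cochains scale ?p" "equivariant scale dil 1 f" "i < -1 \<Longrightarrow> f = 0"
    and \<theta>: "\<theta> \<in> cochains scale ?r" "equivariant scale dil 2 \<theta>" "i < 0 \<Longrightarrow> \<theta> = 0"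
    and g: "g \<in> cochains scale ?q" "equivariant scale dil 1 g" "j < -1 \<Longrightarrow> g = 0"
    and \<eta>: "\<eta> \<in> cochains scale ?t" "equivariant scale dil 2 \<eta>" "j < 0 \<Longrightarrow> \<eta> = 0"
    using X Y by (auto simp: XY sLh_iff)
  note formula = l2_op_formula1[OF f(1) \<theta>(1) g(1) \<eta>(1)]
  have eq0: "equivariant scale dil c 0" for c by (rule p.equivariant_zero) (simp add: dil_def zero_prod_def)
  show "l2_op sG sV X Y \<in> sLh sG sV (i + j + 1)"
  proof (cases "i \<ge> -1 \<and> j \<ge> -1")
    case True
    have eqsg: "equivariant scale dil c (sg n P)" if "equivariant scale dil c P" for c n P
      using p.equivariant_scale[OF dil_linear that, of "(- 1) ^ n"] by (simp add: p.cochain_scale_sign)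
    have "nat \<bar>i + j + 1 + 1\<bar> = ?p + ?q" using True by linarith
    then have 1: "sg ?p (bracket ?p ?q f g) \<in> cochains scale (nat \<bar>i + j + 1 + 1\<bar>)"
      using p.bracket_cochain[OF f(1) g(1)] by (simp add: p.cochains_sg)
    \<comment> \<open>For negative \<open>j\<close> the cochain \<open>\<eta>\<close> is zero, so
      its nominal degree does no harm; the same reasoning applies to \<open>\<theta>\<close>
      below.\<close>
    have 2: "bracket ?p ?t f \<eta> \<in> cochains scale (nat \<bar>i + j + 1\<bar>)"
    proof (cases "j \<ge> 0")
      case True
      then have "nat \<bar>i + j + 1\<bar> = ?p + ?t" using \<open>i \<ge> -1 \<and> j \<ge> -1\<close> by linarith
      then show ?thesis using p.bracket_cochain[OF f(1) \<eta>(1)] by simp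
    qed (simp add: \<eta>(3) bracket_zero[OF f(1)] p.cochains_zero)
    have 3: "bracket ?q ?r g \<theta> \<in> cochains scale (nat \<bar>i + j + 1\<bar>)"
    proof (cases "i \<ge> 0")
      case True
      then have "nat \<bar>i + j + 1\<bar> = ?q + ?r" using \<open>i \<ge> -1 \<and> j \<ge> -1\<close> by linarith
      then show ?thesis using p.bracket_cochain[OF g(1) \<theta>(1)] by simp
    qed (simp add: \<theta>(3) bracket_zero[OF g(1)] p.cochains_zero)
    have "i + j + 1 < 0 \<Longrightarrow> \<theta> = 0 \<and> \<eta> = 0" using True \<theta>(3) \<eta>(3) by linarith
    then show ?thesis
      using 1 2 3 True p.equivariant_bracket[OF dil_linear f(1) g(1) f(2) g(2)]
        p.equivariant_bracket[OF dil_linear f(1) \<eta>(1) f(2) \<eta>(2)]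
        p.equivariant_bracket[OF dil_linear g(1) \<theta>(1) g(2) \<theta>(2)]
      unfolding XY formula sLh_iff
      by (auto simp: p.cochains_add p.cochains_sg eqsg p.equivariant_add[OF dil_linear]
          bracket_zero[OF f(1)] bracket_zero[OF g(1)])
  next
    case False
    \<comment> \<open>One of the two degrees lies below -1, where the graded piece is zero.\<close>
    then have "f = 0 \<and> \<theta> = 0 \<or> g = 0 \<and> \<eta> = 0" using f(3) \<theta>(3) g(3) \<eta>(3) by linarith
    then have "l2_op sG sV X Y = 0"
      unfolding XY formula
      using bracket_zero[OF f(1)] bracket_zero[OF g(1)] bracket_zero[OF \<theta>(1)] bracket_zero[OF \<eta>(1)]
      by (auto simp: prod_eq_iff)
    then show ?thesis by (simp add: sLh_iff p.cochains_zero eq0)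
  qed
  have par: "even ?p \<longleftrightarrow> odd i" "even ?q \<longleftrightarrow> odd j" "even ?r \<longleftrightarrow> even i" "even ?t \<longleftrightarrow> even j"
    by (simp_all add: even_nat_abs)
  show "l2_op sG sV Y X = sgz (i * j) (l2_op sG sV X Y)"
    unfolding XY formula l2_op_formula1[OF g(1) \<eta>(1) f(1) \<theta>(1)] bracket_skew[of ?q ?p g f]
    using par by (cases "even i"; cases "even j") (simp_all add: sgz_def sg_def add.commute)
next
  fix X Y Z i j k assume X: "X \<in> sLh sG sV i" and Y: "Y \<in> sLh sG sV j" and Z: "Z \<in> sLh sG sV k"
  define p r q t u w where "p = nat \<bar>i + 1\<bar>" and "r = nat \<bar>i\<bar>" and "q = nat \<bar>j + 1\<bar>"
    and "t = nat \<bar>j\<bar>" and "u = nat \<bar>k + 1\<bar>" and "w = nat \<bar>k\<bar>"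
  note defs = this
  have par: "even p \<longleftrightarrow> odd i" "even q \<longleftrightarrow> odd j" "even r \<longleftrightarrow> even i" "even t \<longleftrightarrow> even j"
     "even u \<longleftrightarrow> odd k" "even w \<longleftrightarrow> even k"
    by (simp_all add: defs even_nat_abs)
  obtain f \<theta> g \<eta> h \<zeta> where XYZ: "X = (f, \<theta>)" "Y = (g, \<eta>)" "Z = (h, \<zeta>)" by (metis surj_pair)
  have f: "f \<in> cochains scale p" and \<theta>: "\<theta> \<in> cochains scale r" and g: "g \<in> cochains scale q"
    and \<eta>: "\<eta> \<in> cochains scale t" and h: "h \<in> cochains scale u" and \<zeta>: "\<zeta> \<in> cochains scale w"
    using X Y Z by (auto simp: XYZ sLh_iff defs)
  have iter: "l2_op sG sV (l2_op sG sV (f, \<theta>) (g, \<eta>)) (h, \<zeta>) =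
    (sg (p + q) (sg p (bracket (p + q) u (bracket p q f g) h)),
     sg p (bracket (p + q) w (bracket p q f g) \<zeta>) +
     sg ((p + t) * (u + 1)) (bracket u (p + t) h (bracket p t f \<eta>)) +
     sg ((q + r) * (u + 1)) (sg (r * (q + 1)) (bracket u (q + r) h (bracket q r g \<theta>))))"
    if f: "f \<in> cochains scale p" and \<theta>: "\<theta> \<in> cochains scale r" and g: "g \<in> cochains scale q"
    and \<eta>: "\<eta> \<in> cochains scale t" and h: "h \<in> cochains scale u" and \<zeta>: "\<zeta> \<in> cochains scale w"
    for f \<theta> g \<eta> h \<zeta> p q r t u w
    unfolding l2_op_formula1[OF f \<theta> g \<eta>]
      l2_op_formula[OF p.cochains_sg[OF p.bracket_cochain[OF f g]] p.bracket_cochain[OF f \<eta>]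
        p.cochains_sg[OF p.bracket_cochain[OF g \<theta>]] h \<zeta>]
      bracket_sg[OF h] bracket_sg[OF \<zeta>] ..
  note props = p.cochain_props
  \<comment> \<open>One identity for the first component, and for the second component one for each
    of \<open>\<zeta>\<close>, \<open>\<eta>\<close>, \<open>\<theta>\<close> as the single factor
    from h.\<close>
  note jac = bracket_jacobi[OF props[OF f] props[OF g] props[OF h]]
    bracket_jacobi[OF props[OF f] props[OF g] props[OF \<zeta>]]
    bracket_jacobi[OF props[OF f] props[OF h] props[OF \<eta>]]
    bracket_jacobi[OF props[OF g] props[OF h] props[OF \<theta>]]
  show "l2_op sG sV (l2_op sG sV X Y) Z + sgz (j * k) (l2_op sG sV (l2_op sG sV X Z) Y) +
      sgz (i * (j + k)) (l2_op sG sV (l2_op sG sV Y Z) X) = 0"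
    unfolding XYZ iter[OF f \<theta> g \<eta> h \<zeta>] iter[OF f \<theta> h \<zeta> g \<eta>] iter[OF g \<eta> h \<zeta> f \<theta>] jac
      bracket_skew[of "p + u" q "bracket p u f h" g] bracket_skew[of "q + u" p "bracket q u g h" f]
    using par
    by (cases "even i"; cases "even j"; cases "even k") (simp_all add: sgz_def sg_def zero_prod_def)
qed

end

section \<open>Maurer-Cartan elements are pre-LieDer pairs\<close>

context semidirect
begin

lemma sLh_0_iff:
  "X \<in> sLh sG sV 0 \<longleftrightarrow> fst X \<in> L' sG sV 1 \<and> snd X \<in> h_space sG sV 0"
  by (simp add: sLh_def mem_Times_iff)

context
  fixes \<pi> :: "'g \<Rightarrow> 'g \<Rightarrow> 'g" and \<rho> \<mu> :: "'g \<Rightarrow> 'v \<Rightarrow> 'v" and D :: "'g \<Rightarrow> 'v"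
  assumes \<pi>: "bilinear_map sG sG sG \<pi>" and \<rho>: "bilinear_map sG sV sV \<rho>"
    and \<mu>: "bilinear_map sG sV sV \<mu>" and D: "Vector_Spaces.linear sG sV D"
begin

abbreviation \<Psi> :: "('g \<times> 'v) cochain" where
  "\<Psi> \<equiv> fst (pair_element sV \<pi> \<rho> (\<lambda>v x. \<mu> x v) D)"

abbreviation \<Delta> :: "('g \<times> 'v) cochain" where
  "\<Delta> \<equiv> snd (pair_element sV \<pi> \<rho> (\<lambda>v x. \<mu> x v) D)"

lemma structure_maps_linear:
  "\<pi> (x + y) z = \<pi> x z + \<pi> y z" "\<pi> (sG c x) z = sG c (\<pi> x z)"
  "\<pi> z (x + y) = \<pi> z x + \<pi> z y" "\<pi> z (sG c x) = sG c (\<pi> z x)"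
  "\<rho> (x + y) v = \<rho> x v + \<rho> y v" "\<rho> (sG c x) v = sV c (\<rho> x v)"
  "\<rho> x (v + v') = \<rho> x v + \<rho> x v'" "\<rho> x (sV c v) = sV c (\<rho> x v)"
  "\<mu> (x + y) v = \<mu> x v + \<mu> y v" "\<mu> (sG c x) v = sV c (\<mu> x v)"
  "\<mu> x (v + v') = \<mu> x v + \<mu> x v'" "\<mu> x (sV c v) = sV c (\<mu> x v)"
  "D (x + y) = D x + D y" "D (sG c x) = sV c (D x)"
  using \<pi> \<rho> \<mu> D by (simp_all add: bilinear_map_def Vector_Spaces.linear_iff)

lemma structure_maps_zero [simp]:
  "\<pi> 0 z = 0" "\<pi> z 0 = 0" "\<rho> 0 v = 0" "\<rho> x 0 = 0" "\<mu> 0 v = 0" "\<mu> x 0 = 0" "D 0 = 0"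
  using structure_maps_linear(1,5,9,13)[of 0 0] structure_maps_linear(3,7,11)[of _ 0 0] by simp_all

lemma structure_maps_diff:
  "\<pi> (x - y) z = \<pi> x z - \<pi> y z" "\<rho> (x - y) v = \<rho> x v - \<rho> y v"
  "\<rho> x (v - v') = \<rho> x v - \<rho> x v'" "\<mu> x (v - v') = \<mu> x v - \<mu> x v'"
  using structure_maps_linear(1)[of "x - y" y z] structure_maps_linear(5)[of "x - y" y v] structure_maps_linear(7)[of x "v - v'" v']
    structure_maps_linear(11)[of x "v - v'" v'] by (simp_all add: algebra_simps)

lemma pair_element_degree: "pair_element sV \<pi> \<rho> (\<lambda>v x. \<mu> x v) D \<in> sLh sG sV 0"
proof -
  have split1: "length us + 1 + length vs = Suc 0 \<longleftrightarrow> us = [] \<and> vs = []" for us vs :: "'g list" by auto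
  have dist: "length xs \<noteq> Suc 0" if "\<not> distinct xs" for xs :: "'g list"
    using that by (auto simp: length_Suc_conv)
  have vs: "vector_space sG" "vector_space sV" by unfold_locales
  have 1: "(\<lambda>xs y. if length xs = 1 then \<pi> (hd xs) y else 0) \<in> Hom_wedge sG sG sG 1"
    using vs dist by (auto simp: Hom_wedge_def multilinear_on_def split1 Vector_Spaces.linear_iff structure_maps_linear)
  have 2: "(\<lambda>xs v. if length xs = 1 then \<rho> (hd xs) v else 0) \<in> Hom_wedge sG sV sV 1"
    using vs dist by (auto simp: Hom_wedge_def multilinear_on_def split1 Vector_Spaces.linear_iff structure_maps_linear)
  have 3: "(\<lambda>xs v x. if xs = [] then \<mu> x v else 0) \<in> Hom_wedge2 sG sV sG sV 0"
    using vs by (auto simp: Hom_wedge2_def Hom_wedge_def multilinear_on_def Vector_Spaces.linear_iff structure_maps_linear)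
  have 4: "(\<lambda>xs x. if xs = [] then D x else 0) \<in> Hom_wedge sG sG sV 0"
    using vs by (auto simp: Hom_wedge_def multilinear_on_def Vector_Spaces.linear_iff structure_maps_linear)
  show ?thesis
    unfolding sLh_0_iff L'_def h_space_def pair_element_def using 1 2 3 4 by auto
qed

lemma \<Psi>_simps [simp]:
  "\<Psi> [] c = 0" "\<Psi> [a] c = (\<pi> (fst a) (fst c), \<rho> (fst a) (snd c) + \<mu> (fst c) (snd a))"
  "\<Psi> (a # b # xs) c = 0"
  by (auto simp: pair_element_def lift_ggg_def lift_gvv_def lift_gvgv_def zero_prod_def
      intro!: sum.neutral simp: less_Suc_eq_0_disj)

lemma \<Delta>_simps [simp]: "\<Delta> [] c = (0, D (fst c))" "\<Delta> (a # xs) c = 0"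
  by (simp_all add: pair_element_def lift_ggv_def zero_prod_def)

lemma \<Psi>_cochain: "\<Psi> \<in> cochains scale 1" and \<Delta>_cochain: "\<Delta> \<in> cochains scale 0"
  using pair_element_degree by (auto simp: sLh_iff)

text \<open>In odd degree the graded commutator of a cochain with itself is twice its insertion. The
  alternation of \<open>\<Psi>\<close> is the commutator of the product, so the difference of two
  associators remains.\<close>

lemma bracket_\<Psi>_\<Psi>:
  "bracket 1 1 \<Psi> \<Psi> [a, b] c = scale 2
    (\<Psi> [\<Psi> [a] b - \<Psi> [b] a] c + \<Psi> [b] (\<Psi> [a] c) - \<Psi> [a] (\<Psi> [b] c))"
proof -
  have "ins_prod \<Psi> \<Psi> [a, b] c = \<Psi> [\<Psi> [a] b - \<Psi> [b] a] c + \<Psi> [b] (\<Psi> [a] c) - \<Psi> [a] (\<Psi> [b] c)"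
    by (simp add: ins_prod_def alternation_def zero_prod_def algebra_simps)
  then show ?thesis
    using p.scale_left_distrib[of 1 1] by (simp add: bracket_def)
qed

lemma bracket_\<Psi>_\<Delta>: "bracket 1 0 \<Psi> \<Delta> [a] c = \<Psi> [\<Delta> [] a] c + \<Psi> [a] (\<Delta> [] c) - \<Delta> [] (\<Psi> [a] c)"
  by (simp add: bracket_def ins_prod_def alternation_def zero_prod_def)

text \<open>\<open>\<Delta>\<close> may stand in either argument, so its bracket with
  \<open>\<Psi>\<close> occurs twice; the factor 2 is cancelled in characteristic 0.\<close>

lemma l2_op_pair_element:
  "l2_op sG sV (pair_element sV \<pi> \<rho> (\<lambda>v x. \<mu> x v) D) (pair_element sV \<pi> \<rho> (\<lambda>v x. \<mu> x v) D) = 0 \<longleftrightarrow>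
   bracket 1 1 \<Psi> \<Psi> = 0 \<and> bracket 1 0 \<Psi> \<Delta> = 0"
proof -
  have two: "F + F = 0 \<longleftrightarrow> F = 0" for F :: "('g \<times> 'v) cochain"
  proof
    assume *: "F + F = 0"
    have "scale 2 (F xs y) = 0" for xs y
      using fun_cong[OF fun_cong[OF *], of xs y] p.scale_left_distrib[of 1 1] by simp
    then show "F = 0" by (simp add: fun_eq_iff)
  qed simp
  have "l2_op sG sV (\<Psi>, \<Delta>) (\<Psi>, \<Delta>) = (sg 1 (bracket 1 1 \<Psi> \<Psi>), bracket 1 0 \<Psi> \<Delta> + bracket 1 0 \<Psi> \<Delta>)"
    using l2_op_formula1[OF \<Psi>_cochain \<Delta>_cochain \<Psi>_cochain \<Delta>_cochain] by simp
  then show ?thesis using two by (simp add: zero_prod_def)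
qed

lemma bracket_\<Psi>_\<Psi>_eq_0:
  "bracket 1 1 \<Psi> \<Psi> = 0 \<longleftrightarrow> (\<forall>a b c. \<Psi> [\<Psi> [a] b - \<Psi> [b] a] c + \<Psi> [b] (\<Psi> [a] c) - \<Psi> [a] (\<Psi> [b] c) = 0)"
proof
  assume "bracket 1 1 \<Psi> \<Psi> = 0"
  then have "scale 2 (\<Psi> [\<Psi> [a] b - \<Psi> [b] a] c + \<Psi> [b] (\<Psi> [a] c) - \<Psi> [a] (\<Psi> [b] c)) = 0" for a b c
    unfolding bracket_\<Psi>_\<Psi>[symmetric] by simp
  then show "\<forall>a b c. \<Psi> [\<Psi> [a] b - \<Psi> [b] a] c + \<Psi> [b] (\<Psi> [a] c) - \<Psi> [a] (\<Psi> [b] c) = 0"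
    by (simp only: p.scale_eq_0_iff) simp
next
  assume *: "\<forall>a b c. \<Psi> [\<Psi> [a] b - \<Psi> [b] a] c + \<Psi> [b] (\<Psi> [a] c) - \<Psi> [a] (\<Psi> [b] c) = 0"
  have "bracket 1 1 \<Psi> \<Psi> xs c = 0" for xs c
  proof (cases "length xs = 2")
    case True
    then obtain a b where xs: "xs = [a, b]" by (auto simp: length_Suc_conv numeral_2_eq_2)
    show ?thesis unfolding xs bracket_\<Psi>_\<Psi> using * by (simp only: p.scale_zero_right)
  next
    case False
    then show ?thesis
      using p.cochainD(5)[OF p.bracket_cochain[OF \<Psi>_cochain \<Psi>_cochain], of xs c] by simp
  qed
  then show "bracket 1 1 \<Psi> \<Psi> = 0" by (simp add: fun_eq_iff)
qed

lemma bracket_\<Psi>_\<Delta>_eq_0: "bracket 1 0 \<Psi> \<Delta> = 0 \<longleftrightarrow> (\<forall>x y. D (\<pi> x y) = \<rho> x (D y) + \<mu> y (D x))"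
proof
  assume "bracket 1 0 \<Psi> \<Delta> = 0"
  then have "\<Psi> [\<Delta> [] (x, 0)] (y, 0) + \<Psi> [(x, 0)] (\<Delta> [] (y, 0)) - \<Delta> [] (\<Psi> [(x, 0)] (y, 0)) = 0" for x y
    unfolding bracket_\<Psi>_\<Delta>[symmetric] by simp
  then show "\<forall>x y. D (\<pi> x y) = \<rho> x (D y) + \<mu> y (D x)"
    by (simp add: zero_prod_def algebra_simps)
next
  assume *: "\<forall>x y. D (\<pi> x y) = \<rho> x (D y) + \<mu> y (D x)"
  have "bracket 1 0 \<Psi> \<Delta> xs c = 0" for xs c
  proof (cases "length xs = 1")
    case True
    then obtain a where xs: "xs = [a]" by (auto simp: length_Suc_conv)
    show ?thesis unfolding xs bracket_\<Psi>_\<Delta> using * by (simp add: zero_prod_def)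
  next
    case False
    then show ?thesis
      using p.cochainD(5)[OF p.bracket_cochain[OF \<Psi>_cochain \<Delta>_cochain], of xs c] by simp
  qed
  then show "bracket 1 0 \<Psi> \<Delta> = 0" by (simp add: fun_eq_iff)
qed

text \<open>The first condition says that the semidirect product on \<open>g \<oplus> V\<close> is a pre-Lie algebra.\<close>

lemma semidirect_pre_Lie:
  "(\<forall>a b c. \<Psi> [\<Psi> [a] b - \<Psi> [b] a] c + \<Psi> [b] (\<Psi> [a] c) - \<Psi> [a] (\<Psi> [b] c) = 0) \<longleftrightarrow>
   (\<forall>x y z. \<pi> (\<pi> x y) z - \<pi> x (\<pi> y z) = \<pi> (\<pi> y x) z - \<pi> y (\<pi> x z)) \<and>
   (\<forall>x y v. \<rho> (sub_adjacent_bracket \<pi> x y) v = \<rho> x (\<rho> y v) - \<rho> y (\<rho> x v)) \<and>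
   (\<forall>x y v. \<mu> y (\<mu> x v) - \<mu> (\<pi> x y) v = \<mu> y (\<rho> x v) - \<rho> x (\<mu> y v))"
    (is "?L \<longleftrightarrow> ?A \<and> ?B \<and> ?C")
proof (intro iffI conjI allI)
  assume L: ?L
  fix x y z v
  \<comment> \<open>The three conditions come from arguments in g, g, g, in g, g, V and in g, V, g.
    The case V, g, g is the last one up to sign, as the expression is antisymmetric in
    \<open>a\<close> and \<open>b\<close>.\<close>
  show "\<pi> (\<pi> x y) z - \<pi> x (\<pi> y z) = \<pi> (\<pi> y x) z - \<pi> y (\<pi> x z)"
    using L[rule_format, of "(x, 0)" "(y, 0)" "(z, 0)"]
    by (simp add: zero_prod_def structure_maps_diff algebra_simps)
  show "\<rho> (sub_adjacent_bracket \<pi> x y) v = \<rho> x (\<rho> y v) - \<rho> y (\<rho> x v)"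
    using L[rule_format, of "(x, 0)" "(y, 0)" "(0, v)"]
    by (simp add: zero_prod_def sub_adjacent_bracket_def structure_maps_diff algebra_simps)
  show "\<mu> y (\<mu> x v) - \<mu> (\<pi> x y) v = \<mu> y (\<rho> x v) - \<rho> x (\<mu> y v)"
    using L[rule_format, of "(x, 0)" "(0, v)" "(y, 0)"]
    by (simp add: zero_prod_def structure_maps_diff algebra_simps)
next
  assume R: "?A \<and> ?B \<and> ?C"
  fix a b c :: "'g \<times> 'v"
  obtain x u y v z w where abc: "a = (x, u)" "b = (y, v)" "c = (z, w)" by (metis surj_pair)
  have "\<pi> (\<pi> x y) z = \<pi> x (\<pi> y z) + \<pi> (\<pi> y x) z - \<pi> y (\<pi> x z)"
    using R by (simp add: algebra_simps)
  moreover have "\<rho> (\<pi> x y) w = \<rho> (\<pi> y x) w + \<rho> x (\<rho> y w) - \<rho> y (\<rho> x w)"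
    using R by (simp add: sub_adjacent_bracket_def structure_maps_diff algebra_simps)
  \<comment> \<open>The condition on \<open>\<mu>\<close> is used for the V-component of
    \<open>b\<close> and, with roles exchanged, for that of \<open>a\<close>.\<close>
  moreover have "\<mu> z (\<mu> x v) = \<mu> (\<pi> x z) v + \<mu> z (\<rho> x v) - \<rho> x (\<mu> z v)"
    "\<mu> z (\<mu> y u) = \<mu> (\<pi> y z) u + \<mu> z (\<rho> y u) - \<rho> y (\<mu> z u)"
    using R by (simp_all add: algebra_simps)
  ultimately show "\<Psi> [\<Psi> [a] b - \<Psi> [b] a] c + \<Psi> [b] (\<Psi> [a] c) - \<Psi> [a] (\<Psi> [b] c) = 0"
    by (simp add: abc zero_prod_def structure_maps_diff structure_maps_linear)
qed

lemma pre_LieDer_pair_iff: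
  "pre_LieDer_pair sG sV \<pi> D \<rho> \<mu> \<longleftrightarrow>
   l2_op sG sV (pair_element sV \<pi> \<rho> (\<lambda>v x. \<mu> x v) D) (pair_element sV \<pi> \<rho> (\<lambda>v x. \<mu> x v) D) = 0"
  unfolding l2_op_pair_element bracket_\<Psi>_\<Psi>_eq_0 bracket_\<Psi>_\<Delta>_eq_0 semidirect_pre_Lie
  using \<pi> \<rho> \<mu> D vs1.vector_space_axioms vs2.vector_space_axioms
  by (auto simp: pre_LieDer_pair_def pre_Lie_algebra_def pre_Lie_representation_def)

end

end

lemma pair_element_add:
  assumes "vector_space sV"
  shows "pair_element sV (\<pi> + \<pi>') (\<rho> + \<rho>') (\<mu> + \<mu>') (D + D') =
    pair_element sV \<pi> \<rho> \<mu> D + pair_element sV \<pi>' \<rho>' \<mu>' D'"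
proof -
  interpret vector_space sV by fact
  show ?thesis
    by (auto simp: pair_element_def lift_ggg_def lift_gvv_def lift_gvgv_def lift_ggv_def fun_eq_iff
        scale_right_distrib sum.distrib[symmetric] le_Suc_eq intro!: sum.cong)
qed

lemma bilinear_map_add:
  assumes "bilinear_map sA sB sC f" "bilinear_map sA sB sC g"
  shows "bilinear_map sA sB sC (f + g)"
proof -
  have "vector_space sC" using assms(1) by (auto simp: bilinear_map_def Vector_Spaces.linear_iff)
  then interpret vector_space sC .
  show ?thesis using assms by (auto simp: bilinear_map_def Vector_Spaces.linear_iff scale_right_distrib)
qed

theorem theorem3p10:
  fixes sG :: "'k::{alg_closed_field, field_char_0} \<Rightarrow> 'g::ab_group_add \<Rightarrow> 'g"
    and sV :: "'k \<Rightarrow> 'v::ab_group_add \<Rightarrow> 'v"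
    and \<pi> :: "'g \<Rightarrow> 'g \<Rightarrow> 'g" and D :: "'g \<Rightarrow> 'v" and \<rho> \<mu> :: "'g \<Rightarrow> 'v \<Rightarrow> 'v"
  assumes "pre_LieDer_pair sG sV \<pi> D \<rho> \<mu>"
  shows
    "let s = element_scale sG sV; E = sLh sG sV; l = untwisted_l sG sV;
         \<alpha> = pair_element sV \<pi> \<rho> (\<lambda>v x. \<mu> x v) D; l\<alpha> = twist s l \<alpha>
     in maurer_cartan s E l \<alpha> \<and>
        L_infinity_algebra s E l\<alpha> \<and>
        (\<forall>x \<in> total_space s E. l\<alpha> 1 [x] = l 2 [\<alpha>, x]) \<and>
        (\<forall>x \<in> total_space s E. \<forall>y \<in> total_space s E. l\<alpha> 2 [x, y] = l 2 [x, y]) \<and>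
        (\<forall>k\<ge>3. \<forall>xs. length xs = k \<and> set xs \<subseteq> total_space s E \<longrightarrow> l\<alpha> k xs = 0) \<and>
        (\<forall>\<pi>' \<rho>' \<mu>' D'.
           bilinear_map sG sG sG \<pi>' \<and> bilinear_map sG sV sV \<rho>' \<and> bilinear_map sV sG sV \<mu>' \<and>
           Vector_Spaces.linear sG sV D' \<longrightarrow>
           (pre_LieDer_pair sG sV (\<pi> + \<pi>') (D + D') (\<rho> + \<rho>') (\<mu> + (\<lambda>x v. \<mu>' v x)) \<longleftrightarrow>
            maurer_cartan s E l\<alpha> (pair_element sV \<pi>' \<rho>' \<mu>' D')))"
proof -
  let ?\<alpha> = "pair_element sV \<pi> \<rho> (\<lambda>v x. \<mu> x v) D"
  have maps: "bilinear_map sG sG sG \<pi>" "bilinear_map sG sV sV \<rho>" "bilinear_map sG sV sV \<mu>"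
    "Vector_Spaces.linear sG sV D"
    and vs: "vector_space sG" "vector_space sV"
    using assms by (auto simp: pre_LieDer_pair_def pre_Lie_algebra_def pre_Lie_representation_def)
  interpret W: semidirect sG sV
    using vs by (simp add: semidirect_def vector_space_prod_def vector_space_pair_def)
  interpret B: graded_binary "element_scale sG sV" "sLh sG sV" "l2_op sG sV"
    by (rule W.l2_op_graded_binary)
  have \<alpha>: "?\<alpha> \<in> sLh sG sV 0" by (rule W.pair_element_degree[OF maps])
  have MC: "l2_op sG sV ?\<alpha> ?\<alpha> = 0" using assms W.pre_LieDer_pair_iff[OF maps] by simp
  have l: "untwisted_l sG sV = binary_op (l2_op sG sV)"
    by (simp add: untwisted_l_def binary_op_def fun_eq_iff)
  have "pre_LieDer_pair sG sV (\<pi> + \<pi>') (D + D') (\<rho> + \<rho>') (\<mu> + (\<lambda>x v. \<mu>' v x)) \<longleftrightarrow>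
      maurer_cartan (element_scale sG sV) (sLh sG sV) (twist (element_scale sG sV) (binary_op (l2_op sG sV)) ?\<alpha>)
        (pair_element sV \<pi>' \<rho>' \<mu>' D')"
    if maps': "bilinear_map sG sG sG \<pi>'" "bilinear_map sG sV sV \<rho>'" "bilinear_map sV sG sV \<mu>'"
      "Vector_Spaces.linear sG sV D'" for \<pi>' \<rho>' \<mu>' D'
  proof -
    have \<mu>': "bilinear_map sG sV sV (\<lambda>x v. \<mu>' v x)"
      using maps'(3) by (simp add: bilinear_map_def)
    have D': "Vector_Spaces.linear sG sV (D + D')"
      using maps(4) maps'(4) W.vs2.scale_right_distrib by (auto simp: Vector_Spaces.linear_iff)
    \<comment> \<open>Reconciles the two argument orders: \<open>pair_element\<close> takes the
      vector first. Then additivity of \<open>pair_element\<close> identifies the element of the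
      deformed pair with \<open>\<alpha> + \<beta>\<close>, and both sides say that
      \<open>l2_op\<close> vanishes on it.\<close>
    have "(\<lambda>v x. (\<mu> + (\<lambda>x v. \<mu>' v x)) x v) = (\<lambda>v x. \<mu> x v) + \<mu>'" by (simp add: fun_eq_iff)
    then show ?thesis
      unfolding B.maurer_cartan_twist[OF \<alpha> MC W.pair_element_degree[OF maps'(1,2) \<mu>' maps'(4)]]
        W.pre_LieDer_pair_iff[OF bilinear_map_add[OF maps(1) maps'(1)] bilinear_map_add[OF maps(2) maps'(2)]
          bilinear_map_add[OF maps(3) \<mu>'] D']
      by (simp only: pair_element_add[OF vs(2)])
  qed
  then show ?thesis
    unfolding Let_def l
    using B.maurer_cartan_binary_op[OF \<alpha>] B.twist_L_infinity[OF \<alpha> MC] B.twist_1[OF \<alpha> MC]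
      B.twist_2[OF \<alpha> MC] B.twist_ge_3[OF \<alpha> MC] MC
    by (simp add: binary_op_def)
qed

end
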